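(* Let $M_t$ be a family of smooth closed strictly convex surfaces in $\mathbb{R}^3$ moving according to $\frac{d}{dt}X=\frac1H\nu$. Then both $$\max_{M_t}\frac{(\lambda_1-\lambda_2)^2}{2(\lambda_1+\lambda_2)\lambda_1\lambda_2}\qquad\text{and}\qquad\max_{M_t}\frac{(\lambda_1^2+\lambda_2^2)(\lambda_1-\lambda_2)^2}{8(\lambda_1+\lambda_2)\lambda_1^3\lambda_2^3}$$ are non-increasing in time.
   Context: $X$ denotes the embedding, $\nu$ the outer unit normal, $\lambda_1,\lambda_2>0$ the principal curvatures, $H=\lambda_1+\lambda_2$. *)

theory Defs
  imports "HOL-Analysis.Analysis"
begin

fun Ck :: "nat \<Rightarrow> ('a::euclidean_space \<Rightarrow> 'b::real_normed_vector) \<Rightarrow> 'a set \<Rightarrow> bool" where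
  "Ck 0 f S = continuous_on S f"
| "Ck (Suc k) f S = (f differentiable_on S \<and>
      (\<forall>v. Ck k (\<lambda>x. frechet_derivative f (at x) v) S))"

definition smooth_on :: "'a::euclidean_space set \<Rightarrow> ('a \<Rightarrow> 'b::real_normed_vector) \<Rightarrow> bool" where
  "smooth_on S f = (\<forall>k. Ck k f S)"

(* Surfaces are parametrized over the unit sphere S^2 (maps defined on an open
   neighbourhood of it); tangent vectors at p are the v with v \<bullet> p = 0.
   Principal curvatures at p of the surface X with unit normal N: the eigenvalues l
   of the Weingarten map, i.e. dN_p(v) = l * dX_p(v) for some nonzero tangent v. *)
definition princ_curvs :: "(real^3 \<Rightarrow> real^3) \<Rightarrow> (real^3 \<Rightarrow> real^3) \<Rightarrow> real^3 \<Rightarrow> real set" where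
  "princ_curvs X N p = {l. \<exists>v. v \<bullet> p = 0 \<and> v \<noteq> 0 \<and>
      frechet_derivative N (at p) v = l *\<^sub>R frechet_derivative X (at p) v}"

definition lambda1 :: "(real^3 \<Rightarrow> real^3) \<Rightarrow> (real^3 \<Rightarrow> real^3) \<Rightarrow> real^3 \<Rightarrow> real" where
  "lambda1 X N p = Min (princ_curvs X N p)"

definition lambda2 :: "(real^3 \<Rightarrow> real^3) \<Rightarrow> (real^3 \<Rightarrow> real^3) \<Rightarrow> real^3 \<Rightarrow> real" where
  "lambda2 X N p = Max (princ_curvs X N p)"

definition mean_curv :: "(real^3 \<Rightarrow> real^3) \<Rightarrow> (real^3 \<Rightarrow> real^3) \<Rightarrow> real^3 \<Rightarrow> real" where
  "mean_curv X N p = lambda1 X N p + lambda2 X N p"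

end

theory Submission
  imports Defs
begin

text \<open>Parametrize by the Gauss map: for the support function \<open>h\<close> at a fixed normal the flow becomes
  \<open>h\<^sub>t = F = r1 r2 / (r1 + r2)\<close>, where \<open>r1\<close>, \<open>r2\<close> are the principal radii, so the radii satisfy a
  parabolic equation whose operator \<open>F\<close> is concave.  With \<open>\<sigma> = r1 + r2\<close> the two quantities are
  \<open>(\<sigma> - 4 F) / 2\<close> and \<open>\<sigma> (\<sigma> - 2 F) (\<sigma> - 4 F) / 8\<close>.  At a spatial maximum the time derivative is at most
  a zero order term, which has a sign, plus gradient terms.  For the first quantity these are non-positive by
  concavity of \<open>F\<close>; for the second one the vanishing of the gradient reduces them to
  a polynomial inequality in \<open>r1\<close>, \<open>r2\<close>.  Passing to the Gauss parametrization does not change the time derivative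
  at a spatial maximum.  No inverse function theorem is needed: the coordinate fields \<open>\<partial>\<close> of the
  Gauss image are written down as vector fields on the original domain, where they commute because they are dual
  to a coordinate system.\<close>

section \<open>Smooth functions\<close>

text \<open>Two obstacles shape the proof. \<open>lambda1\<close> and \<open>lambda2\<close> are a
  \<open>Min\<close> and a \<open>Max\<close>, which may fail to be differentiable at umbilic
  points; so only symmetric functions of them are differentiated, written through a trace
  \<open>T\<close> and a determinant \<open>D\<close> of the Hessian of the support function.
  Covariant derivatives on the sphere would bring in Christoffel symbols; instead the support
  function is extended one-homogeneously and restricted to an affine plane, where the Hessian
  consists of plain second derivatives. The price is the factor \<open>\<rho>\<close>: its second
  derivative and the quadratic terms of \<open>T\<close> carry all the curvature of the sphere. As a
  chart can be centred at any given maximum, evolution is computed only from the jet at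
  \<open>A = B = 0\<close>. Time derivatives transfer because \<open>a0\<close> differs from
  \<open>dt\<close> by a combination of \<open>a1\<close> and \<open>a2\<close>, which annihilate
  the quantity at a spatial maximum. Strict convexity acts twice: 0 is not a principal curvature, so
  the Gauss map has invertible differential, and positive curvatures make the radii
  positive.\<close>

lemma Ck_SucD:
  assumes "open S" "Ck (Suc k) f S"
  shows "\<And>x. x \<in> S \<Longrightarrow> (f has_derivative frechet_derivative f (at x)) (at x)"
    and "\<And>v. Ck k (\<lambda>x. frechet_derivative f (at x) v) S"
  using assms by (simp_all add: differentiable_on_eq_differentiable_at frechet_derivative_works[symmetric])

lemma Ck_cong:
  assumes "open S" and "\<And>x. x \<in> S \<Longrightarrow> f x = g x"
  shows "Ck k f S \<longleftrightarrow> Ck k g S"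
  using assms(2)
proof (induction k arbitrary: f g)
  case 0
  then show ?case by (auto cong: continuous_on_cong)
next
  case (Suc k)
  have *: "Ck (Suc k) g S" if fg: "\<And>x. x \<in> S \<Longrightarrow> f x = g x" and C: "Ck (Suc k) f S" for f g :: "'a \<Rightarrow> 'b"
  proof -
    have d: "(g has_derivative frechet_derivative f (at x)) (at x)" if "x \<in> S" for x
      using has_derivative_transform_within_open[OF Ck_SucD(1)[OF assms(1) C that] assms(1) that fg] .
    have "Ck k (\<lambda>x. frechet_derivative g (at x) v) S" for v
      using Ck_SucD(2)[OF assms(1) C, of v] frechet_derivative_at[OF d]
        Suc.IH[of "\<lambda>x. frechet_derivative f (at x) v" "\<lambda>x. frechet_derivative g (at x) v"] by metis
    then show ?thesis
      using assms(1) d by (auto simp: differentiable_on_eq_differentiable_at differentiable_def)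
  qed
  show ?case using *[of f g] *[of g f] Suc.prems by metis
qed

lemma Ck_SucI:
  assumes "open S" and d: "\<And>x. x \<in> S \<Longrightarrow> (f has_derivative f' x) (at x)"
    and "\<And>v. Ck k (\<lambda>x. f' x v) S"
  shows "Ck (Suc k) f S"
proof -
  have "Ck k (\<lambda>x. frechet_derivative f (at x) v) S" for v
    using assms(3)[of v] frechet_derivative_at[OF d]
      Ck_cong[OF assms(1), of "\<lambda>x. f' x v" "\<lambda>x. frechet_derivative f (at x) v"] by metis
  then show ?thesis
    using assms(1,2) by (auto simp: differentiable_on_eq_differentiable_at differentiable_def)
qed

lemma Ck_Suc_imp_Ck: "open S \<Longrightarrow> Ck (Suc k) f S \<Longrightarrow> Ck k f S"
proof (induction k arbitrary: f)
  case 0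
  then show ?case by (auto intro: differentiable_imp_continuous_on)
next
  case (Suc k)
  note d = Ck_SucD[OF Suc.prems]
  show ?case by (rule Ck_SucI[OF Suc.prems(1) d(1)]) (use Suc.IH Suc.prems(1) d(2) in blast)+
qed

lemma Ck_const: "open S \<Longrightarrow> Ck k (\<lambda>x. c) S"
  by (induction k arbitrary: c) simp_all

lemma Ck_linear_compose:
  assumes "open S" "bounded_linear L"
  shows "Ck k f S \<Longrightarrow> Ck k (\<lambda>x. L (f x)) S"
proof (induction k arbitrary: f)
  case 0
  then show ?case using assms(2) by (auto intro: bounded_linear.continuous_on)
next
  case (Suc k)
  note d = Ck_SucD[OF assms(1) Suc.prems]
  show ?case
    by (rule Ck_SucI[OF assms(1) bounded_linear.has_derivative[OF assms(2) d(1)]])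
      (use Suc.IH d(2) assms(1) in auto)
qed

lemma Ck_add:
  assumes "open S"
  shows "Ck k f S \<Longrightarrow> Ck k g S \<Longrightarrow> Ck k (\<lambda>x. f x + g x) S"
proof (induction k arbitrary: f g)
  case 0
  then show ?case by (auto intro: continuous_on_add)
next
  case (Suc k)
  note d = Ck_SucD[OF assms Suc.prems(1)] Ck_SucD[OF assms Suc.prems(2)]
  show ?case
    by (rule Ck_SucI[OF assms has_derivative_add[OF d(1) d(3)]]) (use Suc.IH d(2,4) assms in auto)
qed

lemma Ck_sum:
  assumes "open S" "finite I"
  shows "(\<And>i. i \<in> I \<Longrightarrow> Ck k (f i) S) \<Longrightarrow> Ck k (\<lambda>x. \<Sum>i\<in>I. f i x) S"
  using assms(2) by (induction I) (auto intro!: Ck_const Ck_add assms(1))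

lemma Ck_bilinear:
  assumes "open S" and b: "bounded_bilinear B"
  shows "Ck k f S \<Longrightarrow> Ck k g S \<Longrightarrow> Ck k (\<lambda>x. B (f x) (g x)) S"
proof (induction k arbitrary: f g)
  case 0
  then show ?case using bounded_bilinear.continuous_on[OF b] by auto
next
  case (Suc k)
  note d = Ck_SucD[OF assms(1) Suc.prems(1)] Ck_SucD[OF assms(1) Suc.prems(2)]
  show ?case
    by (rule Ck_SucI[OF assms(1) bounded_bilinear.FDERIV[OF b d(1) d(3)]])
      (assumption | rule Ck_add Suc.IH d(2,4) assms(1) Ck_Suc_imp_Ck[OF assms(1) Suc.prems(1)]
        Ck_Suc_imp_Ck[OF assms(1) Suc.prems(2)])+
qed

text \<open>\<open>Ck\<close> controls derivatives in fixed directions only, whereas the chain rule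
  differentiates \<open>f\<close> in a direction that moves with \<open>x\<close>. Expanding that
  direction in \<open>Basis\<close> leaves fixed directions, to which the induction hypothesis
  applies.\<close>

lemma Ck_compose:
  fixes g :: "'a::euclidean_space \<Rightarrow> 'b::euclidean_space" and f :: "'b \<Rightarrow> 'c::real_normed_vector"
  assumes S: "open S" and T: "open T" and sub: "\<And>x. x \<in> S \<Longrightarrow> g x \<in> T"
  shows "Ck k f T \<Longrightarrow> Ck k g S \<Longrightarrow> Ck k (\<lambda>x. f (g x)) S"
proof (induction k arbitrary: f)
  case 0
  then show ?case using sub by (auto intro: continuous_on_compose2)
next
  case (Suc k)
  note d = Ck_SucD[OF T Suc.prems(1)] Ck_SucD[OF S Suc.prems(2)]
  show ?case
  proof (rule Ck_SucI[OF S])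
    fix x assume x: "x \<in> S"
    let ?f' = "frechet_derivative f (at (g x))" and ?g' = "frechet_derivative g (at x)"
    have "((\<lambda>x. f (g x)) has_derivative (\<lambda>v. ?f' (?g' v))) (at x)"
      using has_derivative_compose[OF d(3)[OF x] d(1)[OF sub[OF x]]] .
    moreover have rep: "?f' w = (\<Sum>b\<in>Basis. (w \<bullet> b) *\<^sub>R ?f' b)" for w
    proof -
      have lin: "linear ?f'" using d(1)[OF sub[OF x]] by (rule has_derivative_linear)
      have "?f' w = ?f' (\<Sum>b\<in>Basis. (w \<bullet> b) *\<^sub>R b)" by (simp add: euclidean_representation)
      then show ?thesis by (simp add: linear_sum[OF lin] linear_cmul[OF lin])
    qed
    ultimately show "((\<lambda>x. f (g x)) has_derivative
        (\<lambda>v. \<Sum>b\<in>Basis. (?g' v \<bullet> b) *\<^sub>R ?f' b)) (at x)"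
      by (subst rep[symmetric]) 
  next
    fix v
    show "Ck k (\<lambda>x. \<Sum>b\<in>Basis. (frechet_derivative g (at x) v \<bullet> b) *\<^sub>R frechet_derivative f (at (g x)) b) S"
      by (intro Ck_sum Ck_bilinear[OF _ bounded_bilinear_scaleR] Ck_bilinear[OF _ bounded_bilinear_inner]
          Ck_const S finite_Basis d Suc.IH Ck_Suc_imp_Ck[OF S Suc.prems(2)])
  qed
qed

lemma Ck_inverse:
  fixes f :: "'a::euclidean_space \<Rightarrow> real"
  assumes "open S" and nz: "\<And>x. x \<in> S \<Longrightarrow> f x \<noteq> 0"
  shows "Ck k f S \<Longrightarrow> Ck k (\<lambda>x. inverse (f x)) S"
proof (induction k)
  case 0
  then show ?case using nz by (auto intro!: continuous_on_inverse)
next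
  case (Suc k)
  note d = Ck_SucD[OF assms(1) Suc.prems(1)]
  note m = Ck_bilinear[OF assms(1) bounded_bilinear_mult]
  have i: "Ck k (\<lambda>x. inverse (f x)) S" using Suc Ck_Suc_imp_Ck[OF assms(1)] by blast
  show ?case
  proof (rule Ck_SucI[OF assms(1) Deriv.has_derivative_inverse[OF nz d(1)]])
    fix v
    have "Ck k (\<lambda>x. (- 1) * (inverse (f x) * frechet_derivative f (at x) v * inverse (f x))) S"
      by (intro m i d Ck_const assms(1))
    then show "Ck k (\<lambda>x. - (inverse (f x) * frechet_derivative f (at x) v * inverse (f x))) S"
      by simp
  qed (use assms(1) in auto)
qed

context
  fixes S :: "'a::euclidean_space set"
  assumes S: "open S"
begin

lemma smooth_on_cong: "(\<And>x. x \<in> S \<Longrightarrow> f x = g x) \<Longrightarrow> smooth_on S f \<longleftrightarrow> smooth_on S g"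
  using Ck_cong[OF S, of f g] by (auto simp: smooth_on_def)

lemma smooth_on_const: "smooth_on S (\<lambda>x. c)"
  using S by (simp add: smooth_on_def Ck_const)

lemma smooth_on_add: "smooth_on S f \<Longrightarrow> smooth_on S g \<Longrightarrow> smooth_on S (\<lambda>x. f x + g x)"
  using S by (simp add: smooth_on_def Ck_add)

lemma smooth_on_sum: "finite I \<Longrightarrow> (\<And>i. i \<in> I \<Longrightarrow> smooth_on S (f i)) \<Longrightarrow> smooth_on S (\<lambda>x. \<Sum>i\<in>I. f i x)"
  using S by (simp add: smooth_on_def Ck_sum)

lemma smooth_on_linear_compose: "bounded_linear L \<Longrightarrow> smooth_on S f \<Longrightarrow> smooth_on S (\<lambda>x. L (f x))"
  using S by (simp add: smooth_on_def Ck_linear_compose)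

lemma smooth_on_bilinear:
  "bounded_bilinear B \<Longrightarrow> smooth_on S f \<Longrightarrow> smooth_on S g \<Longrightarrow> smooth_on S (\<lambda>x. B (f x) (g x))"
  using S by (simp add: smooth_on_def Ck_bilinear)

lemmas smooth_on_mult = smooth_on_bilinear[OF bounded_bilinear_mult]
lemmas smooth_on_inner = smooth_on_bilinear[OF bounded_bilinear_inner]
lemmas smooth_on_scaleR = smooth_on_bilinear[OF bounded_bilinear_scaleR]

lemma smooth_on_uminus: "smooth_on S f \<Longrightarrow> smooth_on S (\<lambda>x. - f x)"
  using smooth_on_linear_compose[OF bounded_linear_minus[OF bounded_linear_ident]] .

lemma smooth_on_diff: "smooth_on S f \<Longrightarrow> smooth_on S g \<Longrightarrow> smooth_on S (\<lambda>x. f x - g x)"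
  using smooth_on_add[OF _ smooth_on_uminus, of f g] by simp

lemma smooth_on_divide:
  fixes f g :: "'a \<Rightarrow> real"
  assumes "smooth_on S f" "smooth_on S g" "\<And>x. x \<in> S \<Longrightarrow> g x \<noteq> 0"
  shows "smooth_on S (\<lambda>x. f x / g x)"
  unfolding divide_inverse
  using assms S by (intro smooth_on_mult) (auto simp: smooth_on_def Ck_inverse)

lemma smooth_on_linear: 
  fixes f :: "'a \<Rightarrow> 'b::real_normed_vector"
  assumes "bounded_linear f" shows "smooth_on S f"
proof -
  have "Ck (Suc k) f S" for k
    by (rule Ck_SucI[OF S bounded_linear_imp_has_derivative[OF assms]])
      (use Ck_const[OF S] S in auto)
  then show ?thesis using Ck_Suc_imp_Ck[OF S] unfolding smooth_on_def by blast
qed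

lemma smooth_on_Pair:
  assumes "smooth_on S f" "smooth_on S g" shows "smooth_on S (\<lambda>x. (f x, g x))"
proof -
  have "smooth_on S (\<lambda>x. (f x, 0) + (0, g x))"
    by (intro smooth_on_add smooth_on_linear_compose[OF _ assms(1)] smooth_on_linear_compose[OF _ assms(2)]
        bounded_linear_Pair bounded_linear_ident bounded_linear_zero)
  then show ?thesis by simp
qed

lemma smooth_on_compose:
  assumes "open T" "\<And>x. x \<in> S \<Longrightarrow> g x \<in> T" "smooth_on T f" "smooth_on S g"
  shows "smooth_on S (\<lambda>x. f (g x))"
  using Ck_compose[of S T g _ f, OF S assms(1,2)] assms(3,4) by (simp add: smooth_on_def)

lemma smooth_on_frechet: "smooth_on S f \<Longrightarrow> smooth_on S (\<lambda>x. frechet_derivative f (at x) v)"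
  unfolding smooth_on_def by (metis Ck.simps(2))

lemma smooth_on_has_derivative:
  "smooth_on S f \<Longrightarrow> x \<in> S \<Longrightarrow> (f has_derivative frechet_derivative f (at x)) (at x)"
  using Ck_SucD(1)[OF S] by (metis smooth_on_def)

lemma smooth_on_continuous: "smooth_on S f \<Longrightarrow> continuous_on S f"
  unfolding smooth_on_def by (metis Ck.simps(1))

lemma smooth_on_frechet_field:
  fixes v :: "'a \<Rightarrow> 'a"
  assumes "smooth_on S f" "smooth_on S v"
  shows "smooth_on S (\<lambda>x. frechet_derivative f (at x) (v x))"
proof -
  have "smooth_on S (\<lambda>x. \<Sum>b\<in>Basis. (v x \<bullet> b) *\<^sub>R frechet_derivative f (at x) b)"
    by (intro smooth_on_sum smooth_on_scaleR smooth_on_inner smooth_on_const smooth_on_frechet assms finite_Basis)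
  moreover have "frechet_derivative f (at x) (v x)
      = (\<Sum>b\<in>Basis. (v x \<bullet> b) *\<^sub>R frechet_derivative f (at x) b)" if "x \<in> S" for x
  proof -
    have lin: "linear (frechet_derivative f (at x))"
      using smooth_on_has_derivative[OF assms(1) that] by (rule has_derivative_linear)
    have "frechet_derivative f (at x) (v x) = frechet_derivative f (at x) (\<Sum>b\<in>Basis. (v x \<bullet> b) *\<^sub>R b)"
      by (simp add: euclidean_representation)
    then show ?thesis by (simp add: linear_sum[OF lin] linear_cmul[OF lin])
  qed
  ultimately show ?thesis
    using smooth_on_cong[of "\<lambda>x. frechet_derivative f (at x) (v x)"
      "\<lambda>x. \<Sum>b\<in>Basis. (v x \<bullet> b) *\<^sub>R frechet_derivative f (at x) b"] by presburger
qed

lemma smooth_on_subset_open: "open T \<Longrightarrow> T \<subseteq> S \<Longrightarrow> smooth_on S f \<Longrightarrow> smooth_on T f"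
proof -
  assume T: "open T" "T \<subseteq> S" and f: "smooth_on S f"
  have "Ck k f S \<Longrightarrow> Ck k f T" for k
    by (induction k arbitrary: f) (use T(2) in \<open>auto intro: continuous_on_subset differentiable_on_subset\<close>)
  then show "smooth_on T f" using f by (auto simp: smooth_on_def)
qed

end

section \<open>Derivations along vector fields\<close>

definition lie :: "('a::euclidean_space \<Rightarrow> 'a) \<Rightarrow> ('a \<Rightarrow> 'b::real_normed_vector) \<Rightarrow> 'a \<Rightarrow> 'b" where
  "lie a f x = frechet_derivative f (at x) (a x)"

lemma has_real_derivative_along_line:
  fixes f :: "'a::real_normed_vector \<Rightarrow> real"
  assumes "(f has_derivative f') (at (c + t *\<^sub>R v))"
  shows "((\<lambda>s. f (c + s *\<^sub>R v)) has_real_derivative f' v) (at t)"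
proof -
  have "((\<lambda>s. c + s *\<^sub>R v) has_derivative (\<lambda>h. h *\<^sub>R v)) (at t)"
    by (auto intro!: derivative_eq_intros)
  from has_derivative_compose[OF this assms]
  have "((\<lambda>s. f (c + s *\<^sub>R v)) has_derivative (\<lambda>h. f' (h *\<^sub>R v))) (at t)" .
  moreover have "(\<lambda>h. f' (h *\<^sub>R v)) = (*) (f' v)"
    using linear_cmul[OF has_derivative_linear[OF assms]] by (auto simp: mult.commute)
  ultimately show ?thesis by (simp add: has_field_derivative_def)
qed

context
  fixes S :: "'a::euclidean_space set"
  assumes S: "open S"
begin

lemma smooth_on_lie: "smooth_on S a \<Longrightarrow> smooth_on S f \<Longrightarrow> smooth_on S (lie a f)"
  unfolding lie_def by (rule smooth_on_frechet_field[OF S])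

lemma lie_cong: "(\<And>y. y \<in> S \<Longrightarrow> f y = g y) \<Longrightarrow> smooth_on S f \<Longrightarrow> x \<in> S \<Longrightarrow> lie a f x = lie a g x"
  unfolding lie_def
  using frechet_derivative_at has_derivative_transform_within_open[OF smooth_on_has_derivative[OF S] S]
  by metis

lemma lie_const: "lie a (\<lambda>x. c) x = 0"
  by (simp add: lie_def)

lemma lie_eqI: "(f has_derivative f') (at x) \<Longrightarrow> lie a f x = f' (a x)"
  unfolding lie_def using frechet_derivative_at by metis

lemma lie_add:
  "smooth_on S f \<Longrightarrow> smooth_on S g \<Longrightarrow> x \<in> S \<Longrightarrow> lie a (\<lambda>x. f x + g x) x = lie a f x + lie a g x"
  by (subst lie_eqI[OF has_derivative_add]) (auto intro: smooth_on_has_derivative[OF S] simp: lie_def)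

lemma lie_diff:
  "smooth_on S f \<Longrightarrow> smooth_on S g \<Longrightarrow> x \<in> S \<Longrightarrow> lie a (\<lambda>x. f x - g x) x = lie a f x - lie a g x"
  by (subst lie_eqI[OF has_derivative_diff]) (auto intro: smooth_on_has_derivative[OF S] simp: lie_def)

lemma lie_bilinear:
  "bounded_bilinear B \<Longrightarrow> smooth_on S f \<Longrightarrow> smooth_on S g \<Longrightarrow> x \<in> S \<Longrightarrow>
    lie a (\<lambda>x. B (f x) (g x)) x = B (f x) (lie a g x) + B (lie a f x) (g x)"
  by (subst lie_eqI[OF bounded_bilinear.FDERIV]) (auto intro: smooth_on_has_derivative[OF S] simp: lie_def)

lemmas lie_mult = lie_bilinear[OF bounded_bilinear_mult]
lemmas lie_inner = lie_bilinear[OF bounded_bilinear_inner]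

lemma lie_inner_const:
  "smooth_on S f \<Longrightarrow> x \<in> S \<Longrightarrow> lie a (\<lambda>x. f x \<bullet> v) x = lie a f x \<bullet> v"
  by (simp add: lie_inner smooth_on_const[OF S] lie_const)

text \<open>Two mean value theorems: along \<open>v\<close> for the increment of \<open>f\<close>
  over \<open>s *\<^sub>R w\<close>, then along \<open>w\<close>. The second difference is symmetric
  in \<open>v\<close> and \<open>w\<close>, which is the source of the symmetry of second
  derivatives.\<close>

lemma second_difference:
  fixes f :: "'a \<Rightarrow> real"
  assumes f: "smooth_on S f" and s: "0 < s" and sub: "\<And>t r. t \<in> {0..s} \<Longrightarrow> r \<in> {0..s} \<Longrightarrow> x + t *\<^sub>R v + r *\<^sub>R w \<in> S"
  shows "\<exists>t\<in>{0..s}. \<exists>r\<in>{0..s}.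
    f (x + s *\<^sub>R v + s *\<^sub>R w) - f (x + s *\<^sub>R v) - f (x + s *\<^sub>R w) + f x
      = s * (s * frechet_derivative (\<lambda>y. frechet_derivative f (at y) v) (at (x + t *\<^sub>R v + r *\<^sub>R w)) w)"
proof -
  let ?f' = "\<lambda>y. frechet_derivative f (at y)"
  have 1: "((\<lambda>t. f (x + r *\<^sub>R w + t *\<^sub>R v)) has_real_derivative ?f' (x + t *\<^sub>R v + r *\<^sub>R w) v) (at t)"
    if "t \<in> {0..s}" "r \<in> {0..s}" for t r
    using has_real_derivative_along_line[of f _ "x + r *\<^sub>R w" t v]
      smooth_on_has_derivative[OF S f, OF sub[OF that]] by (simp add: algebra_simps)
  have "\<exists>t>0. t < s \<and> (f (x + s *\<^sub>R w + s *\<^sub>R v) - f (x + 0 *\<^sub>R w + s *\<^sub>R v))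
      - (f (x + s *\<^sub>R w + 0 *\<^sub>R v) - f (x + 0 *\<^sub>R w + 0 *\<^sub>R v))
      = (s - 0) * (?f' (x + t *\<^sub>R v + s *\<^sub>R w) v - ?f' (x + t *\<^sub>R v + 0 *\<^sub>R w) v)"
    by (rule MVT2[OF s DERIV_diff[OF 1 1]]) (use s in auto)
  then obtain t where t: "0 < t" "t < s" and eq1: "f (x + s *\<^sub>R v + s *\<^sub>R w) - f (x + s *\<^sub>R v) - f (x + s *\<^sub>R w) + f x
      = s * (?f' (x + t *\<^sub>R v + s *\<^sub>R w) v - ?f' (x + t *\<^sub>R v + 0 *\<^sub>R w) v)"
    by (auto simp: algebra_simps)
  have 2: "((\<lambda>r. ?f' (x + t *\<^sub>R v + r *\<^sub>R w) v) has_real_derivative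
      frechet_derivative (\<lambda>y. ?f' y v) (at (x + t *\<^sub>R v + r *\<^sub>R w)) w) (at r)" if "r \<in> {0..s}" for r
    using that t by (intro has_real_derivative_along_line smooth_on_has_derivative[OF S smooth_on_frechet[OF S f]] sub) auto
  have "\<exists>r>0. r < s \<and> ?f' (x + t *\<^sub>R v + s *\<^sub>R w) v - ?f' (x + t *\<^sub>R v + 0 *\<^sub>R w) v
      = (s - 0) * frechet_derivative (\<lambda>y. ?f' y v) (at (x + t *\<^sub>R v + r *\<^sub>R w)) w"
    by (rule MVT2[OF s 2]) auto
  then obtain r where r: "0 < r" "r < s" and eq2: "?f' (x + t *\<^sub>R v + s *\<^sub>R w) v - ?f' (x + t *\<^sub>R v + 0 *\<^sub>R w) v
      = s * frechet_derivative (\<lambda>y. ?f' y v) (at (x + t *\<^sub>R v + r *\<^sub>R w)) w"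
    by auto
  show ?thesis
    by (rule bexI[of _ t], rule bexI[of _ r]) (use t r eq1 eq2 in auto)
qed

lemma frechet_derivative_symmetric:
  fixes f :: "'a \<Rightarrow> real"
  assumes f: "smooth_on S f" and x: "x \<in> S"
  shows "frechet_derivative (\<lambda>y. frechet_derivative f (at y) v) (at x) w
    = frechet_derivative (\<lambda>y. frechet_derivative f (at y) w) (at x) v"
proof -
  define H where "H v w y = frechet_derivative (\<lambda>y. frechet_derivative f (at y) v) (at y) w" for v w y
  have cont: "isCont (H v w) x" for v w
  proof -
    have "smooth_on S (H v w)" unfolding H_def by (intro smooth_on_frechet S f)
    then show ?thesis using smooth_on_continuous[OF S] S x continuous_on_eq_continuous_at by blast
  qed
  have close: "\<bar>H v w x - H w v x\<bar> < e" if "e > 0" for e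
  proof -
    obtain d1 where d1: "d1 > 0" "\<And>y. dist y x < d1 \<Longrightarrow> dist (H v w y) (H v w x) < e/2"
      using cont[of v w] \<open>e > 0\<close> unfolding continuous_at_eps_delta by (metis half_gt_zero)
    obtain d2 where d2: "d2 > 0" "\<And>y. dist y x < d2 \<Longrightarrow> dist (H w v y) (H w v x) < e/2"
      using cont[of w v] \<open>e > 0\<close> unfolding continuous_at_eps_delta by (metis half_gt_zero)
    obtain d3 where d3: "d3 > 0" "ball x d3 \<subseteq> S"
      using S x open_contains_ball by blast
    define d where "d = min d1 (min d2 d3)"
    \<comment> \<open>Small enough that the parallelogram spanned by \<open>s *\<^sub>R v\<close>
      and \<open>s *\<^sub>R w\<close> stays within distance \<open>d\<close>; the
      \<open>+ 1\<close> keeps the denominator positive when both vectors vanish.\<close>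
    define s where "s = d / (norm v + norm w + 1)"
    have dpos: "d > 0" using d1(1) d2(1) d3(1) by (simp add: d_def)
    have n: "norm v + norm w + 1 > 0" by (simp add: add_nonneg_pos)
    have s: "s > 0" using dpos n by (simp add: s_def)
    have near: "dist (x + t *\<^sub>R v + r *\<^sub>R w) x < d" if "t \<in> {0..s}" "r \<in> {0..s}" for t r
    proof -
      have "dist (x + t *\<^sub>R v + r *\<^sub>R w) x = norm (t *\<^sub>R v + r *\<^sub>R w)"
        by (simp add: dist_norm algebra_simps)
      also have "\<dots> \<le> t * norm v + r * norm w"
        using that by (intro norm_triangle_le) auto
      also have "\<dots> \<le> s * norm v + s * norm w"
        using that by (intro add_mono mult_right_mono) auto
      also have "\<dots> < s * (norm v + norm w + 1)" using s by (simp add: algebra_simps)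
      also have "\<dots> = d" using n by (simp add: s_def)
      finally show ?thesis .
    qed
    have inS: "x + t *\<^sub>R v + r *\<^sub>R w \<in> S" if "t \<in> {0..s}" "r \<in> {0..s}" for t r
      using near[OF that] d3(2) by (auto simp: d_def dist_commute)
    have inS': "x + r *\<^sub>R w + t *\<^sub>R v \<in> S" if "r \<in> {0..s}" "t \<in> {0..s}" for t r
      using inS[OF that(2,1)] by (simp add: algebra_simps)
    obtain t r where tr: "t \<in> {0..s}" "r \<in> {0..s}"
      and e1: "f (x + s *\<^sub>R v + s *\<^sub>R w) - f (x + s *\<^sub>R v) - f (x + s *\<^sub>R w) + f x
        = s * (s * H v w (x + t *\<^sub>R v + r *\<^sub>R w))"
      using second_difference[OF f s inS] unfolding H_def by blast
    obtain t' r' where tr': "t' \<in> {0..s}" "r' \<in> {0..s}"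
      and e2: "f (x + s *\<^sub>R w + s *\<^sub>R v) - f (x + s *\<^sub>R w) - f (x + s *\<^sub>R v) + f x
        = s * (s * H w v (x + t' *\<^sub>R w + r' *\<^sub>R v))"
      using second_difference[OF f s inS'] unfolding H_def by blast
    have swap: "x + p *\<^sub>R w + q *\<^sub>R v = x + q *\<^sub>R v + p *\<^sub>R w" for p q by (simp add: algebra_simps)
    have "s * (s * H v w (x + t *\<^sub>R v + r *\<^sub>R w)) = s * (s * H w v (x + r' *\<^sub>R v + t' *\<^sub>R w))"
      using e1 e2 unfolding swap by linarith
    then have eq: "H v w (x + t *\<^sub>R v + r *\<^sub>R w) = H w v (x + r' *\<^sub>R v + t' *\<^sub>R w)"
      using s by simp
    have "dist (H v w (x + t *\<^sub>R v + r *\<^sub>R w)) (H v w x) < e/2" "dist (H w v (x + r' *\<^sub>R v + t' *\<^sub>R w)) (H w v x) < e/2"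
      using near[OF tr] near[OF tr'(2,1)] d1(2) d2(2) unfolding d_def by simp_all
    then show ?thesis using eq unfolding dist_real_def by linarith
  qed
  have "\<bar>H v w x - H w v x\<bar> \<le> 0" by (rule dense_ge) (rule less_imp_le[OF close])
  then show ?thesis by (simp add: H_def)
qed

text \<open>Separates the Hessian of \<open>f\<close>, symmetric in the two directions, from the
  first order term caused by the variation of \<open>b\<close>. Commutators and second derivative
  tests both rest on this splitting.\<close>

lemma lie_lie:
  fixes f :: "'a \<Rightarrow> real"
  assumes f: "smooth_on S f" and b: "smooth_on S b" and x: "x \<in> S"
  shows "lie a (lie b f) x = frechet_derivative (\<lambda>y. frechet_derivative f (at y) (b x)) (at x) (a x)
    + frechet_derivative f (at x) (frechet_derivative b (at x) (a x))"
proof -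
  let ?f' = "\<lambda>y. frechet_derivative f (at y)"
  have rep: "?f' y w = (\<Sum>i\<in>Basis. (w \<bullet> i) * ?f' y i)" if "y \<in> S" for y w
  proof -
    have lin: "linear (?f' y)"
      using smooth_on_has_derivative[OF S f that] by (rule has_derivative_linear)
    have "?f' y w = ?f' y (\<Sum>i\<in>Basis. (w \<bullet> i) *\<^sub>R i)" by (simp add: euclidean_representation)
    also have "\<dots> = (\<Sum>i\<in>Basis. (w \<bullet> i) * ?f' y i)"
      by (simp only: linear_sum[OF lin] linear_cmul[OF lin] real_scaleR_def)
    finally show ?thesis .
  qed
  note d = smooth_on_has_derivative[OF S b x] smooth_on_has_derivative[OF S smooth_on_frechet[OF S f] x]
  let ?b' = "frechet_derivative b (at x)" and ?H = "\<lambda>i. frechet_derivative (\<lambda>y. ?f' y i) (at x)"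
  have "((\<lambda>y. \<Sum>i\<in>Basis. (b y \<bullet> i) * ?f' y i) has_derivative
      (\<lambda>v. \<Sum>i\<in>Basis. (b x \<bullet> i) * ?H i v + (?b' v \<bullet> i) * ?f' x i)) (at x)"
    by (intro has_derivative_sum has_derivative_mult has_derivative_inner_left d)
  then have "((\<lambda>y. ?f' y (b y)) has_derivative
      (\<lambda>v. \<Sum>i\<in>Basis. (b x \<bullet> i) * ?H i v + (?b' v \<bullet> i) * ?f' x i)) (at x)"
    by (rule has_derivative_transform_within_open[OF _ S x]) (rule rep[symmetric])
  from fun_cong[OF frechet_derivative_at[OF this], of "a x"]
  have 1: "lie a (lie b f) x = (\<Sum>i\<in>Basis. (b x \<bullet> i) * ?H i (a x) + (?b' (a x) \<bullet> i) * ?f' x i)"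
    unfolding lie_def[abs_def] by (rule sym)
  have "((\<lambda>y. \<Sum>i\<in>Basis. (b x \<bullet> i) * ?f' y i) has_derivative
      (\<lambda>v. \<Sum>i\<in>Basis. (b x \<bullet> i) * ?H i v)) (at x)"
    by (intro has_derivative_sum has_derivative_mult_right d)
  then have "((\<lambda>y. ?f' y (b x)) has_derivative (\<lambda>v. \<Sum>i\<in>Basis. (b x \<bullet> i) * ?H i v)) (at x)"
    by (rule has_derivative_transform_within_open[OF _ S x]) (rule rep[symmetric])
  from fun_cong[OF frechet_derivative_at[OF this], of "a x"]
  have "frechet_derivative (\<lambda>y. ?f' y (b x)) (at x) (a x) = (\<Sum>i\<in>Basis. (b x \<bullet> i) * ?H i (a x))"
    by (rule sym)
  then show ?thesis unfolding 1 sum.distrib rep[OF x, of "?b' (a x)"] by linarith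
qed

text \<open>The commutator of two derivations is again a derivation, hence it vanishes as soon as
  it annihilates enough functions to separate tangent directions.\<close>
lemma lie_commute:
  fixes f :: "'a \<Rightarrow> real" and G :: "('a \<Rightarrow> real) set"
  assumes sm: "smooth_on S a" "smooth_on S b" "\<And>g. g \<in> G \<Longrightarrow> smooth_on S g" "smooth_on S f"
    and x: "x \<in> S"
    and sep: "\<And>c. (\<And>g. g \<in> G \<Longrightarrow> frechet_derivative g (at x) c = 0) \<Longrightarrow> c = 0"
    and com: "\<And>g. g \<in> G \<Longrightarrow> lie a (lie b g) x = lie b (lie a g) x"
  shows "lie a (lie b f) x = lie b (lie a f) x"
proof -
  \<comment> \<open>The Lie bracket at \<open>x\<close>; the Hessian terms cancel, so the commutator
    is the derivative in direction \<open>c\<close>.\<close>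
  define c where "c = frechet_derivative b (at x) (a x) - frechet_derivative a (at x) (b x)"
  have *: "lie a (lie b g) x - lie b (lie a g) x = frechet_derivative g (at x) c"
    if g: "smooth_on S g" for g :: "'a \<Rightarrow> real"
    using lie_lie[OF g sm(2) x, of a] lie_lie[OF g sm(1) x, of b]
      frechet_derivative_symmetric[OF g x, of "a x" "b x"]
      linear_diff[OF has_derivative_linear[OF smooth_on_has_derivative[OF S g x]]]
    by (simp add: c_def)
  have "c = 0" by (rule sep) (use * com sm(3) in fastforce)
  then show ?thesis
    using *[OF sm(4)] linear_0[OF has_derivative_linear[OF smooth_on_has_derivative[OF S sm(4) x]]] by simp
qed

end

text \<open>The first derivative vanishes in every spatial direction. In \<open>lie_lie\<close> the
  term from the variation of \<open>a\<close> drops out as well, because the derivative of a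
  horizontal field is horizontal; what remains is a second derivative along a line.\<close>

lemma lie_max:
  fixes w :: "real \<times> 'b::euclidean_space \<Rightarrow> real"
  assumes S: "open S" and w: "smooth_on S w" and a: "smooth_on S a" and z: "z \<in> S"
    and max: "\<And>y. y \<in> S \<Longrightarrow> fst y = fst z \<Longrightarrow> w y \<le> w z"
    and hor: "\<And>y. y \<in> S \<Longrightarrow> fst (a y) = 0"
  shows "lie a w z = 0" and "lie a (lie a w) z \<le> 0"
proof -
  let ?w' = "\<lambda>y. frechet_derivative w (at y)"
  have lineS: "\<exists>d>0. \<forall>t. \<bar>t\<bar> < d \<longrightarrow> z + t *\<^sub>R v \<in> S" for v
  proof -
    have "open ((\<lambda>t. z + t *\<^sub>R v) -` S)"
      by (intro open_vimage S continuous_intros)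
    moreover have "0 \<in> (\<lambda>t. z + t *\<^sub>R v) -` S" using z by simp
    ultimately obtain d where "d > 0" "ball 0 d \<subseteq> (\<lambda>t. z + t *\<^sub>R v) -` S"
      unfolding open_contains_ball by blast
    then show ?thesis by (intro exI[of _ d]) (auto simp: subset_iff)
  qed
  have line: "((\<lambda>s. w (z + s *\<^sub>R v)) has_real_derivative ?w' (z + t *\<^sub>R v) v) (at t)"
    if "z + t *\<^sub>R v \<in> S" for v t
    by (rule has_real_derivative_along_line[OF smooth_on_has_derivative[OF S w that]])
  have crit: "?w' z v = 0" if v: "fst v = 0" for v
  proof -
    obtain d where d: "d > 0" "\<And>t. \<bar>t\<bar> < d \<Longrightarrow> z + t *\<^sub>R v \<in> S" using lineS by blast
    show ?thesis
      by (rule DERIV_local_max[OF line[of 0 v, simplified] d(1)]) (use z max d v in auto)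
  qed
  then show "lie a w z = 0" using hor[OF z] by (simp add: lie_def)
  have "?w' z (frechet_derivative a (at z) (a z)) = 0"
  proof (rule crit)
    have "((\<lambda>y. fst (a y)) has_derivative (\<lambda>v. fst (frechet_derivative a (at z) v))) (at z)"
      by (intro has_derivative_fst smooth_on_has_derivative[OF S a z])
    moreover have "((\<lambda>y. fst (a y)) has_derivative (\<lambda>v. 0)) (at z)"
      by (rule has_derivative_transform_within_open[OF has_derivative_const S z]) (use hor in auto)
    ultimately show "fst (frechet_derivative a (at z) (a z)) = 0"
      using has_derivative_unique by metis
  qed
  moreover have "frechet_derivative (\<lambda>y. ?w' y v) (at z) v \<le> 0" if v: "fst v = 0" for v
  proof (rule ccontr)
    \<comment> \<open>A positive second derivative would make the first one, which vanishes at
      \<open>z\<close>, positive just beyond \<open>z\<close>, so \<open>w\<close> would exceed its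
      maximum.\<close>
    assume neg: "\<not> ?thesis"
    obtain d where d: "d > 0" "\<And>t. \<bar>t\<bar> < d \<Longrightarrow> z + t *\<^sub>R v \<in> S" using lineS by blast
    have "((\<lambda>s. ?w' (z + s *\<^sub>R v) v) has_real_derivative
        frechet_derivative (\<lambda>y. ?w' y v) (at z) v) (at 0)"
      using has_real_derivative_along_line[of "\<lambda>y. ?w' y v" _ z 0 v]
        smooth_on_has_derivative[OF S smooth_on_frechet[OF S w] z] by simp
    from DERIV_pos_inc_right[OF this] neg obtain e where e: "e > 0"
      "\<And>h. 0 < h \<Longrightarrow> h < e \<Longrightarrow> ?w' (z + h *\<^sub>R v) v > ?w' (z + 0 *\<^sub>R v) v" by auto
    define h where "h = min d e / 2"
    have h: "0 < h" "h < d" "h < e" using d(1) e(1) by (auto simp: h_def)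
    have "\<exists>t>0. t < h \<and> w (z + h *\<^sub>R v) - w (z + 0 *\<^sub>R v) = (h - 0) * ?w' (z + t *\<^sub>R v) v"
      by (rule MVT2[OF h(1) line]) (use d(2) h in auto)
    then obtain t where t: "0 < t" "t < h" "w (z + h *\<^sub>R v) - w z = h * ?w' (z + t *\<^sub>R v) v" by auto
    have "?w' (z + t *\<^sub>R v) v > 0" using e(2)[of t] t h crit[OF v] by auto
    then have "w (z + h *\<^sub>R v) > w z" using t h by (simp add: algebra_simps)
    moreover have "w (z + h *\<^sub>R v) \<le> w z" using max d(2)[of h] h v by auto
    ultimately show False by simp
  qed
  ultimately show "lie a (lie a w) z \<le> 0"
    using lie_lie[OF S w a z, of a] hor[OF z] by simp
qed

section \<open>The support function in a chart of the Gauss image\<close>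

text \<open>In a chart of the Gauss image around a point, \<open>(A, B, 1) / \<rho>\<close> is the unit normal and
  \<open>h\<close> is the restriction to the affine plane of the one-homogeneous support function.
  The fields \<open>a1\<close>, \<open>a2\<close>, \<open>a0\<close> differentiate along \<open>A\<close>, along \<open>B\<close>, and in time
  with the normal held fixed.  In these terms \<open>\<sigma>\<close> is the sum of the principal radii,
  \<open>F\<close> is the reciprocal of the mean curvature, and \<open>flow\<close> says that the surface
  expands with normal speed \<open>F\<close>.\<close>
locale gauss_chart =
  fixes \<Omega> :: "(real \<times> 'b::euclidean_space) set"
    and a0 a1 a2 :: "real \<times> 'b \<Rightarrow> real \<times> 'b"
    and A B h \<rho> :: "real \<times> 'b \<Rightarrow> real"
  assumes open_\<Omega>: "open \<Omega>"
    and smooth_fields: "smooth_on \<Omega> a0" "smooth_on \<Omega> a1" "smooth_on \<Omega> a2"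
    and smooth_functions: "smooth_on \<Omega> A" "smooth_on \<Omega> B" "smooth_on \<Omega> h" "smooth_on \<Omega> \<rho>"
    and dual: "\<And>x. x \<in> \<Omega> \<Longrightarrow> lie a1 A x = 1" "\<And>x. x \<in> \<Omega> \<Longrightarrow> lie a1 B x = 0"
      "\<And>x. x \<in> \<Omega> \<Longrightarrow> lie a2 A x = 0" "\<And>x. x \<in> \<Omega> \<Longrightarrow> lie a2 B x = 1"
      "\<And>x. x \<in> \<Omega> \<Longrightarrow> lie a0 A x = 0" "\<And>x. x \<in> \<Omega> \<Longrightarrow> lie a0 B x = 0"
    and commute: "\<And>f x. smooth_on \<Omega> f \<Longrightarrow> x \<in> \<Omega> \<Longrightarrow> lie a2 (lie a1 f) x = (lie a1 (lie a2 f) x :: real)"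
      "\<And>f x. smooth_on \<Omega> f \<Longrightarrow> x \<in> \<Omega> \<Longrightarrow> lie a0 (lie a1 f) x = (lie a1 (lie a0 f) x :: real)"
      "\<And>f x. smooth_on \<Omega> f \<Longrightarrow> x \<in> \<Omega> \<Longrightarrow> lie a0 (lie a2 f) x = (lie a2 (lie a0 f) x :: real)"
    and horizontal: "\<And>x. x \<in> \<Omega> \<Longrightarrow> fst (a1 x) = 0" "\<And>x. x \<in> \<Omega> \<Longrightarrow> fst (a2 x) = 0"
    and \<rho>: "\<And>x. x \<in> \<Omega> \<Longrightarrow> \<rho> x * \<rho> x = 1 + A x * A x + B x * B x" "\<And>x. x \<in> \<Omega> \<Longrightarrow> \<rho> x > 0"
begin

definition "hAA = lie a1 (lie a1 h)"
definition "hAB = lie a1 (lie a2 h)"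
definition "hBB = lie a2 (lie a2 h)"
text \<open>Under central projection the inverse round metric is \<open>\<rho> * \<rho>\<close>
  times the identity plus the square of the vector \<open>(A, B)\<close>, and the tensor of
  principal radii is the Hessian of \<open>h\<close> divided by \<open>\<rho>\<close>. Hence its
  trace is \<open>\<rho> * T\<close> and its determinant \<open>\<rho> ^ 4 * D\<close>;
  \<open>F\<close> below is their quotient.\<close>

definition "T x = hAA x + hBB x + (A x * A x * hAA x + 2 * (A x * B x * hAB x) + B x * B x * hBB x)"
definition "D x = hAA x * hBB x - hAB x * hAB x"
definition "\<sigma> x = \<rho> x * T x"
definition "F x = \<rho> x * \<rho> x * \<rho> x * D x / T x"

lemmas smooth_intros =
  smooth_on_add[OF open_\<Omega>] smooth_on_diff[OF open_\<Omega>] smooth_on_mult[OF open_\<Omega>]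
  smooth_on_const[OF open_\<Omega>] smooth_on_lie[OF open_\<Omega>] smooth_on_divide[OF open_\<Omega>]
  smooth_fields smooth_functions

lemma smooth_hess: "smooth_on \<Omega> hAA" "smooth_on \<Omega> hAB" "smooth_on \<Omega> hBB"
  unfolding hAA_def hAB_def hBB_def by (intro smooth_intros)+

lemma smooth_TD\<sigma>: "smooth_on \<Omega> T" "smooth_on \<Omega> D" "smooth_on \<Omega> \<sigma>"
  unfolding T_def[abs_def] D_def[abs_def] \<sigma>_def[abs_def] by (intro smooth_intros smooth_hess)+

lemma lie_lie_mult:
  fixes f g :: "real \<times> 'b \<Rightarrow> real"
  assumes "smooth_on \<Omega> f" "smooth_on \<Omega> g" "smooth_on \<Omega> b" "x \<in> \<Omega>"
  shows "lie a (lie b (\<lambda>x. f x * g x)) x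
    = lie a (lie b f) x * g x + lie b f x * lie a g x + lie a f x * lie b g x + f x * lie a (lie b g) x"
proof -
  have "lie a (lie b (\<lambda>x. f x * g x)) x = lie a (\<lambda>x. f x * lie b g x + lie b f x * g x) x"
    by (rule lie_cong[OF open_\<Omega>])
      (use assms in \<open>auto intro!: lie_mult[OF open_\<Omega>] smooth_on_lie smooth_on_mult open_\<Omega>\<close>)
  also have "\<dots> = lie a (lie b f) x * g x + lie b f x * lie a g x + lie a f x * lie b g x + f x * lie a (lie b g) x"
    using assms by (simp add: lie_add[OF open_\<Omega>] lie_mult[OF open_\<Omega>] smooth_on_lie smooth_on_mult open_\<Omega> algebra_simps)
  finally show ?thesis .
qed

lemma lie_lie_add:
  fixes f g :: "real \<times> 'b \<Rightarrow> real"
  assumes "smooth_on \<Omega> f" "smooth_on \<Omega> g" "smooth_on \<Omega> b" "x \<in> \<Omega>"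
  shows "lie a (lie b (\<lambda>x. f x + g x)) x = lie a (lie b f) x + lie a (lie b g) x"
proof -
  have "lie a (lie b (\<lambda>x. f x + g x)) x = lie a (\<lambda>x. lie b f x + lie b g x) x"
    by (rule lie_cong[OF open_\<Omega>])
      (use assms in \<open>auto intro!: lie_add[OF open_\<Omega>] smooth_on_lie smooth_on_add open_\<Omega>\<close>)
  then show ?thesis using assms by (simp add: lie_add[OF open_\<Omega>] smooth_on_lie open_\<Omega>)
qed

lemma lie_lie_diff:
  fixes f g :: "real \<times> 'b \<Rightarrow> real"
  assumes "smooth_on \<Omega> f" "smooth_on \<Omega> g" "smooth_on \<Omega> b" "x \<in> \<Omega>"
  shows "lie a (lie b (\<lambda>x. f x - g x)) x = lie a (lie b f) x - lie a (lie b g) x"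
proof -
  have "lie a (lie b (\<lambda>x. f x - g x)) x = lie a (\<lambda>x. lie b f x - lie b g x) x"
    by (rule lie_cong[OF open_\<Omega>])
      (use assms in \<open>auto intro!: lie_diff[OF open_\<Omega>] smooth_on_lie smooth_on_diff open_\<Omega>\<close>)
  then show ?thesis using assms by (simp add: lie_diff[OF open_\<Omega>] smooth_on_lie open_\<Omega>)
qed

lemma lie_lie_const: "lie a (lie b (\<lambda>x. c)) x = 0"
  by (simp add: lie_def[abs_def])

lemma lie_lie_cong:
  fixes f g :: "real \<times> 'b \<Rightarrow> real"
  assumes "\<And>x. x \<in> \<Omega> \<Longrightarrow> f x = g x" "smooth_on \<Omega> f" "smooth_on \<Omega> b" "x \<in> \<Omega>"
  shows "lie a (lie b f) x = lie a (lie b g) x"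
  by (rule lie_cong[OF open_\<Omega>]) (use assms in \<open>auto intro!: lie_cong[OF open_\<Omega>] smooth_on_lie open_\<Omega>\<close>)

lemmas smooth_simps = smooth_intros smooth_hess smooth_TD\<sigma>
lemmas lie_simps =
  lie_add[OF open_\<Omega>] lie_diff[OF open_\<Omega>] lie_mult[OF open_\<Omega>] lie_const[OF open_\<Omega>]
  lie_lie_add lie_lie_diff lie_lie_mult lie_lie_const

lemma lie_lie_dual:
  assumes "x \<in> \<Omega>" "a \<in> {a0, a1, a2}" "b \<in> {a0, a1, a2}"
  shows "lie a (lie b A) x = 0" "lie a (lie b B) x = 0"
proof -
  have *: "lie a (lie b f) x = 0" if "smooth_on \<Omega> f" "\<And>y. y \<in> \<Omega> \<Longrightarrow> lie b f y = c" for f and c :: real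
    using lie_cong[OF open_\<Omega> that(2) smooth_on_lie[OF open_\<Omega> _ that(1)] assms(1), of a]
      assms(3) smooth_fields by (auto simp: lie_const[OF open_\<Omega>])
  show "lie a (lie b A) x = 0" "lie a (lie b B) x = 0"
    using assms(3) *[of A] *[of B] smooth_functions(1,2) dual by auto
qed

text \<open>In the affine chart the Codazzi equations are just the commutation of the coordinate
  fields on derivatives of \<open>h\<close>; no curvature term appears even at fourth order.\<close>

lemma codazzi:
  assumes x: "x \<in> \<Omega>"
  shows "lie a2 hAA x = lie a1 hAB x" "lie a2 hAB x = lie a1 hBB x"
    "lie a2 (lie a2 hAA) x = lie a1 (lie a1 hBB) x"
proof -
  have 1: "lie a2 hAA y = lie a1 hAB y" if "y \<in> \<Omega>" for y
  proof -
    have "lie a2 hAA y = lie a1 (lie a2 (lie a1 h)) y"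
      unfolding hAA_def by (rule commute) (intro smooth_intros that)+
    also have "\<dots> = lie a1 hAB y" unfolding hAB_def
      by (rule lie_cong[OF open_\<Omega>]) (auto intro!: commute smooth_intros that)
    finally show ?thesis .
  qed
  have 2: "lie a2 hAB y = lie a1 hBB y" if "y \<in> \<Omega>" for y
    unfolding hAB_def hBB_def by (rule commute) (intro smooth_intros that)+
  show "lie a2 hAA x = lie a1 hAB x" "lie a2 hAB x = lie a1 hBB x" using 1 2 x by auto
  have "lie a2 (lie a2 hAA) x = lie a2 (lie a1 hAB) x"
    by (rule lie_cong[OF open_\<Omega> 1]) (auto intro!: smooth_intros smooth_hess x)
  also have "\<dots> = lie a1 (lie a2 hAB) x" by (rule commute) (intro smooth_hess x)+
  also have "\<dots> = lie a1 (lie a1 hBB) x"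
    by (rule lie_cong[OF open_\<Omega> 2]) (auto intro!: smooth_intros smooth_hess x)
  finally show "lie a2 (lie a2 hAA) x = lie a1 (lie a1 hBB) x" .
qed

end

locale gauss_chart_flow = gauss_chart +
  assumes T_pos: "\<And>x. x \<in> \<Omega> \<Longrightarrow> T x > 0"
    and flow: "\<And>x. x \<in> \<Omega> \<Longrightarrow> lie a0 h x = \<rho> x * F x"
begin

lemma smooth_F: "smooth_on \<Omega> F"
  unfolding F_def[abs_def] using T_pos by (intro smooth_intros smooth_TD\<sigma>) force

lemma F_T: "x \<in> \<Omega> \<Longrightarrow> F x * T x = \<rho> x * \<rho> x * \<rho> x * D x"
  using T_pos[of x] by (simp add: F_def)

text \<open>\<open>a0\<close> commutes with \<open>a1\<close> and \<open>a2\<close>, so the flow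
  equation for \<open>h\<close> can be differentiated twice in space.\<close>

lemma hess_evolution:
  assumes x: "x \<in> \<Omega>"
  shows "lie a0 hAA x = lie a1 (lie a1 (\<lambda>x. \<rho> x * F x)) x"
    and "lie a0 hBB x = lie a2 (lie a2 (\<lambda>x. \<rho> x * F x)) x"
proof -
  have *: "lie a0 (lie a (lie a h)) x = lie a (lie a (\<lambda>x. \<rho> x * F x)) x"
    if a: "smooth_on \<Omega> a" and c: "\<And>f x. smooth_on \<Omega> f \<Longrightarrow> x \<in> \<Omega> \<Longrightarrow> lie a0 (lie a f) x = (lie a (lie a0 f) x :: real)" for a
  proof -
    have "lie a0 (lie a (lie a h)) x = lie a (lie a0 (lie a h)) x"
      by (rule c) (intro smooth_intros a x)+
    also have "\<dots> = lie a (lie a (lie a0 h)) x"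
      by (rule lie_cong[OF open_\<Omega>]) (auto intro!: c smooth_intros a x)
    also have "\<dots> = lie a (lie a (\<lambda>x. \<rho> x * F x)) x"
      by (rule lie_lie_cong) (auto intro!: flow smooth_intros a x)
    finally show ?thesis .
  qed
  show "lie a0 hAA x = lie a1 (lie a1 (\<lambda>x. \<rho> x * F x)) x" "lie a0 hBB x = lie a2 (lie a2 (\<lambda>x. \<rho> x * F x)) x"
    unfolding hAA_def hBB_def by (rule *, auto intro: smooth_fields commute)+
qed

section \<open>Derivatives up to second order at a vertex of the chart, with diagonal
  Hessian\<close>

context
  fixes z
  assumes z: "z \<in> \<Omega>" and vertex: "A z = 0" "B z = 0" "hAB z = 0"
begin

lemma \<rho>_z: "\<rho> z = 1"
proof -
  have "\<rho> z * \<rho> z = 1" using \<rho>(1)[OF z] vertex by simp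
  then show ?thesis using \<rho>(2)[OF z] by (metis abs_of_pos real_sqrt_abs2 real_sqrt_one)
qed

text \<open>Obtained by differentiating the equation for \<open>\<rho> * \<rho>\<close> once and
  twice, which avoids square roots.\<close>

lemma \<rho>_jet:
  shows "lie a1 \<rho> z = 0" "lie a2 \<rho> z = 0" "lie a0 \<rho> z = 0"
    "lie a1 (lie a1 \<rho>) z = 1" "lie a2 (lie a2 \<rho>) z = 1"
proof -
  have eq1: "lie a (\<lambda>x. \<rho> x * \<rho> x) z = lie a (\<lambda>x. 1 + A x * A x + B x * B x) z" for a
    by (rule lie_cong[OF open_\<Omega> \<rho>(1)]) (auto intro!: smooth_simps z)
  have eq2: "lie a (lie a (\<lambda>x. \<rho> x * \<rho> x)) z = lie a (lie a (\<lambda>x. 1 + A x * A x + B x * B x)) z"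
    if "smooth_on \<Omega> a" for a
    by (rule lie_lie_cong[OF \<rho>(1)]) (auto intro!: smooth_simps z that)
  show 1: "lie a1 \<rho> z = 0" "lie a2 \<rho> z = 0" "lie a0 \<rho> z = 0"
    using eq1[of a1] eq1[of a2] eq1[of a0]
    by (simp_all add: lie_simps smooth_simps z vertex \<rho>_z)
  show "lie a1 (lie a1 \<rho>) z = 1" "lie a2 (lie a2 \<rho>) z = 1"
    using eq2[OF smooth_fields(2)] eq2[OF smooth_fields(3)]
    by (simp_all add: lie_simps smooth_simps z vertex \<rho>_z 1 dual lie_lie_dual)
qed

lemma T_jet:
  shows "lie a1 T z = lie a1 hAA z + lie a1 hBB z"
    "lie a2 T z = lie a2 hAA z + lie a2 hBB z"
    "lie a0 T z = lie a0 hAA z + lie a0 hBB z"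
    "lie a1 (lie a1 T) z = lie a1 (lie a1 hAA) z + lie a1 (lie a1 hBB) z + 2 * hAA z"
    "lie a2 (lie a2 T) z = lie a2 (lie a2 hAA) z + lie a2 (lie a2 hBB) z + 2 * hBB z"
  unfolding T_def[abs_def]
  by (simp_all add: lie_simps smooth_simps z vertex dual lie_lie_dual)

lemma D_jet:
  shows "lie a D z = lie a hAA z * hBB z + hAA z * lie a hBB z"
    "smooth_on \<Omega> a \<Longrightarrow> lie a (lie a D) z = lie a (lie a hAA) z * hBB z + 2 * (lie a hAA z * lie a hBB z)
      + hAA z * lie a (lie a hBB) z - 2 * (lie a hAB z * lie a hAB z)"
  unfolding D_def[abs_def]
  by (simp_all add: lie_simps smooth_simps z vertex algebra_simps)

text \<open>In the second derivatives, the zero order part is the contribution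
  \<open>2 * hAA\<close> or \<open>2 * hBB\<close> of the quadratic terms of \<open>T\<close>, plus
  \<open>hAA + hBB\<close> from the second derivative of \<open>\<rho>\<close>.\<close>

lemma \<sigma>_jet:
  shows "\<sigma> z = hAA z + hBB z"
    "lie a1 \<sigma> z = lie a1 hAA z + lie a1 hBB z"
    "lie a2 \<sigma> z = lie a2 hAA z + lie a2 hBB z"
    "lie a0 \<sigma> z = lie a0 hAA z + lie a0 hBB z"
    "lie a1 (lie a1 \<sigma>) z = lie a1 (lie a1 hAA) z + lie a1 (lie a1 hBB) z + 3 * hAA z + hBB z"
    "lie a2 (lie a2 \<sigma>) z = lie a2 (lie a2 hAA) z + lie a2 (lie a2 hBB) z + hAA z + 3 * hBB z"
proof -
  have T: "T z = hAA z + hBB z" by (simp add: T_def vertex)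
  show "\<sigma> z = hAA z + hBB z"
    "lie a1 \<sigma> z = lie a1 hAA z + lie a1 hBB z"
    "lie a2 \<sigma> z = lie a2 hAA z + lie a2 hBB z"
    "lie a0 \<sigma> z = lie a0 hAA z + lie a0 hBB z"
    "lie a1 (lie a1 \<sigma>) z = lie a1 (lie a1 hAA) z + lie a1 (lie a1 hBB) z + 3 * hAA z + hBB z"
    "lie a2 (lie a2 \<sigma>) z = lie a2 (lie a2 hAA) z + lie a2 (lie a2 hBB) z + hAA z + 3 * hBB z"
    unfolding \<sigma>_def[abs_def]
    by (simp_all add: lie_simps smooth_simps z \<rho>_z \<rho>_jet T_jet T)
qed

text \<open>The product \<open>F * T = \<rho> * \<rho> * \<rho> * D\<close> is differentiated rather
  than the quotient. The second derivative of \<open>T\<close> equals that of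
  \<open>\<sigma>\<close> minus \<open>\<sigma>\<close>, and the cube of \<open>\<rho>\<close>
  contributes three times \<open>hAA * hBB\<close>.\<close>

lemma F_jet:
  shows "F z * \<sigma> z = hAA z * hBB z"
    "lie a1 F z * \<sigma> z + F z * lie a1 \<sigma> z = lie a1 hAA z * hBB z + hAA z * lie a1 hBB z"
    "lie a2 F z * \<sigma> z + F z * lie a2 \<sigma> z = lie a2 hAA z * hBB z + hAA z * lie a2 hBB z"
    "lie a0 F z * \<sigma> z + F z * lie a0 \<sigma> z = lie a0 hAA z * hBB z + hAA z * lie a0 hBB z"
    "lie a1 (lie a1 F) z * \<sigma> z + 2 * (lie a1 F z * lie a1 \<sigma> z) + F z * (lie a1 (lie a1 \<sigma>) z - \<sigma> z)
      = lie a1 (lie a1 hAA) z * hBB z + 2 * (lie a1 hAA z * lie a1 hBB z) + hAA z * lie a1 (lie a1 hBB) z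
        - 2 * (lie a1 hAB z * lie a1 hAB z) + 3 * (hAA z * hBB z)"
    "lie a2 (lie a2 F) z * \<sigma> z + 2 * (lie a2 F z * lie a2 \<sigma> z) + F z * (lie a2 (lie a2 \<sigma>) z - \<sigma> z)
      = lie a2 (lie a2 hAA) z * hBB z + 2 * (lie a2 hAA z * lie a2 hBB z) + hAA z * lie a2 (lie a2 hBB) z
        - 2 * (lie a2 hAB z * lie a2 hAB z) + 3 * (hAA z * hBB z)"
    "lie a0 hAA z = lie a1 (lie a1 F) z + F z"
    "lie a0 hBB z = lie a2 (lie a2 F) z + F z"
proof -
  have T: "T z = hAA z + hBB z" and D: "D z = hAA z * hBB z" by (simp_all add: T_def D_def vertex)
  have eq1: "lie a (\<lambda>x. F x * T x) z = lie a (\<lambda>x. \<rho> x * \<rho> x * \<rho> x * D x) z" for a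
    by (rule lie_cong[OF open_\<Omega> F_T]) (auto intro!: smooth_simps smooth_F z)
  have eq2: "lie a (lie a (\<lambda>x. F x * T x)) z = lie a (lie a (\<lambda>x. \<rho> x * \<rho> x * \<rho> x * D x)) z"
    if "smooth_on \<Omega> a" for a
    by (rule lie_lie_cong[OF F_T]) (auto intro!: smooth_simps smooth_F z that)
  show "F z * \<sigma> z = hAA z * hBB z"
    using F_T[OF z] by (simp add: \<rho>_z \<sigma>_def D)
  show "lie a1 F z * \<sigma> z + F z * lie a1 \<sigma> z = lie a1 hAA z * hBB z + hAA z * lie a1 hBB z"
    "lie a2 F z * \<sigma> z + F z * lie a2 \<sigma> z = lie a2 hAA z * hBB z + hAA z * lie a2 hBB z"
    "lie a0 F z * \<sigma> z + F z * lie a0 \<sigma> z = lie a0 hAA z * hBB z + hAA z * lie a0 hBB z"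
    using eq1[of a1] eq1[of a2] eq1[of a0]
    by (simp_all add: lie_simps smooth_simps smooth_F z \<rho>_z \<rho>_jet T_jet \<sigma>_jet T D D_jet algebra_simps)
  show "lie a1 (lie a1 F) z * \<sigma> z + 2 * (lie a1 F z * lie a1 \<sigma> z) + F z * (lie a1 (lie a1 \<sigma>) z - \<sigma> z)
      = lie a1 (lie a1 hAA) z * hBB z + 2 * (lie a1 hAA z * lie a1 hBB z) + hAA z * lie a1 (lie a1 hBB) z
        - 2 * (lie a1 hAB z * lie a1 hAB z) + 3 * (hAA z * hBB z)"
    using eq2[OF smooth_fields(2)]
    by (simp add: lie_simps smooth_simps smooth_F z \<rho>_z \<rho>_jet T_jet \<sigma>_jet T D D_jet algebra_simps)
  show "lie a2 (lie a2 F) z * \<sigma> z + 2 * (lie a2 F z * lie a2 \<sigma> z) + F z * (lie a2 (lie a2 \<sigma>) z - \<sigma> z)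
      = lie a2 (lie a2 hAA) z * hBB z + 2 * (lie a2 hAA z * lie a2 hBB z) + hAA z * lie a2 (lie a2 hBB) z
        - 2 * (lie a2 hAB z * lie a2 hAB z) + 3 * (hAA z * hBB z)"
    using eq2[OF smooth_fields(3)]
    by (simp add: lie_simps smooth_simps smooth_F z \<rho>_z \<rho>_jet T_jet \<sigma>_jet T D D_jet algebra_simps)
  show "lie a0 hAA z = lie a1 (lie a1 F) z + F z" "lie a0 hBB z = lie a2 (lie a2 F) z + F z"
    by (simp_all add: hess_evolution z lie_simps smooth_simps smooth_F \<rho>_z \<rho>_jet)
qed

end

end

section \<open>Evolution of the pinching quantities\<close>

text \<open>Here \<open>p\<close>, \<open>s\<close> are the principal radii and \<open>a\<close>, \<open>c\<close> are derivatives of the Hessian of the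
  support function.  The cubic factors in \<open>crit\<close> are what remains of the equation for a critical point of the
  cubic quantity after dividing by \<open>p - s\<close>.  After clearing denominators the expression is a square
  times a polynomial in \<open>p\<close>, \<open>s\<close> all of whose coefficients are positive.\<close>
lemma cubic_gradient_terms:
  fixes p s a c :: real
  assumes pos: "p > 0" "s > 0"
    and crit: "a * (3 * p^3 + 3 * p\<^sup>2 * s - p * s\<^sup>2 + 3 * s^3) = c * (3 * s^3 + 3 * s\<^sup>2 * p - s * p\<^sup>2 + 3 * p^3)"
  defines "F \<equiv> p * s / (p + s)" and "G \<equiv> (s\<^sup>2 * a + p\<^sup>2 * c) / (p + s)\<^sup>2"
  shows "s\<^sup>2 / (p + s)\<^sup>2 * ((6 * (p + s) - 12 * F) / 8 * (a + c)\<^sup>2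
      + 2 * ((-12 * (p + s) + 16 * F) / 8 * ((a + c) * G)) + 2 * (p + s) * G\<^sup>2)
    + (3 * (p + s)\<^sup>2 - 12 * (p + s) * F + 8 * F\<^sup>2) / 8 * (2 * (s * a - p * c)\<^sup>2 / (p + s) ^ 3 + 2 * c\<^sup>2 / (p + s)) \<ge> 0"
    (is "?L \<ge> 0")
proof -
  define S where "S = p + s"
  have S: "S > 0" using pos by (simp add: S_def)
  \<comment> \<open>The left hand side multiplied by \<open>8 * S ^ 7\<close>.\<close>
  define tot where "tot = 2 * (3 * S^4 - 12 * (p * s) * S\<^sup>2 + 8 * (p * s)\<^sup>2) * ((s * a - p * c)\<^sup>2 + c\<^sup>2 * S\<^sup>2) * S\<^sup>2
    + s\<^sup>2 * ((6 * S\<^sup>2 - 12 * (p * s)) * (a + c)\<^sup>2 * S^4 + 2 * (16 * (p * s) - 12 * S\<^sup>2) * (a + c) * (s\<^sup>2 * a + p\<^sup>2 * c) * S\<^sup>2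
      + 16 * S\<^sup>2 * (s\<^sup>2 * a + p\<^sup>2 * c)\<^sup>2)"
  \<comment> \<open>The reciprocal is named, with \<open>r * S = 1\<close> as its only relation, so
    that identities with denominators become polynomial ones for \<open>algebra\<close>. The same
    device recurs below.\<close>
  define r where "r = 1 / S"
  have r: "r * S = 1" using S by (simp add: r_def)
  have L: "?L = tot * r ^ 7 / 8"
  proof -
    have F: "F = p * s * r" and G: "G = (s\<^sup>2 * a + p\<^sup>2 * c) * r\<^sup>2"
      by (simp_all add: F_def G_def r_def S_def power_divide)
    have d: "x / S = x * r" "x / S\<^sup>2 = x * r\<^sup>2" "x / S ^ 3 = x * r ^ 3" for x
      by (simp_all add: r_def power_divide)
    show ?thesis
      unfolding F G tot_def S_def[symmetric] unfolding d using r by algebra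
  qed
  define m1 m2 where "m1 = 3 * p^3 + 3 * p\<^sup>2 * s - p * s\<^sup>2 + 3 * s^3" and "m2 = 3 * s^3 + 3 * s\<^sup>2 * p - s * p\<^sup>2 + 3 * p^3"
  have "m2 > 0"
  proof -
    have "m2 = 2 * s^3 + 3 * s\<^sup>2 * p + 2 * p^3 + (p + s) * (p - s)\<^sup>2 + s\<^sup>2 * p" unfolding m2_def by algebra
    then show ?thesis using pos by (simp add: add_pos_pos add_pos_nonneg)
  qed
  \<comment> \<open>\<open>crit\<close> reads \<open>a * m1 = c * m2\<close>, which fixes the pair
    \<open>(a, c)\<close> up to a common factor \<open>k\<close>; the claim becomes one in
    \<open>p\<close> and \<open>s\<close> alone.\<close>
  define k where "k = a / m2"
  have a: "a = k * m2" and c: "c = k * m1"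
    using crit[folded m1_def m2_def] \<open>m2 > 0\<close> by (simp_all add: k_def field_simps)
  have "tot = k\<^sup>2 * (36 * s^14 + 144 * p * s^13 + 180 * p^2 * s^12 + 384 * p^3 * s^11 + 1204 * p^4 * s^10
    + 1936 * p^5 * s^9 + 2244 * p^6 * s^8 + 2560 * p^7 * s^7 + 2284 * p^8 * s^6 + 1584 * p^9 * s^5
    + 1308 * p^10 * s^4 + 1152 * p^11 * s^3 + 828 * p^12 * s^2 + 432 * p^13 * s + 108 * p^14)"
    unfolding tot_def a c m1_def m2_def S_def by algebra
  then have "tot \<ge> 0" using pos by simp
  then show ?thesis unfolding L using S by (simp add: r_def)
qed

text \<open>The second order jet of the flow at a vertex of the chart: \<open>p\<close>, \<open>s\<close> are the principal radii,
  \<open>a\<close>, \<open>b\<close>, \<open>c\<close>, \<open>d\<close> the third and \<open>p11\<close>, \<open>s11\<close>, \<open>s22\<close> the fourth derivatives of the support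
  function, and the suffixes \<open>a\<close>, \<open>b\<close>, \<open>0\<close> denote derivatives along \<open>A\<close>, \<open>B\<close> and time.
  The hypotheses come from differentiating \<open>F * (p + s) = p * s\<close>, the extra terms being the curvature
  of the sphere.\<close>
context
  fixes p s F Fa Fb F0 Faa Fbb a b c d p11 s11 s22 p0 s0 :: real
  assumes pos: "p > 0" "s > 0"
    and F: "F * (p + s) = p * s"
    and Fa: "Fa * (p + s) + F * (a + c) = a * s + p * c"
    and Fb: "Fb * (p + s) + F * (b + d) = b * s + p * d"
    and F0: "F0 * (p + s) + F * (p0 + s0) = p0 * s + p * s0"
    and Faa: "Faa * (p + s) + 2 * (Fa * (a + c)) + F * (p11 + s11 + 3 * p + s - (p + s))
      = p11 * s + 2 * (a * c) + p * s11 - 2 * (b * b) + 3 * (p * s)"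
    and Fbb: "Fbb * (p + s) + 2 * (Fb * (b + d)) + F * (s11 + s22 + p + 3 * s - (p + s))
      = s11 * s + 2 * (b * d) + p * s22 - 2 * (c * c) + 3 * (p * s)"
    and p0: "p0 = Faa + F" and s0: "s0 = Fbb + F"
begin

text \<open>Implicit differentiation: the weights of the two radii are the partial derivatives of
  \<open>p * s / (p + s)\<close> with respect to \<open>p\<close> and \<open>s\<close>.\<close>

lemma first_order: "Fa = (s\<^sup>2 * a + p\<^sup>2 * c) / (p + s)\<^sup>2" "Fb = (s\<^sup>2 * b + p\<^sup>2 * d) / (p + s)\<^sup>2"
  "F0 = (s\<^sup>2 * p0 + p\<^sup>2 * s0) / (p + s)\<^sup>2"
proof -
  have *: "G = (s\<^sup>2 * x + p\<^sup>2 * y) / (p + s)\<^sup>2" if "G * (p + s) + F * (x + y) = x * s + p * y" for G x y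
  proof -
    have "G * (p + s)\<^sup>2 = s\<^sup>2 * x + p\<^sup>2 * y" using that F by algebra
    then show ?thesis using pos by (simp add: field_simps)
  qed
  show "Fa = (s\<^sup>2 * a + p\<^sup>2 * c) / (p + s)\<^sup>2" "Fb = (s\<^sup>2 * b + p\<^sup>2 * d) / (p + s)\<^sup>2"
    "F0 = (s\<^sup>2 * p0 + p\<^sup>2 * s0) / (p + s)\<^sup>2"
    using *[OF Fa] *[OF Fb] *[OF F0] by auto
qed

text \<open>The chain rule in time: the second order part is the linearization of the flow operator,
  and the rest comes from the summand \<open>F\<close> in \<open>p0\<close> and
  \<open>s0\<close>.\<close>

lemma F_evolution:
  "F0 = s\<^sup>2 / (p + s)\<^sup>2 * Faa + p\<^sup>2 / (p + s)\<^sup>2 * Fbb + F * (s\<^sup>2 + p\<^sup>2) / (p + s)\<^sup>2"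
  unfolding first_order(3) p0 s0 by (simp add: add_divide_distrib ring_distribs mult.commute)

text \<open>Besides the linearized operator and zero order terms, the second derivative of
  \<open>F\<close> as a function of the symmetric matrix of radii appears: the squares over
  \<open>(p + s) ^ 3\<close> come from varying the eigenvalues, those over \<open>p + s\<close> from
  the off-diagonal entries, whose derivatives are \<open>b\<close> and \<open>c\<close>.\<close>

lemma \<sigma>_evolution:
  "p0 + s0 = s\<^sup>2 / (p + s)\<^sup>2 * (p11 + s11 + 3 * p + s) + p\<^sup>2 / (p + s)\<^sup>2 * (s11 + s22 + p + 3 * s)
    - 2 * ((s * a - p * c)\<^sup>2 + (s * b - p * d)\<^sup>2) / (p + s) ^ 3 - 2 * (b\<^sup>2 + c\<^sup>2) / (p + s)
    + 4 * F - (s\<^sup>2 + p\<^sup>2) / (p + s)"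
proof -
  define r where "r = 1 / (p + s)"
  have r: "r * (p + s) = 1" using pos by (simp add: r_def)
  have F': "F = p * s * r" using F r by algebra
  have Fa': "Fa = (s\<^sup>2 * a + p\<^sup>2 * c) * r\<^sup>2" using Fa F r by algebra
  have Fb': "Fb = (s\<^sup>2 * b + p\<^sup>2 * d) * r\<^sup>2" using Fb F r by algebra
  have Faa': "Faa = (p11 * s + 2 * (a * c) + p * s11 - 2 * (b * b) + 3 * (p * s)
      - 2 * (Fa * (a + c)) - F * (p11 + s11 + 3 * p + s - (p + s))) * r" using Faa r by algebra
  have Fbb': "Fbb = (s11 * s + 2 * (b * d) + p * s22 - 2 * (c * c) + 3 * (p * s)
      - 2 * (Fb * (b + d)) - F * (s11 + s22 + p + 3 * s - (p + s))) * r" using Fbb r by algebra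
  have "p0 + s0 = s\<^sup>2 * r\<^sup>2 * (p11 + s11 + 3 * p + s) + p\<^sup>2 * r\<^sup>2 * (s11 + s22 + p + 3 * s)
    - 2 * ((s * a - p * c)\<^sup>2 + (s * b - p * d)\<^sup>2) * r ^ 3 - 2 * (b\<^sup>2 + c\<^sup>2) * r
    + 4 * F - (s\<^sup>2 + p\<^sup>2) * r"
    unfolding p0 s0 Faa' Fbb' Fa' Fb' F' using r by algebra
  then show ?thesis by (simp add: r_def power_divide)
qed

lemma linear_pinching_decreasing:
  assumes "(p11 + s11 + 3 * p + s) - 4 * Faa \<le> 0" "(s11 + s22 + p + 3 * s) - 4 * Fbb \<le> 0"
  shows "(p0 + s0) - 4 * F0 \<le> 0"
proof -
  define u v where "u = s\<^sup>2 / (p + s)\<^sup>2" and "v = p\<^sup>2 / (p + s)\<^sup>2"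
  have uv: "u \<ge> 0" "v \<ge> 0" by (simp_all add: u_def v_def)
  \<comment> \<open>Minus the second derivative of \<open>F\<close>, non-negative by
    concavity.\<close>
  define Q where "Q = 2 * ((s * a - p * c)\<^sup>2 + (s * b - p * d)\<^sup>2) / (p + s) ^ 3 + 2 * (b\<^sup>2 + c\<^sup>2) / (p + s)"
  have Q: "Q \<ge> 0" using pos by (simp add: Q_def)
  have "(p0 + s0) - 4 * F0 = u * ((p11 + s11 + 3 * p + s) - 4 * Faa) + v * ((s11 + s22 + p + 3 * s) - 4 * Fbb)
     - Q + (4 * F - (s\<^sup>2 + p\<^sup>2) / (p + s) - 4 * (F * (s\<^sup>2 + p\<^sup>2) / (p + s)\<^sup>2))"
    unfolding F_evolution \<sigma>_evolution Q_def u_def v_def by (simp add: algebra_simps)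
  moreover have "4 * F - (s\<^sup>2 + p\<^sup>2) / (p + s) - 4 * (F * (s\<^sup>2 + p\<^sup>2) / (p + s)\<^sup>2) \<le> 0"
  proof -
    define r where "r = 1 / (p + s)"
    have r: "r * (p + s) = 1" "r > 0" using pos by (simp_all add: r_def)
    have F': "F = p * s * r" using F r(1) by algebra
    have "4 * F - (s\<^sup>2 + p\<^sup>2) * r - 4 * (F * (s\<^sup>2 + p\<^sup>2) * r\<^sup>2)
      = - ((p - s)\<^sup>2 * (p\<^sup>2 + s\<^sup>2 + 4 * (p * s)) * r ^ 3)"
      unfolding F' using r(1) by algebra
    also have "\<dots> \<le> 0" using pos r(2) by simp
    finally show ?thesis by (simp add: r_def power_divide)
  qed
  ultimately show ?thesis using assms uv Q by (smt (verit) mult_nonneg_nonpos)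
qed

text \<open>With \<sigma> standing for \<open>p + s\<close>, the constants are partial derivatives
  of \<open>\<sigma> * (\<sigma> - 2 * F) * (\<sigma> - 4 * F) / 8\<close>: \<open>gs\<close> and
  \<open>gF\<close> of first order, \<open>gss\<close> and \<open>gsF\<close> of second order; the
  remaining one, twice in \<open>F\<close>, is \<open>2 * (p + s)\<close>. So \<open>crit\<close>
  and \<open>hess\<close> are the conditions at a spatial maximum.\<close>

lemma cubic_pinching_decreasing:
  defines "gs \<equiv> (3 * (p + s)\<^sup>2 - 12 * (p + s) * F + 8 * F\<^sup>2) / 8" and "gF \<equiv> 2 * (p + s) * F - 3 / 4 * (p + s)\<^sup>2"
    and "gss \<equiv> (6 * (p + s) - 12 * F) / 8" and "gsF \<equiv> (-12 * (p + s) + 16 * F) / 8"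
  assumes crit: "gs * (a + c) + gF * Fa = 0" "gs * (b + d) + gF * Fb = 0"
    and hess: "gs * (p11 + s11 + 3 * p + s) + gF * Faa + (gss * (a + c)\<^sup>2 + 2 * (gsF * ((a + c) * Fa)) + 2 * (p + s) * Fa\<^sup>2) \<le> 0"
      "gs * (s11 + s22 + p + 3 * s) + gF * Fbb + (gss * (b + d)\<^sup>2 + 2 * (gsF * ((b + d) * Fb)) + 2 * (p + s) * Fb\<^sup>2) \<le> 0"
  shows "gs * (p0 + s0) + gF * F0 \<le> 0"
proof (cases "p = s")
  case True
  \<comment> \<open>At an umbilic point the critical point equations are void, but the left hand side vanishes.\<close>
  then have F2: "F = s / 2" using F pos by (simp add: field_simps)
  have "s * (4 * F0) = s * (p0 + s0)" using F0 unfolding F2 True by (simp add: field_simps)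
  then have F0': "F0 = (p0 + s0) / 4" using pos by simp
  show ?thesis unfolding gs_def gF_def F2 F0' True by (simp add: field_simps power2_eq_square)
next
  case False
  define r where "r = 1 / (p + s)"
  have r: "r * (p + s) = 1" "r > 0" using pos by (simp_all add: r_def)
  have F': "F = p * s * r" using F r(1) by algebra
  define m1 m2 where "m1 = 3 * p^3 + 3 * p\<^sup>2 * s - p * s\<^sup>2 + 3 * s^3" and "m2 = 3 * s^3 + 3 * s\<^sup>2 * p - s * p\<^sup>2 + 3 * p^3"
  have m: "x * m1 = y * m2" if "gs * (x + y) + gF * ((s\<^sup>2 * x + p\<^sup>2 * y) / (p + s)\<^sup>2) = 0" for x y
  proof -
    \<comment> \<open>The gradient contains the factor \<open>p - s\<close>; cancelling it leaves
      the linear relation used in \<open>cubic_gradient_terms\<close>.\<close>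
    have "gs * (x + y) + gF * ((s\<^sup>2 * x + p\<^sup>2 * y) * r\<^sup>2) = (p - s) * (x * m1 - y * m2) * r\<^sup>2 / 8"
      unfolding gs_def gF_def F' m1_def m2_def using r(1) by algebra
    then show ?thesis using that False r(2) by (simp add: r_def power_divide)
  qed
  define u v where "u = s\<^sup>2 / (p + s)\<^sup>2" and "v = p\<^sup>2 / (p + s)\<^sup>2"
  have uv: "u \<ge> 0" "v \<ge> 0" by (simp_all add: u_def v_def)
  define ga gb where "ga = gss * (a + c)\<^sup>2 + 2 * (gsF * ((a + c) * Fa)) + 2 * (p + s) * Fa\<^sup>2"
    and "gb = gss * (b + d)\<^sup>2 + 2 * (gsF * ((b + d) * Fb)) + 2 * (p + s) * Fb\<^sup>2"
  have F'': "F = p * s / (p + s)" "F = s * p / (s + p)" using F' by (simp_all add: r_def add.commute mult.commute)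
  \<comment> \<open>The gradient terms split into a form in \<open>a\<close>, \<open>c\<close> and
    one in \<open>b\<close>, \<open>d\<close>; the off-diagonal square of \<open>c\<close> belongs
    to the first, that of \<open>b\<close> to the second.\<close>
  have "u * ga + gs * (2 * (s * a - p * c)\<^sup>2 / (p + s) ^ 3 + 2 * c\<^sup>2 / (p + s)) \<ge> 0"
    using cubic_gradient_terms[OF pos m[OF crit(1)[unfolded first_order(1)], unfolded m1_def m2_def]]
    unfolding u_def ga_def gs_def gss_def gsF_def first_order(1) F''(1) .
  \<comment> \<open>The previous inequality with \<open>p\<close> and \<open>s\<close> exchanged and
    \<open>d\<close>, \<open>b\<close> in place of \<open>a\<close>, \<open>c\<close>.\<close>
  moreover have "v * gb + gs * (2 * (p * d - s * b)\<^sup>2 / (p + s) ^ 3 + 2 * b\<^sup>2 / (p + s)) \<ge> 0"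
    using cubic_gradient_terms[OF pos(2,1) m[OF crit(2)[unfolded first_order(2)], unfolded m1_def m2_def, symmetric]]
    unfolding v_def gb_def gs_def gss_def gsF_def first_order(2) F''(1)
    by (simp only: add.commute[of s p] mult.commute[of s p] add.commute[of d b] add.commute[of "p\<^sup>2 * d"])
  moreover have "gs * (4 * F - (s\<^sup>2 + p\<^sup>2) / (p + s)) + gF * (F * (s\<^sup>2 + p\<^sup>2) / (p + s)\<^sup>2) \<le> 0"
  proof -
    have "gs * (4 * F - (s\<^sup>2 + p\<^sup>2) * r) + gF * (F * (s\<^sup>2 + p\<^sup>2) * r\<^sup>2)
      = - ((p - s)\<^sup>2 * (3 * p ^ 4 + 3 * s ^ 4 - 2 * p\<^sup>2 * s\<^sup>2) * r ^ 3 / 8)"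
      unfolding gs_def gF_def F' using r(1) by algebra
    also have "3 * p ^ 4 + 3 * s ^ 4 - 2 * p\<^sup>2 * s\<^sup>2 = (p\<^sup>2 - s\<^sup>2)\<^sup>2 + 2 * p ^ 4 + 2 * s ^ 4" by algebra
    also have "- ((p - s)\<^sup>2 * ((p\<^sup>2 - s\<^sup>2)\<^sup>2 + 2 * p ^ 4 + 2 * s ^ 4) * r ^ 3 / 8) \<le> 0" using pos r(2) by simp
    finally show ?thesis by (simp add: r_def power_divide)
  qed
  moreover have "u * (gs * (p11 + s11 + 3 * p + s) + gF * Faa + ga) \<le> 0"
    "v * (gs * (s11 + s22 + p + 3 * s) + gF * Fbb + gb) \<le> 0"
    using hess uv unfolding ga_def gb_def by (simp_all add: mult_nonneg_nonpos)
  moreover have "gs * (p0 + s0) + gF * F0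
    = u * (gs * (p11 + s11 + 3 * p + s) + gF * Faa + ga) + v * (gs * (s11 + s22 + p + 3 * s) + gF * Fbb + gb)
    - (u * ga + gs * (2 * (s * a - p * c)\<^sup>2 / (p + s) ^ 3 + 2 * c\<^sup>2 / (p + s)))
    - (v * gb + gs * (2 * (p * d - s * b)\<^sup>2 / (p + s) ^ 3 + 2 * b\<^sup>2 / (p + s)))
    + (gs * (4 * F - (s\<^sup>2 + p\<^sup>2) / (p + s)) + gF * (F * (s\<^sup>2 + p\<^sup>2) / (p + s)\<^sup>2))"
    unfolding F_evolution \<sigma>_evolution u_def[symmetric] v_def[symmetric] power2_commute[of "p * d"]
    by (simp add: algebra_simps add_divide_distrib)
  ultimately show ?thesis by linarith
qed

end

context gauss_chart_flow
begin

text \<open>Since \<open>F = 1 / (\<kappa>1 + \<kappa>2)\<close> and \<open>\<sigma> = (\<kappa>1 + \<kappa>2) / (\<kappa>1 \<kappa>2)\<close>, the two quantities of the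
  theorem are polynomials in \<open>\<sigma>\<close> and \<open>F\<close>, here rescaled by 2 and by 8.\<close>
definition "linear_pinching x = \<sigma> x - 4 * F x"
definition "cubic_pinching x = \<sigma> x * \<sigma> x * \<sigma> x - 6 * (\<sigma> x * \<sigma> x * F x) + 8 * (\<sigma> x * F x * F x)"

lemma smooth_pinching: "smooth_on \<Omega> linear_pinching" "smooth_on \<Omega> cubic_pinching"
  unfolding linear_pinching_def[abs_def] cubic_pinching_def[abs_def]
  by (intro smooth_intros smooth_TD\<sigma> smooth_F)+

context
  fixes z
  assumes z: "z \<in> \<Omega>" and vertex: "A z = 0" "B z = 0" "hAB z = 0"
    and pos: "hAA z > 0" "hBB z > 0"
begin

text \<open>Matches the chart with the algebraic context: \<open>p\<close>, \<open>s\<close> are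
  \<open>hAA\<close>, \<open>hBB\<close>, and \<open>a\<close>, \<open>b\<close>, \<open>c\<close>,
  \<open>d\<close> are \<open>lie a1 hAA\<close>, \<open>lie a2 hAA\<close>,
  \<open>lie a2 hAB\<close>, \<open>lie a2 hBB\<close>. The Codazzi equations identify the other
  third derivatives with these.\<close>

lemma jet_hyps:
  shows "F z * (hAA z + hBB z) = hAA z * hBB z"
    "lie a1 F z * (hAA z + hBB z) + F z * (lie a1 hAA z + lie a2 hAB z) = lie a1 hAA z * hBB z + hAA z * lie a2 hAB z"
    "lie a2 F z * (hAA z + hBB z) + F z * (lie a2 hAA z + lie a2 hBB z) = lie a2 hAA z * hBB z + hAA z * lie a2 hBB z"
    "lie a0 F z * (hAA z + hBB z) + F z * (lie a0 hAA z + lie a0 hBB z) = lie a0 hAA z * hBB z + hAA z * lie a0 hBB z"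
    "lie a1 (lie a1 F) z * (hAA z + hBB z) + 2 * (lie a1 F z * (lie a1 hAA z + lie a2 hAB z))
       + F z * (lie a1 (lie a1 hAA) z + lie a1 (lie a1 hBB) z + 3 * hAA z + hBB z - (hAA z + hBB z))
     = lie a1 (lie a1 hAA) z * hBB z + 2 * (lie a1 hAA z * lie a2 hAB z) + hAA z * lie a1 (lie a1 hBB) z
       - 2 * (lie a2 hAA z * lie a2 hAA z) + 3 * (hAA z * hBB z)"
    "lie a2 (lie a2 F) z * (hAA z + hBB z) + 2 * (lie a2 F z * (lie a2 hAA z + lie a2 hBB z))
       + F z * (lie a1 (lie a1 hBB) z + lie a2 (lie a2 hBB) z + hAA z + 3 * hBB z - (hAA z + hBB z))
     = lie a1 (lie a1 hBB) z * hBB z + 2 * (lie a2 hAA z * lie a2 hBB z) + hAA z * lie a2 (lie a2 hBB) z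
       - 2 * (lie a2 hAB z * lie a2 hAB z) + 3 * (hAA z * hBB z)"
  using F_jet[OF z vertex] unfolding \<sigma>_jet[OF z vertex] codazzi[OF z] by auto

lemmas jet = pos jet_hyps F_jet(7,8)[OF z vertex]

lemma linear_pinching_max:
  assumes max: "\<And>y. y \<in> \<Omega> \<Longrightarrow> fst y = fst z \<Longrightarrow> linear_pinching y \<le> linear_pinching z"
  shows "lie a0 linear_pinching z \<le> 0"
proof -
  have d: "lie a0 linear_pinching z = lie a0 \<sigma> z - 4 * lie a0 F z"
    "lie a1 (lie a1 linear_pinching) z = lie a1 (lie a1 \<sigma>) z - 4 * lie a1 (lie a1 F) z"
    "lie a2 (lie a2 linear_pinching) z = lie a2 (lie a2 \<sigma>) z - 4 * lie a2 (lie a2 F) z"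
    unfolding linear_pinching_def[abs_def] by (simp_all add: lie_simps smooth_simps smooth_F z)
  note m = lie_max(2)[OF open_\<Omega> smooth_pinching(1) _ z max]
  have "lie a1 (lie a1 linear_pinching) z \<le> 0" "lie a2 (lie a2 linear_pinching) z \<le> 0"
    by (intro m smooth_fields horizontal; assumption)+
  then show ?thesis
    using linear_pinching_decreasing[OF jet] unfolding d \<sigma>_jet[OF z vertex] codazzi[OF z] by simp
qed

lemma cubic_pinching_max:
  assumes max: "\<And>y. y \<in> \<Omega> \<Longrightarrow> fst y = fst z \<Longrightarrow> cubic_pinching y \<le> cubic_pinching z"
  shows "lie a0 cubic_pinching z \<le> 0"
proof -
  define gs gF gss gsF where "gs = (3 * (\<sigma> z)\<^sup>2 - 12 * \<sigma> z * F z + 8 * (F z)\<^sup>2) / 8"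
    and "gF = 2 * \<sigma> z * F z - 3 / 4 * (\<sigma> z)\<^sup>2"
    and "gss = (6 * \<sigma> z - 12 * F z) / 8" and "gsF = (-12 * \<sigma> z + 16 * F z) / 8"
  have d: "lie a cubic_pinching z = 8 * (gs * lie a \<sigma> z + gF * lie a F z)" for a
    unfolding cubic_pinching_def[abs_def] gs_def gF_def
    by (simp add: lie_simps smooth_simps smooth_F z, simp add: field_simps power2_eq_square)
  have dd: "lie a (lie a cubic_pinching) z = 8 * (gs * lie a (lie a \<sigma>) z + gF * lie a (lie a F) z
      + (gss * (lie a \<sigma> z)\<^sup>2 + 2 * (gsF * (lie a \<sigma> z * lie a F z)) + 2 * \<sigma> z * (lie a F z)\<^sup>2))"
    if "smooth_on \<Omega> a" for a
    unfolding cubic_pinching_def[abs_def] gs_def gF_def gss_def gsF_def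
    by (simp add: lie_simps smooth_simps smooth_F z that, simp add: field_simps power2_eq_square)
  note m = lie_max[OF open_\<Omega> smooth_pinching(2) _ z max]
  have c: "lie a1 cubic_pinching z = 0" "lie a2 cubic_pinching z = 0"
    by (intro m smooth_fields horizontal; assumption)+
  have h: "lie a1 (lie a1 cubic_pinching) z \<le> 0" "lie a2 (lie a2 cubic_pinching) z \<le> 0"
    by (intro m smooth_fields horizontal; assumption)+
  show ?thesis
    using cubic_pinching_decreasing[OF jet] c h
    unfolding d dd[OF smooth_fields(2)] dd[OF smooth_fields(3)] gs_def gF_def gss_def gsF_def
      \<sigma>_jet[OF z vertex] codazzi[OF z] by simp
qed

end

end

section \<open>A maximum principle on compact sets\<close>

text \<open>Compactness gives the earliest time at which \<open>w - \<delta> t\<close> reaches its value at a point of the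
  final slice; if it came after \<open>s\<close>, the time derivative at a spatial maximum would contradict it.\<close>
lemma SUP_nonincreasing_if_decreasing_at_max:
  fixes w :: "real \<Rightarrow> 'k::metric_space \<Rightarrow> real"
  assumes K: "compact K" "K \<noteq> {}"
    and cont: "continuous_on ({a<..<b} \<times> K) (\<lambda>x. w (fst x) (snd x))"
    and dec: "\<And>t p. t \<in> {a<..<b} \<Longrightarrow> p \<in> K \<Longrightarrow> (\<And>q. q \<in> K \<Longrightarrow> w t q \<le> w t p) \<Longrightarrow>
      \<exists>d\<le>0. ((\<lambda>t. w t p) has_real_derivative d) (at t)"
    and st: "a < s" "s \<le> t" "t < b"
  shows "(SUP p\<in>K. w t p) \<le> (SUP p\<in>K. w s p)"
proof -
  have slice: "continuous_on K (w r)" if "r \<in> {a<..<b}" for r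
    using continuous_on_compose2[OF cont continuous_on_Pair[OF continuous_on_const[of K r] continuous_on_id]]
      that by (simp add: image_subset_iff)
  have ex_max: "\<exists>p\<in>K. \<forall>q\<in>K. w r q \<le> w r p" if "r \<in> {a<..<b}" for r
    using continuous_attains_sup[OF K slice[OF that]] .
  have bdd: "bdd_above (w r ` K)" if "r \<in> {a<..<b}" for r
    using compact_imp_bounded[OF compact_continuous_image[OF slice[OF that] K(1)]]
    by (rule bounded_imp_bdd_above)
  have bound: "w t p \<le> (SUP p\<in>K. w s p) + e" if p: "p \<in> K" and e: "e > 0" for p e
  proof -
    \<comment> \<open>Over the whole time interval the slope \<delta> costs at most
      \<open>e\<close>; the \<open>+ 1\<close> covers \<open>s = t\<close>.\<close>
    define \<delta> where "\<delta> = e / (t - s + 1)"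
    have \<delta>: "\<delta> > 0" "\<delta> * (t - s) \<le> e" using e st by (auto simp: \<delta>_def field_simps)
    define Z where "Z = {x \<in> {s..t} \<times> K. w t p - \<delta> * t \<le> w (fst x) (snd x) - \<delta> * fst x}"
    have sub: "{s..t} \<times> K \<subseteq> {a<..<b} \<times> K" using st by auto
    have "compact Z"
    proof -
      have "closed Z" unfolding Z_def
        by (intro continuous_closed_preimage_constant continuous_on_closed_Collect_le continuous_intros
            continuous_on_subset[OF cont sub] compact_imp_closed compact_Times K compact_Icc)
      moreover have "Z = ({s..t} \<times> K) \<inter> Z" by (auto simp: Z_def)
      ultimately show ?thesis using compact_Int_closed[OF compact_Times[OF compact_Icc K(1)]] by metis
    qed
    moreover have "(t, p) \<in> Z" using p st by (simp add: Z_def)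
    ultimately obtain x where x: "x \<in> Z" and xmin: "\<And>y. y \<in> Z \<Longrightarrow> fst x \<le> fst y"
      using continuous_attains_inf[of Z fst] continuous_on_fst[OF continuous_on_id] by blast
    define r where "r = fst x"
    have r: "r \<in> {s..t}" "r \<in> {a<..<b}" using x st by (auto simp: Z_def r_def)
    obtain q where q: "q \<in> K" "\<And>q'. q' \<in> K \<Longrightarrow> w r q' \<le> w r q" using ex_max[OF r(2)] by blast
    have "w r (snd x) \<le> w r q" using q(2) x by (auto simp: Z_def)
    then have rq: "w t p - \<delta> * t \<le> w r q - \<delta> * r" using x by (simp add: Z_def r_def)
    have "r = s"
    proof (rule ccontr)
      assume "r \<noteq> s"
      then have rs: "s < r" using r by simp
      obtain d where d: "d \<le> 0" "((\<lambda>t. w t q) has_real_derivative d) (at r)"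
        using dec[OF r(2) q] by blast
      have "((\<lambda>t. w t q - \<delta> * t) has_real_derivative d - \<delta>) (at r)"
        by (auto intro!: derivative_eq_intros d(2))
      from DERIV_neg_dec_left[OF this] d(1) \<delta>(1) obtain \<eta> where \<eta>: "\<eta> > 0"
        "\<And>h. 0 < h \<Longrightarrow> h < \<eta> \<Longrightarrow> w r q - \<delta> * r < w (r - h) q - \<delta> * (r - h)" by auto
      define h where "h = min \<eta> (r - s) / 2"
      have h: "0 < h" "h < \<eta>" "h < r - s" using \<eta>(1) rs by (auto simp: h_def)
      have "(r - h, q) \<in> Z" using \<eta>(2)[OF h(1,2)] rq q(1) r(1) h by (auto simp: Z_def)
      then show False using xmin h by (force simp: r_def)
    qed
    then have "w t p \<le> w s q + \<delta> * (t - s)" using rq by (simp add: algebra_simps)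
    also have "w s q \<le> (SUP p\<in>K. w s p)" by (rule cSUP_upper[OF q(1) bdd]) (use st in auto)
    finally show ?thesis using \<delta>(2) by simp
  qed
  show ?thesis by (rule cSUP_least[OF K(2)], rule field_le_epsilon) (rule bound)
qed

section \<open>Linear algebra of the Weingarten map\<close>

definition orthonormal3 :: "real^3 \<Rightarrow> real^3 \<Rightarrow> real^3 \<Rightarrow> bool" where
  "orthonormal3 u v w \<longleftrightarrow> u \<bullet> u = 1 \<and> v \<bullet> v = 1 \<and> w \<bullet> w = 1 \<and> u \<bullet> v = 0 \<and> u \<bullet> w = 0 \<and> v \<bullet> w = 0"

lemma orthonormal3_expand:
  assumes o: "orthonormal3 u v w"
  shows "x = (x \<bullet> u) *\<^sub>R u + (x \<bullet> v) *\<^sub>R v + (x \<bullet> w) *\<^sub>R w"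
proof -
  have ne: "u \<noteq> v" "u \<noteq> w" "v \<noteq> w" using o by (auto simp: orthonormal3_def)
  have po: "pairwise orthogonal {u, v, w}"
    using o by (auto simp: pairwise_def orthogonal_def orthonormal3_def inner_commute)
  have n: "norm i = 1" if "i \<in> {u, v, w}" for i
    using that o by (auto simp: orthonormal3_def norm_eq_1)
  have ind: "independent {u, v, w}"
    using pairwise_orthogonal_independent[OF po] n by force
  have "UNIV \<subseteq> span {u, v, w}"
    by (rule card_ge_dim_independent[OF _ ind]) (use ne in auto)
  then have "(\<Sum>i\<in>{u, v, w}. (x \<bullet> i) *\<^sub>R i) = x"
    by (intro orthonormal_basis_expand po n) auto
  then show ?thesis using ne by (simp add: add.assoc)
qed

lemma orthonormal3_inner:
  assumes "orthonormal3 u v w"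
  shows "x \<bullet> y = (x \<bullet> u) * (y \<bullet> u) + (x \<bullet> v) * (y \<bullet> v) + (x \<bullet> w) * (y \<bullet> w)"
  by (subst orthonormal3_expand[OF assms, of y]) (simp add: inner_add_right mult.commute)

lemma orthonormal3_completion:
  assumes "u \<bullet> u = 1" "w \<bullet> w = 1" "u \<bullet> w = 0"
  shows "\<exists>v. orthonormal3 u v w"
proof
  have "cross3 u w \<bullet> cross3 u w = 1"
    using norm_cross[of u w] unfolding power2_norm_eq_inner by (simp add: assms)
  then show "orthonormal3 u (cross3 u w) w"
    using assms by (simp add: orthonormal3_def dot_cross_self inner_commute)
qed

lemma orthonormal3_exists:
  assumes "w \<bullet> w = 1" shows "\<exists>u v. orthonormal3 u v w"
proof -
  obtain y :: "real^3" where y: "y \<noteq> 0" "orthogonal w y" using orthogonal_to_vector_exists[of w] by auto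
  have "(y /\<^sub>R norm y) \<bullet> (y /\<^sub>R norm y) = 1" "(y /\<^sub>R norm y) \<bullet> w = 0"
    using y by (simp_all add: orthogonal_def inner_commute flip: power2_norm_eq_inner norm_eq_1)
  then show ?thesis using orthonormal3_completion[OF _ assms] by blast
qed

lemma orthogonal_complement_span2:
  fixes x v u w :: "real^3"
  assumes "x \<noteq> 0" "u \<bullet> x = 0" "w \<bullet> x = 0" "v \<bullet> x = 0"
    and ind: "\<And>\<alpha> \<beta>. \<alpha> *\<^sub>R u + \<beta> *\<^sub>R w = 0 \<Longrightarrow> \<alpha> = 0 \<and> \<beta> = 0"
  shows "\<exists>\<alpha> \<beta>. v = \<alpha> *\<^sub>R u + \<beta> *\<^sub>R w"
proof -
  have ne: "u \<noteq> w" using ind[of 1 "-1"] by auto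
  have w0: "w \<noteq> 0" using ind[of 0 1] by auto
  have "u \<notin> span {w}"
  proof
    assume "u \<in> span {w}"
    then obtain k where "u = k *\<^sub>R w" by (auto simp: span_singleton)
    then show False using ind[of 1 "-k"] by simp
  qed
  then have i: "independent {u, w}" using w0 ne by (simp add: independent_insert)
  have "dim {v. x \<bullet> v = 0} = 2" using dim_hyperplane[OF assms(1)] by simp
  then have "{v. x \<bullet> v = 0} \<subseteq> span {u, w}"
    by (intro card_ge_dim_independent[OF _ i]) (use assms(2,3) ne in \<open>auto simp: inner_commute\<close>)
  then have "v \<in> span {u, w}" using assms by (auto simp: inner_commute)
  then obtain \<alpha> where "v - \<alpha> *\<^sub>R u \<in> span {w}" by (auto simp: span_insert)
  then obtain \<beta> where "v - \<alpha> *\<^sub>R u = \<beta> *\<^sub>R w" by (auto simp: span_singleton)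
  then show ?thesis by (metis add.commute diff_add_cancel)
qed

text \<open>Vieta's formulas for \<open>Min\<close> and \<open>Max\<close> of the root set,
  including the umbilic case in which a double root makes it a singleton. Positivity of the roots
  then yields the signs of \<open>c1\<close> and \<open>c2\<close>.\<close>

lemma Min_Max_quadratic_roots:
  fixes c1 c2 :: real
  assumes "c2 \<noteq> 0" "c1\<^sup>2 \<ge> 4 * c2" and pos: "\<And>l. c2 * l\<^sup>2 - c1 * l + 1 = 0 \<Longrightarrow> l > 0"
  defines "R \<equiv> {l. c2 * l\<^sup>2 - c1 * l + 1 = 0}"
  shows "c1 > 0" "c2 > 0" "Min R + Max R = c1 / c2" "Min R * Max R = 1 / c2" "Min R \<in> R"
proof -
  define d where "d = sqrt (c1\<^sup>2 - 4 * c2)"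
  have d: "d\<^sup>2 = c1\<^sup>2 - 4 * c2" "d \<ge> 0" using assms(2) by (simp_all add: d_def)
  define l m where "l = (c1 - d) / (2 * c2)" and "m = (c1 + d) / (2 * c2)"
  have "l * m = (c1\<^sup>2 - d\<^sup>2) / (4 * c2\<^sup>2)"
    by (simp add: l_def m_def power2_eq_square algebra_simps)
  then have lm: "l + m = c1 / c2" "l * m = 1 / c2"
    using assms(1) unfolding d(1) by (simp_all add: l_def m_def power2_eq_square field_simps)
  have eq: "c2 * x\<^sup>2 - c1 * x + 1 = c2 * (x - l) * (x - m)" for x
  proof -
    have "c2 * (x - l) * (x - m) = c2 * x\<^sup>2 - c2 * (l + m) * x + c2 * (l * m)"
      by (simp add: algebra_simps power2_eq_square)
    then show ?thesis using assms(1) unfolding lm by simp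
  qed
  have R: "R = {l, m}" unfolding R_def eq using assms(1) by auto
  have "l > 0" "m > 0" using pos[of l] pos[of m] unfolding eq by auto
  then show "c2 > 0" using lm(2) by (metis mult_pos_pos zero_less_divide_1_iff)
  then show "c1 > 0" using lm(1) \<open>l > 0\<close> \<open>m > 0\<close> by (metis add_pos_pos zero_less_divide_iff less_asym)
  show "Min R + Max R = c1 / c2" "Min R * Max R = 1 / c2" "Min R \<in> R"
    unfolding R using lm by (auto simp: min_def max_def mult.commute add.commute)
qed

text \<open>In terms of radii this is \<open>(r1 + r2)^2 \<ge> 4 * r1 * r2\<close>, so the quadratic
  for the principal curvatures has real roots. Multiplying by the square of
  \<open>1 + A * A\<close>, the coefficient of \<open>p\<close> on the right, completes the square
  in \<open>p\<close>.\<close>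

lemma trace_det_ineq:
  fixes A B p q s :: real
  shows "4 * (1 + A * A + B * B) * (p * s - q * q) \<le> (p + s + (A * A * p + 2 * (A * B * q) + B * B * s))\<^sup>2"
proof -
  let ?g = "1 + A * A" and ?E = "1 + A * A + B * B" and ?T = "p + s + (A * A * p + 2 * (A * B * q) + B * B * s)"
  have g: "?g > 0" by (simp add: add_pos_nonneg)
  have "?g\<^sup>2 * (?T\<^sup>2 - 4 * ?E * (p * s - q * q))
    = (?g\<^sup>2 * p + 2 * A * B * ?g * q + (A\<^sup>2 * B\<^sup>2 - ?E) * s)\<^sup>2 + 4 * ?E * (?g * q + A * B * s)\<^sup>2"
    by algebra
  also have "\<dots> \<ge> 0"
  proof -
    have "?E \<ge> 0" using zero_le_square[of A] zero_le_square[of B] by linarith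
    moreover have "x\<^sup>2 + 4 * e * y\<^sup>2 \<ge> 0" if "e \<ge> 0" for x y e :: real using that by simp
    ultimately show ?thesis by blast
  qed
  finally have "?T\<^sup>2 - 4 * ?E * (p * s - q * q) \<ge> 0"
    using g by (simp add: zero_le_mult_iff)
  then show ?thesis by simp
qed

text \<open>The left hand side is the eigenvalue equation of the Weingarten map in an affine chart of the Gauss image.\<close>
lemma weingarten_characteristic:
  fixes A B \<rho> p q s l :: real
  assumes \<rho>: "\<rho> > 0" "\<rho> * \<rho> = 1 + A * A + B * B"
  shows "(\<exists>\<alpha> \<beta>. (\<alpha>, \<beta>) \<noteq> (0, 0) \<and> \<alpha> / \<rho> - A * (A * \<alpha> + B * \<beta>) / \<rho> ^ 3 = l * (\<alpha> * p + \<beta> * q)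
      \<and> \<beta> / \<rho> - B * (A * \<alpha> + B * \<beta>) / \<rho> ^ 3 = l * (\<alpha> * q + \<beta> * s))
    \<longleftrightarrow> \<rho> ^ 4 * (p * s - q * q) * l\<^sup>2 - \<rho> * (p + s + (A * A * p + 2 * (A * B * q) + B * B * s)) * l + 1 = 0"
    (is "?L \<longleftrightarrow> ?R")
proof -
  \<comment> \<open>The coefficients of the system multiplied by \<open>\<rho> ^ 3\<close>;
    \<open>1 + B * B\<close> is \<open>\<rho> * \<rho> - A * A\<close>.\<close>
  define g11 g12 g22 where "g11 = 1 + B * B - l * \<rho> ^ 3 * p" and "g12 = - (A * B) - l * \<rho> ^ 3 * q"
    and "g22 = 1 + A * A - l * \<rho> ^ 3 * s"
  have det: "g11 * g22 - g12 * g12 = \<rho>\<^sup>2 * (\<rho> ^ 4 * (p * s - q * q) * l\<^sup>2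
      - \<rho> * (p + s + (A * A * p + 2 * (A * B * q) + B * B * s)) * l + 1)"
    unfolding g11_def g12_def g22_def using \<rho>(2) by algebra
  have row: "(\<alpha> / \<rho> - A * (A * \<alpha> + B * \<beta>) / \<rho> ^ 3 = l * (\<alpha> * p + \<beta> * q)) \<longleftrightarrow> g11 * \<alpha> + g12 * \<beta> = 0"
    "(\<beta> / \<rho> - B * (A * \<alpha> + B * \<beta>) / \<rho> ^ 3 = l * (\<alpha> * q + \<beta> * s)) \<longleftrightarrow> g12 * \<alpha> + g22 * \<beta> = 0" for \<alpha> \<beta>
  proof -
    have e: "\<alpha> / \<rho> - A * (A * \<alpha> + B * \<beta>) / \<rho> ^ 3 - l * (\<alpha> * p + \<beta> * q) = (g11 * \<alpha> + g12 * \<beta>) / \<rho> ^ 3"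
      "\<beta> / \<rho> - B * (A * \<alpha> + B * \<beta>) / \<rho> ^ 3 - l * (\<alpha> * q + \<beta> * s) = (g12 * \<alpha> + g22 * \<beta>) / \<rho> ^ 3"
    proof -
      define r where "r = 1 / \<rho>"
      have r: "r * \<rho> = 1" using \<rho>(1) by (simp add: r_def)
      have d: "x / \<rho> = x * r" "x / \<rho> ^ 3 = x * r ^ 3" for x by (simp_all add: r_def power_divide)
      show "\<alpha> / \<rho> - A * (A * \<alpha> + B * \<beta>) / \<rho> ^ 3 - l * (\<alpha> * p + \<beta> * q) = (g11 * \<alpha> + g12 * \<beta>) / \<rho> ^ 3"
        "\<beta> / \<rho> - B * (A * \<alpha> + B * \<beta>) / \<rho> ^ 3 - l * (\<alpha> * q + \<beta> * s) = (g12 * \<alpha> + g22 * \<beta>) / \<rho> ^ 3"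
        unfolding d g11_def g12_def g22_def using r \<rho>(2) by algebra+
    qed
    show "(\<alpha> / \<rho> - A * (A * \<alpha> + B * \<beta>) / \<rho> ^ 3 = l * (\<alpha> * p + \<beta> * q)) \<longleftrightarrow> g11 * \<alpha> + g12 * \<beta> = 0"
      "(\<beta> / \<rho> - B * (A * \<alpha> + B * \<beta>) / \<rho> ^ 3 = l * (\<alpha> * q + \<beta> * s)) \<longleftrightarrow> g12 * \<alpha> + g22 * \<beta> = 0"
      using e \<rho>(1) by auto
  qed
  have "?L \<longleftrightarrow> (\<exists>\<alpha> \<beta>. (\<alpha>, \<beta>) \<noteq> (0, 0) \<and> g11 * \<alpha> + g12 * \<beta> = 0 \<and> g12 * \<alpha> + g22 * \<beta> = 0)"
    unfolding row ..
  also have "\<dots> \<longleftrightarrow> g11 * g22 - g12 * g12 = 0"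
  proof
    assume "\<exists>\<alpha> \<beta>. (\<alpha>, \<beta>) \<noteq> (0, 0) \<and> g11 * \<alpha> + g12 * \<beta> = 0 \<and> g12 * \<alpha> + g22 * \<beta> = 0"
    then obtain \<alpha> \<beta> where ab: "(\<alpha>, \<beta>) \<noteq> (0, 0)" "g11 * \<alpha> + g12 * \<beta> = 0" "g12 * \<alpha> + g22 * \<beta> = 0" by blast
    have "(g11 * g22 - g12 * g12) * \<alpha> = 0" using ab(2,3) by algebra
    moreover have "(g11 * g22 - g12 * g12) * \<beta> = 0" using ab(2,3) by algebra
    ultimately show "g11 * g22 - g12 * g12 = 0" using ab(1) by auto
  next
    assume det: "g11 * g22 - g12 * g12 = 0"
    show "\<exists>\<alpha> \<beta>. (\<alpha>, \<beta>) \<noteq> (0, 0) \<and> g11 * \<alpha> + g12 * \<beta> = 0 \<and> g12 * \<alpha> + g22 * \<beta> = 0"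
    proof (cases "g11 = 0 \<and> g12 = 0")
      case True
      then show ?thesis by (intro exI[of _ 1] exI[of _ 0]) simp
    next
      case False
      \<comment> \<open>The vector \<open>(- g12, g11)\<close> always solves the first row, and the
        second row at this vector is the determinant.\<close>
      then show ?thesis
        using det by (intro exI[of _ "- g12"] exI[of _ g11]) (auto simp: algebra_simps)
    qed
  qed
  also have "\<dots> \<longleftrightarrow> ?R" unfolding det using \<rho>(1) by simp
  finally show ?thesis .
qed

section \<open>Coordinate fields\<close>

abbreviation "dt \<equiv> lie (\<lambda>_. (1, 0, 0) :: real \<times> real \<times> real)"
abbreviation "du \<equiv> lie (\<lambda>_. (0, 1, 0) :: real \<times> real \<times> real)"
abbreviation "dv \<equiv> lie (\<lambda>_. (0, 0, 1) :: real \<times> real \<times> real)"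

locale coordinate_fields =
  fixes \<Omega> :: "(real \<times> real \<times> real) set" and A B :: "real \<times> real \<times> real \<Rightarrow> real"
  assumes open_\<Omega>: "open \<Omega>" and smooth_A: "smooth_on \<Omega> A" and smooth_B: "smooth_on \<Omega> B"
    and J_nonzero: "\<And>z. z \<in> \<Omega> \<Longrightarrow> du A z * dv B z - dv A z * du B z \<noteq> 0"
begin

definition "J z = du A z * dv B z - dv A z * du B z"
text \<open>\<open>a1\<close> and \<open>a2\<close> are the columns of the inverse spatial Jacobian
  matrix of \<open>(A, B)\<close>, by Cramer's rule.\<close>

definition "a1 z = (0 :: real, dv B z / J z, - (du B z / J z))"
definition "a2 z = (0 :: real, - (dv A z / J z), du A z / J z)"
text \<open>The correction makes \<open>a0\<close> annihilate \<open>A\<close> and \<open>B\<close>,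
  that is, hold the normal fixed while time runs.\<close>

definition "a0 z = (1, 0, 0) - dt A z *\<^sub>R a1 z - dt B z *\<^sub>R a2 z"

lemma frechet_expand:
  fixes f :: "real \<times> real \<times> real \<Rightarrow> 'c::real_normed_vector"
  assumes "smooth_on \<Omega> f" "z \<in> \<Omega>"
  shows "frechet_derivative f (at z) (r, x, y) = r *\<^sub>R dt f z + x *\<^sub>R du f z + y *\<^sub>R dv f z"
proof -
  have lin: "linear (frechet_derivative f (at z))"
    by (rule has_derivative_linear[OF smooth_on_has_derivative[OF open_\<Omega> assms]])
  have "(r, x, y) = r *\<^sub>R (1, 0, 0) + x *\<^sub>R (0, 1, 0) + y *\<^sub>R (0, 0, 1)" by simp
  then show ?thesis by (simp only: linear_add[OF lin] linear_cmul[OF lin] lie_def)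
qed

lemma J: "z \<in> \<Omega> \<Longrightarrow> J z \<noteq> 0"
  using J_nonzero by (simp add: J_def)

lemma smooth_J: "smooth_on \<Omega> J"
  unfolding J_def[abs_def]
  by (intro smooth_on_diff smooth_on_mult smooth_on_lie smooth_on_const open_\<Omega> smooth_A smooth_B)

lemma smooth_a12: "smooth_on \<Omega> a1" "smooth_on \<Omega> a2"
  unfolding a1_def[abs_def] a2_def[abs_def]
  by (intro smooth_on_Pair smooth_on_uminus smooth_on_divide smooth_on_lie smooth_on_const
      open_\<Omega> smooth_A smooth_B smooth_J J; assumption)+

lemma smooth_a0: "smooth_on \<Omega> a0"
  unfolding a0_def[abs_def]
  by (intro smooth_on_diff smooth_on_scaleR smooth_on_lie smooth_on_const open_\<Omega> smooth_A smooth_B smooth_a12)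

lemma horizontal: "fst (a1 z) = 0" "fst (a2 z) = 0"
  by (simp_all add: a1_def a2_def)

lemma fst_a0: "fst (a0 z) = 1"
  by (simp add: a0_def horizontal)

lemma lie_a0:
  fixes f :: "real \<times> real \<times> real \<Rightarrow> 'c::real_normed_vector"
  assumes "smooth_on \<Omega> f" "z \<in> \<Omega>"
  shows "lie a0 f z = dt f z - dt A z *\<^sub>R lie a1 f z - dt B z *\<^sub>R lie a2 f z"
proof -
  have lin: "linear (frechet_derivative f (at z))"
    by (rule has_derivative_linear[OF smooth_on_has_derivative[OF open_\<Omega> assms]])
  show ?thesis unfolding lie_def a0_def by (simp only: linear_diff[OF lin] linear_cmul[OF lin])
qed

lemma dual:
  assumes z: "z \<in> \<Omega>"
  shows "lie a1 A z = 1" "lie a1 B z = 0" "lie a2 A z = 0" "lie a2 B z = 1" "lie a0 A z = 0" "lie a0 B z = 0"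
proof -
  note e = frechet_expand[OF smooth_A z] frechet_expand[OF smooth_B z]
  note l = lie_def[of a1] lie_def[of a2]
  show 1: "lie a1 A z = 1" "lie a1 B z = 0" "lie a2 A z = 0" "lie a2 B z = 1"
    unfolding l a1_def a2_def e using J[OF z] by (simp_all add: field_simps) (simp_all add: J_def algebra_simps)
  show "lie a0 A z = 0" "lie a0 B z = 0"
    by (simp_all add: lie_a0 smooth_A smooth_B z 1)
qed

lemma separate:
  assumes z: "z \<in> \<Omega>" and c: "fst c = 0" "frechet_derivative A (at z) c = 0" "frechet_derivative B (at z) c = 0"
  shows "c = 0"
proof -
  obtain x y where xy: "c = (0, x, y)" using c(1) by (cases c) auto
  have "x * du A z + y * dv A z = 0" "x * du B z + y * dv B z = 0"
    using c(2,3) unfolding xy frechet_expand[OF smooth_A z] frechet_expand[OF smooth_B z] by simp_all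
  then have "x * J z = 0 \<and> y * J z = 0" unfolding J_def by algebra
  then show ?thesis using J[OF z] xy by (simp add: zero_prod_def)
qed

text \<open>Each field maps \<open>fst\<close>, \<open>A\<close> and \<open>B\<close> to constants,
  so iterated derivatives of these functions vanish in either order; since \<open>J\<close> is
  nonzero, the three separate tangent directions and \<open>lie_commute\<close> applies.\<close>

lemma commute:
  fixes f :: "real \<times> real \<times> real \<Rightarrow> real"
  assumes f: "smooth_on \<Omega> f" and z: "z \<in> \<Omega>"
  shows "lie a2 (lie a1 f) z = lie a1 (lie a2 f) z"
    "lie a0 (lie a1 f) z = lie a1 (lie a0 f) z"
    "lie a0 (lie a2 f) z = lie a2 (lie a0 f) z"
proof -
  have sm_fst: "smooth_on \<Omega> (fst :: real \<times> real \<times> real \<Rightarrow> real)"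
    by (rule smooth_on_linear[OF open_\<Omega> bounded_linear_fst])
  have fd_fst: "frechet_derivative fst (at x) = (fst :: real \<times> real \<times> real \<Rightarrow> real)" for x :: "real \<times> real \<times> real"
    using frechet_derivative_at[OF bounded_linear_imp_has_derivative[OF bounded_linear_fst]] by metis
  have lie_lie_const: "lie a (lie b g) z = 0"
    if "smooth_on \<Omega> b" "smooth_on \<Omega> g" "\<And>x. x \<in> \<Omega> \<Longrightarrow> lie b g x = k" for a b g and k :: real
    using lie_cong[OF open_\<Omega> that(3) smooth_on_lie[OF open_\<Omega> that(1,2)] z, of a] by (simp add: lie_const[OF open_\<Omega>])
  have zero: "lie a (lie b g) z = 0" if "b \<in> {a0, a1, a2}" "g \<in> {fst, A, B}" for a b g
  proof -
    have "\<exists>k. \<forall>x\<in>\<Omega>. lie b g x = k"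
      using that dual by (auto simp: lie_def[of _ fst] fd_fst horizontal fst_a0)
    moreover have "smooth_on \<Omega> b" "smooth_on \<Omega> g" using that smooth_a12 smooth_a0 sm_fst smooth_A smooth_B by auto
    ultimately show ?thesis using lie_lie_const by metis
  qed
  have *: "lie a (lie b f) z = lie b (lie a f) z" if ab: "a \<in> {a0, a1, a2}" "b \<in> {a0, a1, a2}" for a b
  proof (rule lie_commute[OF open_\<Omega>, where G = "{fst, A, B}"])
    show "c = 0" if "\<And>g. g \<in> {fst, A, B} \<Longrightarrow> frechet_derivative g (at z) c = 0" for c
      using separate[OF z, of c] that[of fst] that[of A] that[of B] by (simp add: fd_fst)
    show "smooth_on \<Omega> a" "smooth_on \<Omega> b" using ab smooth_a12 smooth_a0 by auto
  qed (use f z ab zero smooth_A smooth_B sm_fst in auto)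
  show "lie a2 (lie a1 f) z = lie a1 (lie a2 f) z" "lie a0 (lie a1 f) z = lie a1 (lie a0 f) z"
    "lie a0 (lie a2 f) z = lie a2 (lie a0 f) z" by (rule *; simp)+
qed

end

section \<open>Charts adapted to the flow\<close>

lemma open_positive_part:
  fixes f :: "'c::topological_space \<Rightarrow> real"
  assumes "open S" "continuous_on S f"
  shows "open {z \<in> S. f z > 0}" "open {z \<in> S. f z \<noteq> 0}"
proof -
  have "{z \<in> S. f z > 0} = S \<inter> f -` {0<..}" "{z \<in> S. f z \<noteq> 0} = S \<inter> f -` (- {0})" by auto
  then show "open {z \<in> S. f z > 0}" "open {z \<in> S. f z \<noteq> 0}"
    using assms by (auto intro!: continuous_open_preimage)
qed

lemma slice_derivatives:
  fixes Z :: "real \<Rightarrow> 'a::euclidean_space \<Rightarrow> 'b::real_normed_vector"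
  assumes "open I" "open U" and sm: "smooth_on (I \<times> U) (\<lambda>(t, x). Z t x)" and t: "t \<in> I" and x: "x \<in> U"
  defines "Z' \<equiv> frechet_derivative (\<lambda>(t, x). Z t x) (at (t, x))"
  shows "(Z t has_derivative (\<lambda>v. Z' (0, v))) (at x)"
    and "((\<lambda>s. Z s x) has_vector_derivative Z' (1, 0)) (at t)"
proof -
  have d: "((\<lambda>(t, x). Z t x) has_derivative Z') (at (t, x))"
    unfolding Z'_def using assms by (intro smooth_on_has_derivative[OF _ sm] open_Times) auto
  have "((\<lambda>y. (t, y)) has_derivative (\<lambda>v. (0, v))) (at x)"
    by (auto intro!: derivative_eq_intros)
  from has_derivative_compose[OF this d] show "(Z t has_derivative (\<lambda>v. Z' (0, v))) (at x)" by simp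
  have "((\<lambda>s. (s, x)) has_derivative (\<lambda>v. (v, 0))) (at t)"
    by (auto intro!: derivative_eq_intros)
  from has_derivative_compose[OF this d] have e: "((\<lambda>s. Z s x) has_derivative (\<lambda>v. Z' (v, 0))) (at t)" by simp
  have eq: "(\<lambda>v. v *\<^sub>R Z' (1, 0)) = (\<lambda>v. Z' (v, 0))"
    by (simp flip: linear_cmul[OF has_derivative_linear[OF d]])
  show "((\<lambda>s. Z s x) has_vector_derivative Z' (1, 0)) (at t)"
    unfolding has_vector_derivative_def eq by (rule e)
qed

lemma sphere_inner: "p \<in> sphere 0 1 \<Longrightarrow> p \<bullet> p = 1"
  by (simp add: norm_eq_1)

locale imcf =
  fixes X N :: "real \<Rightarrow> real^3 \<Rightarrow> real^3" and a b :: real and U :: "(real^3) set"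
  assumes open_U: "open U" and sphere_U: "sphere 0 1 \<subseteq> U"
    and smoothX: "smooth_on ({a<..<b} \<times> U) (\<lambda>(t, x). X t x)"
    and smoothN: "smooth_on ({a<..<b} \<times> U) (\<lambda>(t, x). N t x)"
    and immersed: "\<forall>t\<in>{a<..<b}. \<forall>p\<in>sphere 0 1. \<forall>v. v \<bullet> p = 0 \<and>
         frechet_derivative (X t) (at p) v = 0 \<longrightarrow> v = 0"
    and unit_normal: "\<forall>t\<in>{a<..<b}. \<forall>p\<in>sphere 0 1. norm (N t p) = 1 \<and>
         (\<forall>v. v \<bullet> p = 0 \<longrightarrow> N t p \<bullet> frechet_derivative (X t) (at p) v = 0)"
    and strictly_convex: "\<forall>t\<in>{a<..<b}. \<forall>p\<in>sphere 0 1. \<forall>l\<in>princ_curvs (X t) (N t) p. l > 0"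
    and flow: "\<forall>t\<in>{a<..<b}. \<forall>p\<in>sphere 0 1.
         ((\<lambda>s. X s p) has_vector_derivative (1 / mean_curv (X t) (N t) p) *\<^sub>R N t p) (at t)"

text \<open>The domain is charted around \<open>p0\<close> and the Gauss image around \<open>N t0 p0\<close>, both at time \<open>t0\<close>.\<close>
locale imcf_chart = imcf +
  fixes t0 :: real and p0 e1 e2 f1 f2 :: "real^3"
  assumes t0: "t0 \<in> {a<..<b}" and p0: "p0 \<in> sphere 0 1"
    and frame_e: "orthonormal3 e1 e2 p0" and frame_f: "orthonormal3 f1 f2 (N t0 p0)"
begin

text \<open>Inverse stereographic projection from the antipode of \<open>p0\<close>, and its inverse \<open>\<psi>\<close>.\<close>
definition "\<phi> y = (1 / (1 + (fst y * fst y + snd y * snd y))) *\<^sub>R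
  ((1 - (fst y * fst y + snd y * snd y)) *\<^sub>R p0 + (2 * fst y) *\<^sub>R e1 + (2 * snd y) *\<^sub>R e2)"
definition "\<psi> x = (x \<bullet> e1 / (1 + x \<bullet> p0), x \<bullet> e2 / (1 + x \<bullet> p0))"

lemma denom_pos: "1 + (fst y * fst y + snd y * snd y) > (0 :: real)" for y :: "real \<times> real"
  using zero_le_square[of "fst y"] zero_le_square[of "snd y"] by linarith

lemma smooth_\<phi>: "smooth_on UNIV \<phi>"
proof -
  have "1 + (fst y * fst y + snd y * snd y) \<noteq> (0 :: real)" for y :: "real \<times> real"
    using denom_pos[of y] by simp
  then show ?thesis unfolding \<phi>_def[abs_def]
    by (intro smooth_on_scaleR smooth_on_divide smooth_on_add smooth_on_diff smooth_on_mult smooth_on_const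
        smooth_on_linear[OF _ bounded_linear_fst] smooth_on_linear[OF _ bounded_linear_snd] open_UNIV)
qed

lemma \<phi>_inner: "\<phi> y \<bullet> e1 = 2 * fst y / (1 + (fst y * fst y + snd y * snd y))"
  "\<phi> y \<bullet> e2 = 2 * snd y / (1 + (fst y * fst y + snd y * snd y))"
  "\<phi> y \<bullet> p0 = (1 - (fst y * fst y + snd y * snd y)) / (1 + (fst y * fst y + snd y * snd y))"
proof -
  have "e1 \<bullet> e1 = 1" "e2 \<bullet> e2 = 1" "p0 \<bullet> p0 = 1" "e1 \<bullet> e2 = 0" "e2 \<bullet> e1 = 0" "e1 \<bullet> p0 = 0" "p0 \<bullet> e1 = 0"
    "e2 \<bullet> p0 = 0" "p0 \<bullet> e2 = 0"
    using frame_e inner_commute[of e1 e2] inner_commute[of e1 p0] inner_commute[of e2 p0]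
    by (simp_all add: orthonormal3_def)
  then show "\<phi> y \<bullet> e1 = 2 * fst y / (1 + (fst y * fst y + snd y * snd y))"
    "\<phi> y \<bullet> e2 = 2 * snd y / (1 + (fst y * fst y + snd y * snd y))"
    "\<phi> y \<bullet> p0 = (1 - (fst y * fst y + snd y * snd y)) / (1 + (fst y * fst y + snd y * snd y))"
    by (simp_all add: \<phi>_def inner_add_left)
qed

lemma \<phi>_sphere: "\<phi> y \<in> sphere 0 1"
proof -
  let ?m = "fst y * fst y + snd y * snd y"
  define r where "r = 1 / (1 + ?m)"
  have r: "r * (1 + ?m) = 1" using denom_pos[of y] by (simp add: r_def)
  have d: "x / (1 + ?m) = x * r" for x by (simp add: r_def)
  have "\<phi> y \<bullet> \<phi> y = 1"
    unfolding orthonormal3_inner[OF frame_e, of "\<phi> y" "\<phi> y"] \<phi>_inner d using r by algebra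
  then show ?thesis by (simp add: norm_eq_1)
qed

lemma \<phi>_0: "\<phi> (0, 0) = p0"
  by (simp add: \<phi>_def)

lemma \<psi>_\<phi>: "\<psi> (\<phi> y) = y"
proof -
  let ?m = "fst y * fst y + snd y * snd y"
  have "1 + \<phi> y \<bullet> p0 = 2 / (1 + ?m)" using denom_pos[of y] unfolding \<phi>_inner by (simp add: field_simps)
  then show ?thesis using denom_pos[of y] unfolding \<psi>_def \<phi>_inner by (simp add: prod_eq_iff)
qed

lemma \<phi>_\<psi>:
  assumes x: "x \<in> sphere 0 1" and d: "1 + x \<bullet> p0 > 0"
  shows "\<phi> (\<psi> x) = x"
proof -
  define r where "r = 1 / (1 + x \<bullet> p0)"
  have r: "r * (1 + x \<bullet> p0) = 1" using d by (simp add: r_def)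
  have \<psi>: "fst (\<psi> x) = (x \<bullet> e1) * r" "snd (\<psi> x) = (x \<bullet> e2) * r" by (simp_all add: \<psi>_def r_def)
  have "x \<bullet> x = 1" using x by (simp add: norm_eq_1)
  then have n: "(x \<bullet> e1) * (x \<bullet> e1) + (x \<bullet> e2) * (x \<bullet> e2) + (x \<bullet> p0) * (x \<bullet> p0) = 1"
    using orthonormal3_inner[OF frame_e, of x x] by simp
  let ?m = "fst (\<psi> x) * fst (\<psi> x) + snd (\<psi> x) * snd (\<psi> x)"
  have m: "1 + ?m = 2 * r" unfolding \<psi> using n r by algebra
  have r0: "r > 0" using d by (simp add: r_def)
  have c: "\<phi> (\<psi> x) \<bullet> e1 = x \<bullet> e1" "\<phi> (\<psi> x) \<bullet> e2 = x \<bullet> e2" "\<phi> (\<psi> x) \<bullet> p0 = x \<bullet> p0"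
  proof -
    show "\<phi> (\<psi> x) \<bullet> e1 = x \<bullet> e1" "\<phi> (\<psi> x) \<bullet> e2 = x \<bullet> e2"
      unfolding \<phi>_inner m unfolding \<psi> using r0 by simp_all
    have "1 - ?m = 2 * r * (x \<bullet> p0)" using m r by algebra
    then show "\<phi> (\<psi> x) \<bullet> p0 = x \<bullet> p0" unfolding \<phi>_inner m using r0 by simp
  qed
  show ?thesis
    by (subst orthonormal3_expand[OF frame_e, of "\<phi> (\<psi> x)"], subst (4) orthonormal3_expand[OF frame_e, of x]) (simp only: c)
qed

abbreviation "\<phi>' y \<equiv> frechet_derivative \<phi> (at y)"

lemma \<phi>': "(\<phi> has_derivative \<phi>' y) (at y)"
  by (rule smooth_on_has_derivative[OF open_UNIV smooth_\<phi>]) simp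

lemma \<phi>'_tangent: "\<phi>' y v \<bullet> \<phi> y = 0"
proof -
  have "((\<lambda>y. \<phi> y \<bullet> \<phi> y) has_derivative (\<lambda>v. \<phi> y \<bullet> \<phi>' y v + \<phi>' y v \<bullet> \<phi> y)) (at y)"
    by (rule has_derivative_inner[OF \<phi>' \<phi>'])
  moreover have "(\<lambda>y. \<phi> y \<bullet> \<phi> y) = (\<lambda>y. 1)" using \<phi>_sphere by (simp add: norm_eq_1)
  ultimately have "((\<lambda>y. 1 :: real) has_derivative (\<lambda>v. \<phi> y \<bullet> \<phi>' y v + \<phi>' y v \<bullet> \<phi> y)) (at y)"
    by simp
  then have "(\<lambda>v. \<phi> y \<bullet> \<phi>' y v + \<phi>' y v \<bullet> \<phi> y) = (\<lambda>v. 0)"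
    by (rule has_derivative_unique) (rule has_derivative_const)
  from fun_cong[OF this, of v] show ?thesis by (simp add: inner_commute)
qed

text \<open>\<open>\<psi>\<close> is a smooth left inverse of \<open>\<phi>\<close>, so by the chain
  rule its derivative is a left inverse of that of \<open>\<phi>\<close>.\<close>

lemma \<phi>'_inj: "\<phi>' y v = 0 \<Longrightarrow> v = 0"
proof -
  assume v: "\<phi>' y v = 0"
  let ?S = "{x. 1 + x \<bullet> p0 \<noteq> 0}"
  have "?S = - {x. 1 + x \<bullet> p0 = 0}" by auto
  moreover have "closed {x. 1 + x \<bullet> p0 = 0}" by (intro closed_Collect_eq continuous_intros)
  ultimately have S: "open ?S" by (simp add: open_Compl)
  have "smooth_on ?S \<psi>" unfolding \<psi>_def[abs_def]
    by (intro smooth_on_Pair smooth_on_divide smooth_on_add smooth_on_const S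
        smooth_on_linear[OF S bounded_linear_inner_left]) auto
  moreover have "\<phi> y \<in> ?S" unfolding \<phi>_inner mem_Collect_eq using denom_pos[of y] by (simp add: field_simps)
  ultimately have "(\<psi> has_derivative frechet_derivative \<psi> (at (\<phi> y))) (at (\<phi> y))" (is "(_ has_derivative ?\<psi>') _")
    by (intro smooth_on_has_derivative[OF S])
  from has_derivative_compose[OF \<phi>' this] have "((\<lambda>y. y) has_derivative (\<lambda>v. ?\<psi>' (\<phi>' y v))) (at y)"
    by (simp only: \<psi>_\<phi>)
  from has_derivative_unique[OF this has_derivative_ident] have "?\<psi>' (\<phi>' y v) = v" by metis
  moreover have "?\<psi>' 0 = 0"
    using linear_0[OF has_derivative_linear[OF \<open>(\<psi> has_derivative ?\<psi>') _\<close>]] .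
  ultimately show "v = 0" using v by simp
qed

section \<open>The flow pulled back to the stereographic chart\<close>

definition "\<Omega>0 = {a<..<b} \<times> (UNIV :: (real \<times> real) set)"
definition "Y z = X (fst z) (\<phi> (snd z))"
definition "M z = N (fst z) (\<phi> (snd z))"

lemma open_\<Omega>0: "open \<Omega>0"
  by (simp add: \<Omega>0_def open_Times)

lemma \<phi>_U: "\<phi> y \<in> U"
  using \<phi>_sphere sphere_U by blast

lemma smooth_pullback:
  assumes "smooth_on ({a<..<b} \<times> U) (\<lambda>(t, x). Z t x)"
  shows "smooth_on \<Omega>0 (\<lambda>z. Z (fst z) (\<phi> (snd z)))"
proof -
  have "smooth_on \<Omega>0 (\<lambda>z. (fst z, \<phi> (snd z)))"
    by (intro smooth_on_Pair smooth_on_linear[OF _ bounded_linear_fst] open_\<Omega>0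
        smooth_on_compose[OF _ open_UNIV _ smooth_\<phi>] smooth_on_linear[OF _ bounded_linear_snd]) auto
  then show ?thesis
    using smooth_on_compose[OF open_\<Omega>0 _ _ assms, of "\<lambda>z. (fst z, \<phi> (snd z))"] \<phi>_U open_U
    by (auto simp: open_Times \<Omega>0_def)
qed

lemma smooth_YM: "smooth_on \<Omega>0 Y" "smooth_on \<Omega>0 M"
  unfolding Y_def[abs_def] M_def[abs_def] by (rule smooth_pullback[OF smoothX] smooth_pullback[OF smoothN])+

lemma pullback_derivative:
  fixes Z :: "real \<Rightarrow> real^3 \<Rightarrow> real^3"
  assumes sm: "smooth_on ({a<..<b} \<times> U) (\<lambda>(t, x). Z t x)" and z: "z \<in> \<Omega>0"
  shows "frechet_derivative (\<lambda>z. Z (fst z) (\<phi> (snd z))) (at z) (0, y)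
      = frechet_derivative (Z (fst z)) (at (\<phi> (snd z))) (\<phi>' (snd z) y)"
    and "((\<lambda>s. Z s (\<phi> (snd z))) has_vector_derivative
      frechet_derivative (\<lambda>z. Z (fst z) (\<phi> (snd z))) (at z) (1, 0)) (at (fst z))"
    and "(Z (fst z) has_derivative frechet_derivative (Z (fst z)) (at (\<phi> (snd z)))) (at (\<phi> (snd z)))"
proof -
  let ?x = "(fst z, \<phi> (snd z))"
  let ?Z' = "frechet_derivative (\<lambda>(t, x). Z t x) (at ?x)"
  have x: "fst z \<in> {a<..<b}" "\<phi> (snd z) \<in> U" using z \<phi>_U by (auto simp: \<Omega>0_def)
  note sl = slice_derivatives[OF _ open_U sm x, simplified]
  have d: "((\<lambda>(t, x). Z t x) has_derivative ?Z') (at ?x)"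
    using x open_U by (intro smooth_on_has_derivative[OF _ sm] open_Times) auto
  have "((\<lambda>z. (fst z, \<phi> (snd z))) has_derivative (\<lambda>v. (fst v, \<phi>' (snd z) (snd v)))) (at z)"
    by (intro has_derivative_Pair has_derivative_fst has_derivative_ident
        has_derivative_compose[OF has_derivative_snd[OF has_derivative_ident] \<phi>'])
  from has_derivative_compose[OF this d]
  have "((\<lambda>z. Z (fst z) (\<phi> (snd z))) has_derivative (\<lambda>v. ?Z' (fst v, \<phi>' (snd z) (snd v)))) (at z)" by simp
  from fun_cong[OF frechet_derivative_at[OF this]]
  have f: "frechet_derivative (\<lambda>z. Z (fst z) (\<phi> (snd z))) (at z) v = ?Z' (fst v, \<phi>' (snd z) (snd v))" for v
    by metis
  show "frechet_derivative (\<lambda>z. Z (fst z) (\<phi> (snd z))) (at z) (0, y)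
      = frechet_derivative (Z (fst z)) (at (\<phi> (snd z))) (\<phi>' (snd z) y)"
    unfolding f using fun_cong[OF frechet_derivative_at[OF sl(1)]] by simp
  show "((\<lambda>s. Z s (\<phi> (snd z))) has_vector_derivative
      frechet_derivative (\<lambda>z. Z (fst z) (\<phi> (snd z))) (at z) (1, 0)) (at (fst z))"
    unfolding f using sl(2) linear_0[OF has_derivative_linear[OF \<phi>']] by simp
  show "(Z (fst z) has_derivative frechet_derivative (Z (fst z)) (at (\<phi> (snd z)))) (at (\<phi> (snd z)))"
    using sl(1) frechet_derivative_at[OF sl(1)] by simp
qed

lemma unit_M: "z \<in> \<Omega>0 \<Longrightarrow> M z \<bullet> M z = 1"
  using unit_normal \<phi>_sphere by (auto simp: \<Omega>0_def M_def norm_eq_1)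

lemma M_deriv_orthogonal:
  assumes z: "z \<in> \<Omega>0"
  shows "M z \<bullet> frechet_derivative M (at z) c = 0"
proof -
  have "lie (\<lambda>_. c) (\<lambda>z. M z \<bullet> M z) z = lie (\<lambda>_. c) (\<lambda>_. 1) z"
    by (rule lie_cong[OF open_\<Omega>0 unit_M smooth_on_inner[OF open_\<Omega>0 smooth_YM(2) smooth_YM(2)] z])
  then show ?thesis
    by (simp add: lie_inner[OF open_\<Omega>0 smooth_YM(2) smooth_YM(2) z] lie_const[OF open_\<Omega>0] inner_commute)
      (simp add: lie_def inner_commute)
qed

lemma Y_deriv_orthogonal:
  assumes z: "z \<in> \<Omega>0"
  shows "M z \<bullet> frechet_derivative Y (at z) (0, y) = 0"
proof -
  have "fst z \<in> {a<..<b}" using z by (auto simp: \<Omega>0_def)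
  from unit_normal[THEN bspec, OF this, THEN bspec, OF \<phi>_sphere] show ?thesis
    unfolding Y_def[abs_def] pullback_derivative(1)[OF smoothX z] M_def using \<phi>'_tangent by blast
qed

lemma Y_deriv_time:
  assumes z: "z \<in> \<Omega>0"
  shows "frechet_derivative Y (at z) (1, 0) = (1 / mean_curv (X (fst z)) (N (fst z)) (\<phi> (snd z))) *\<^sub>R M z"
proof -
  have "((\<lambda>s. X s (\<phi> (snd z))) has_vector_derivative
      (1 / mean_curv (X (fst z)) (N (fst z)) (\<phi> (snd z))) *\<^sub>R N (fst z) (\<phi> (snd z))) (at (fst z))"
    using flow z \<phi>_sphere by (simp add: \<Omega>0_def mem_Times_iff)
  from vector_derivative_unique_at[OF pullback_derivative(2)[OF smoothX z] this] show ?thesis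
    unfolding Y_def[abs_def] M_def .
qed


text \<open>\<open>P\<close>, \<open>Q\<close>, \<open>R\<close> are the coordinates of the position vector, \<open>(A, B, 1) / \<rho>\<close> those of the normal; \<open>h\<close> is
  the support function at the normal direction \<open>(A, B, 1)\<close>, so that \<open>P\<close> and \<open>Q\<close> are its derivatives.\<close>
definition "M3 z = M z \<bullet> N t0 p0"
definition "A z = M z \<bullet> f1 / M3 z"
definition "B z = M z \<bullet> f2 / M3 z"
definition "\<rho> z = 1 / M3 z"
definition "P z = Y z \<bullet> f1"
definition "Q z = Y z \<bullet> f2"
definition "R z = Y z \<bullet> N t0 p0"
definition "h z = A z * P z + B z * Q z + R z"
text \<open>On \<open>\<Omega>1\<close> the normal lies in the open hemisphere around
  \<open>N t0 p0\<close>, where central projection is defined; on \<open>\<Omega>\<close> the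
  projected Gauss map moreover has invertible spatial differential.\<close>

definition "\<Omega>1 = {z \<in> \<Omega>0. M3 z > 0}"
definition "\<Omega> = {z \<in> \<Omega>1. du A z * dv B z - dv A z * du B z \<noteq> 0}"

lemma smooth_components: "smooth_on \<Omega>0 M3" "smooth_on \<Omega>0 P" "smooth_on \<Omega>0 Q" "smooth_on \<Omega>0 R"
  unfolding M3_def[abs_def] P_def[abs_def] Q_def[abs_def] R_def[abs_def]
  by (intro smooth_on_inner smooth_on_const open_\<Omega>0 smooth_YM)+

lemma open_\<Omega>1: "open \<Omega>1"
  unfolding \<Omega>1_def by (rule open_positive_part(1)[OF open_\<Omega>0 smooth_on_continuous[OF open_\<Omega>0 smooth_components(1)]])

lemma \<Omega>1_\<Omega>0: "\<Omega>1 \<subseteq> \<Omega>0" by (auto simp: \<Omega>1_def)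

lemma smooth_AB1: "smooth_on \<Omega>1 A" "smooth_on \<Omega>1 B" "smooth_on \<Omega>1 \<rho>"
  unfolding A_def[abs_def] B_def[abs_def] \<rho>_def[abs_def]
  by (intro smooth_on_divide smooth_on_inner smooth_on_const smooth_on_subset_open[OF open_\<Omega>0 open_\<Omega>1 \<Omega>1_\<Omega>0]
      open_\<Omega>1 smooth_YM smooth_components; force simp: \<Omega>1_def)+

lemma open_\<Omega>: "open \<Omega>"
  unfolding \<Omega>_def
  by (intro open_positive_part(2) open_\<Omega>1 smooth_on_continuous smooth_on_diff smooth_on_mult smooth_on_lie
      smooth_on_const smooth_AB1)

lemma \<Omega>_sub: "\<Omega> \<subseteq> \<Omega>1" "\<Omega> \<subseteq> \<Omega>0"
  using \<Omega>1_\<Omega>0 by (auto simp: \<Omega>_def)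

lemma smooth_AB: "smooth_on \<Omega> A" "smooth_on \<Omega> B" "smooth_on \<Omega> \<rho>"
  by (rule smooth_on_subset_open[OF open_\<Omega>1 open_\<Omega> \<Omega>_sub(1)] smooth_AB1)+

lemma smooth_PQR: "smooth_on \<Omega> P" "smooth_on \<Omega> Q" "smooth_on \<Omega> R" "smooth_on \<Omega> M3" "smooth_on \<Omega> Y" "smooth_on \<Omega> M"
  by (rule smooth_on_subset_open[OF open_\<Omega>0 open_\<Omega> \<Omega>_sub(2)], rule smooth_components smooth_YM)+

sublocale fields: coordinate_fields \<Omega> A B
proof
  show "du A z * dv B z - dv A z * du B z \<noteq> 0" if "z \<in> \<Omega>" for z
    using that by (simp add: \<Omega>_def)
qed (rule open_\<Omega> smooth_AB)+

lemma M3_pos: "z \<in> \<Omega>1 \<Longrightarrow> M3 z > 0"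
  by (simp add: \<Omega>1_def)

lemma M_components:
  assumes "z \<in> \<Omega>1"
  shows "M z \<bullet> f1 = A z * M3 z" "M z \<bullet> f2 = B z * M3 z"
  using M3_pos[OF assms] by (simp_all add: A_def B_def)

lemma \<rho>_sq:
  assumes z: "z \<in> \<Omega>1"
  shows "\<rho> z * \<rho> z = 1 + A z * A z + B z * B z" "\<rho> z > 0"
proof -
  have "(A z * A z + B z * B z + 1) * (M3 z * M3 z) = 1"
    using unit_M[of z] z orthonormal3_inner[OF frame_f, of "M z" "M z"] M_components[OF z] \<Omega>1_\<Omega>0
    by (auto simp: M3_def algebra_simps)
  then show "\<rho> z * \<rho> z = 1 + A z * A z + B z * B z"
    using M3_pos[OF z] by (simp add: \<rho>_def field_simps)
  show "\<rho> z > 0" using M3_pos[OF z] by (simp add: \<rho>_def)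
qed

lemma M_inner:
  assumes z: "z \<in> \<Omega>1"
  shows "M z \<bullet> v = M3 z * (A z * (v \<bullet> f1) + B z * (v \<bullet> f2) + v \<bullet> N t0 p0)"
  using orthonormal3_inner[OF frame_f, of "M z" v] M_components[OF z] by (simp add: M3_def algebra_simps)

lemma lie_PQR:
  assumes z: "z \<in> \<Omega>"
  shows "lie c P z = lie c Y z \<bullet> f1" "lie c Q z = lie c Y z \<bullet> f2" "lie c R z = lie c Y z \<bullet> N t0 p0"
  unfolding P_def[abs_def] Q_def[abs_def] R_def[abs_def]
  by (rule lie_inner_const[OF open_\<Omega> smooth_PQR(5) z])+

lemma lie_h:
  assumes z: "z \<in> \<Omega>"
  shows "lie c h z = lie c A z * P z + lie c B z * Q z
    + (A z * (lie c Y z \<bullet> f1) + B z * (lie c Y z \<bullet> f2) + lie c Y z \<bullet> N t0 p0)"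
  unfolding h_def[abs_def]
  by (simp add: lie_add[OF open_\<Omega>] lie_mult[OF open_\<Omega>] smooth_on_add[OF open_\<Omega>] smooth_on_mult[OF open_\<Omega>]
      smooth_AB smooth_PQR z lie_PQR[OF z] algebra_simps)

lemma lie_Y_tangent:
  assumes z: "z \<in> \<Omega>" and c: "fst (c z) = 0"
  shows "A z * (lie c Y z \<bullet> f1) + B z * (lie c Y z \<bullet> f2) + lie c Y z \<bullet> N t0 p0 = 0"
proof -
  obtain y where "c z = (0, y)" using c by (cases "c z") auto
  then have "M z \<bullet> lie c Y z = 0"
    using Y_deriv_orthogonal[of z y] z \<Omega>_sub by (auto simp: lie_def)
  then show ?thesis using M_inner[of z "lie c Y z"] M3_pos[of z] z \<Omega>_sub by auto
qed

text \<open>Legendre duality: apart from \<open>P\<close> and \<open>Q\<close>, the derivative of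
  \<open>h\<close> is the product of \<open>(A, B, 1)\<close> with a derivative of the position
  vector, which vanishes in tangential directions.\<close>

lemma lie_h_fields:
  assumes z: "z \<in> \<Omega>"
  shows "lie fields.a1 h z = P z" "lie fields.a2 h z = Q z"
  using lie_h[OF z] lie_Y_tangent[OF z] fields.dual[OF z] fields.horizontal by auto

sublocale chart: gauss_chart \<Omega> fields.a0 fields.a1 fields.a2 A B h \<rho>
proof
  show "smooth_on \<Omega> h" unfolding h_def[abs_def]
    by (intro smooth_on_add smooth_on_mult open_\<Omega> smooth_AB smooth_PQR)
qed (use open_\<Omega> smooth_AB fields.smooth_a0 fields.smooth_a12 fields.dual fields.commute fields.horizontal
    \<rho>_sq \<Omega>_sub in auto)

text \<open>\<open>P\<close> and \<open>Q\<close> are first derivatives of \<open>h\<close>, so the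
  tangential differential of the position vector in the coordinates \<open>A\<close>,
  \<open>B\<close> is the Hessian of \<open>h\<close>.\<close>

lemma hess_components:
  assumes z: "z \<in> \<Omega>"
  shows "lie fields.a1 Y z \<bullet> f1 = chart.hAA z" "lie fields.a2 Y z \<bullet> f1 = chart.hAB z"
    "lie fields.a1 Y z \<bullet> f2 = chart.hAB z" "lie fields.a2 Y z \<bullet> f2 = chart.hBB z"
proof -
  have 1: "lie c P z = lie c (lie fields.a1 h) z" for c
    by (rule lie_cong[OF open_\<Omega>]) (auto simp: lie_h_fields smooth_PQR z)
  have 2: "lie c Q z = lie c (lie fields.a2 h) z" for c
    by (rule lie_cong[OF open_\<Omega>]) (auto simp: lie_h_fields smooth_PQR z)
  show "lie fields.a1 Y z \<bullet> f1 = chart.hAA z" "lie fields.a2 Y z \<bullet> f1 = chart.hAB z"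
    "lie fields.a1 Y z \<bullet> f2 = chart.hAB z" "lie fields.a2 Y z \<bullet> f2 = chart.hBB z"
    unfolding lie_PQR[OF z, symmetric] 1 2 chart.hAA_def chart.hAB_def chart.hBB_def
    using chart.commute(1)[OF _ z] chart.smooth_functions by auto
qed

text \<open>Product rule for \<open>A * M3\<close> and \<open>B * M3\<close>; the derivative of
  \<open>M3\<close> is eliminated because a unit field is orthogonal to its derivative.\<close>

lemma lie_M_components:
  assumes z: "z \<in> \<Omega>"
  shows "lie c M z \<bullet> f1 = lie c A z / \<rho> z - A z * (A z * lie c A z + B z * lie c B z) / \<rho> z ^ 3"
    "lie c M z \<bullet> f2 = lie c B z / \<rho> z - B z * (A z * lie c A z + B z * lie c B z) / \<rho> z ^ 3"
    "lie c M z \<bullet> N t0 p0 = - (A z * (lie c M z \<bullet> f1) + B z * (lie c M z \<bullet> f2))"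
proof -
  have z1: "z \<in> \<Omega>1" "z \<in> \<Omega>0" using z \<Omega>_sub by auto
  have M3': "lie c M3 z = lie c M z \<bullet> N t0 p0"
    unfolding M3_def[abs_def] by (rule lie_inner_const[OF open_\<Omega> smooth_PQR(6) z])
  have sm: "smooth_on \<Omega> (\<lambda>z. M z \<bullet> v)" for v
    by (intro smooth_on_inner smooth_on_const open_\<Omega> smooth_PQR)
  have "lie c M z \<bullet> f1 = lie c (\<lambda>z. A z * M3 z) z"
    unfolding lie_inner_const[OF open_\<Omega> smooth_PQR(6) z, symmetric]
    by (rule lie_cong[OF open_\<Omega>]) (use M_components \<Omega>_sub z sm in auto)
  then have 1: "lie c M z \<bullet> f1 = A z * (lie c M z \<bullet> N t0 p0) + lie c A z * M3 z"
    by (simp add: lie_mult[OF open_\<Omega>] smooth_AB smooth_PQR z M3')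
  have "lie c M z \<bullet> f2 = lie c (\<lambda>z. B z * M3 z) z"
    unfolding lie_inner_const[OF open_\<Omega> smooth_PQR(6) z, symmetric]
    by (rule lie_cong[OF open_\<Omega>]) (use M_components \<Omega>_sub z sm in auto)
  then have 2: "lie c M z \<bullet> f2 = B z * (lie c M z \<bullet> N t0 p0) + lie c B z * M3 z"
    by (simp add: lie_mult[OF open_\<Omega>] smooth_AB smooth_PQR z M3')
  have "M z \<bullet> lie c M z = 0" using M_deriv_orthogonal[OF z1(2)] by (simp add: lie_def)
  then have 3: "A z * (lie c M z \<bullet> f1) + B z * (lie c M z \<bullet> f2) + lie c M z \<bullet> N t0 p0 = 0"
    using M_inner[OF z1(1)] M3_pos[OF z1(1)] by simp
  then show "lie c M z \<bullet> N t0 p0 = - (A z * (lie c M z \<bullet> f1) + B z * (lie c M z \<bullet> f2))" by linarith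
  have m: "M3 z * \<rho> z = 1" using M3_pos[OF z1(1)] by (simp add: \<rho>_def)
  have d: "x / \<rho> z = x * M3 z" "x / \<rho> z ^ 3 = x * M3 z ^ 3" for x
    using M3_pos[OF z1(1)] by (simp_all add: \<rho>_def power_divide)
  show "lie c M z \<bullet> f1 = lie c A z / \<rho> z - A z * (A z * lie c A z + B z * lie c B z) / \<rho> z ^ 3"
    "lie c M z \<bullet> f2 = lie c B z / \<rho> z - B z * (A z * lie c A z + B z * lie c B z) / \<rho> z ^ 3"
    unfolding d using 1 2 3 m \<rho>_sq(1)[OF z1(1)] by algebra+
qed


section \<open>Principal curvatures as roots of a quadratic in the Hessian of the support
  function\<close>

definition "comb \<alpha> \<beta> z = \<alpha> *\<^sub>R fields.a1 z + \<beta> *\<^sub>R fields.a2 z"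

lemma lie_comb:
  assumes "smooth_on \<Omega> f" "z \<in> \<Omega>"
  shows "lie (comb \<alpha> \<beta>) f z = \<alpha> *\<^sub>R lie fields.a1 f z + \<beta> *\<^sub>R lie fields.a2 f z"
proof -
  have lin: "linear (frechet_derivative f (at z))"
    by (rule has_derivative_linear[OF smooth_on_has_derivative[OF open_\<Omega> assms]])
  show ?thesis unfolding lie_def comb_def by (simp only: linear_add[OF lin] linear_cmul[OF lin])
qed

lemma comb_horizontal: "comb \<alpha> \<beta> z = (0, snd (comb \<alpha> \<beta> z))"
  by (simp add: comb_def prod_eq_iff fields.horizontal)

lemma comb_push_forward:
  assumes z: "z \<in> \<Omega>"
  shows "frechet_derivative (X (fst z)) (at (\<phi> (snd z))) (\<phi>' (snd z) (snd (comb \<alpha> \<beta> z))) = lie (comb \<alpha> \<beta>) Y z"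
    "frechet_derivative (N (fst z)) (at (\<phi> (snd z))) (\<phi>' (snd z) (snd (comb \<alpha> \<beta> z))) = lie (comb \<alpha> \<beta>) M z"
proof -
  have z0: "z \<in> \<Omega>0" using z \<Omega>_sub by auto
  define y where "y = snd (comb \<alpha> \<beta> z)"
  have c: "comb \<alpha> \<beta> z = (0, y)" unfolding y_def by (rule comb_horizontal)
  show "frechet_derivative (X (fst z)) (at (\<phi> (snd z))) (\<phi>' (snd z) (snd (comb \<alpha> \<beta> z))) = lie (comb \<alpha> \<beta>) Y z"
    unfolding lie_def c snd_conv Y_def[abs_def] by (rule pullback_derivative(1)[OF smoothX z0, symmetric])
  show "frechet_derivative (N (fst z)) (at (\<phi> (snd z))) (\<phi>' (snd z) (snd (comb \<alpha> \<beta> z))) = lie (comb \<alpha> \<beta>) M z"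
    unfolding lie_def c snd_conv M_def[abs_def] by (rule pullback_derivative(1)[OF smoothN z0, symmetric])
qed

lemma comb_push_forward_eq_0:
  assumes z: "z \<in> \<Omega>" and "\<phi>' (snd z) (snd (comb \<alpha> \<beta> z)) = 0"
  shows "\<alpha> = 0 \<and> \<beta> = 0"
proof -
  have "snd (comb \<alpha> \<beta> z) = 0" using \<phi>'_inj[OF assms(2)] .
  then have "comb \<alpha> \<beta> z = 0" using comb_horizontal[of \<alpha> \<beta> z] by (simp add: prod_eq_iff)
  then have "lie (comb \<alpha> \<beta>) A z = 0" "lie (comb \<alpha> \<beta>) B z = 0"
    unfolding lie_def using linear_0[OF has_derivative_linear[OF smooth_on_has_derivative[OF open_\<Omega> smooth_AB(1) z]]]
      linear_0[OF has_derivative_linear[OF smooth_on_has_derivative[OF open_\<Omega> smooth_AB(2) z]]] by simp_all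
  then show ?thesis using fields.dual[OF z] by (simp add: lie_comb smooth_AB z)
qed

lemma tangent_eq_comb:
  assumes z: "z \<in> \<Omega>" and v: "v \<bullet> \<phi> (snd z) = 0"
  shows "\<exists>\<alpha> \<beta>. v = \<phi>' (snd z) (snd (comb \<alpha> \<beta> z))"
proof -
  define \<tau>1 \<tau>2 where "\<tau>1 = \<phi>' (snd z) (snd (fields.a1 z))" and "\<tau>2 = \<phi>' (snd z) (snd (fields.a2 z))"
  have lin: "linear (\<phi>' (snd z))" by (rule has_derivative_linear[OF \<phi>'])
  have comb: "\<phi>' (snd z) (snd (comb \<alpha> \<beta> z)) = \<alpha> *\<^sub>R \<tau>1 + \<beta> *\<^sub>R \<tau>2" for \<alpha> \<beta>
    by (simp add: comb_def \<tau>1_def \<tau>2_def linear_add[OF lin] linear_cmul[OF lin])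
  have "\<phi> (snd z) \<noteq> 0" using \<phi>_sphere[of "snd z"] by auto
  moreover have "\<tau>1 \<bullet> \<phi> (snd z) = 0" "\<tau>2 \<bullet> \<phi> (snd z) = 0" unfolding \<tau>1_def \<tau>2_def by (rule \<phi>'_tangent)+
  ultimately have "\<exists>\<alpha> \<beta>. v = \<alpha> *\<^sub>R \<tau>1 + \<beta> *\<^sub>R \<tau>2"
    using v comb_push_forward_eq_0[OF z] unfolding comb by (rule orthogonal_complement_span2)
  then show ?thesis unfolding comb .
qed

lemma lie_comb_components:
  assumes z: "z \<in> \<Omega>"
  shows "lie (comb \<alpha> \<beta>) M z \<bullet> f1 = \<alpha> / \<rho> z - A z * (A z * \<alpha> + B z * \<beta>) / \<rho> z ^ 3"
    "lie (comb \<alpha> \<beta>) M z \<bullet> f2 = \<beta> / \<rho> z - B z * (A z * \<alpha> + B z * \<beta>) / \<rho> z ^ 3"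
    "lie (comb \<alpha> \<beta>) Y z \<bullet> f1 = \<alpha> * chart.hAA z + \<beta> * chart.hAB z"
    "lie (comb \<alpha> \<beta>) Y z \<bullet> f2 = \<alpha> * chart.hAB z + \<beta> * chart.hBB z"
  unfolding lie_M_components[OF z] using fields.dual[OF z]
  by (simp_all add: lie_comb smooth_AB smooth_PQR z inner_add_left hess_components)

lemma lie_comb_third:
  assumes z: "z \<in> \<Omega>"
  shows "lie (comb \<alpha> \<beta>) Y z \<bullet> N t0 p0 = - (A z * (lie (comb \<alpha> \<beta>) Y z \<bullet> f1) + B z * (lie (comb \<alpha> \<beta>) Y z \<bullet> f2))"
  using lie_Y_tangent[OF z, of "comb \<alpha> \<beta>"] comb_horizontal[of \<alpha> \<beta> z] by (auto simp: prod_eq_iff)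

lemma princ_curvs_comb:
  assumes z: "z \<in> \<Omega>"
  shows "l \<in> princ_curvs (X (fst z)) (N (fst z)) (\<phi> (snd z)) \<longleftrightarrow>
    (\<exists>\<alpha> \<beta>. (\<alpha>, \<beta>) \<noteq> (0, 0) \<and> lie (comb \<alpha> \<beta>) M z = l *\<^sub>R lie (comb \<alpha> \<beta>) Y z)"
proof
  assume "l \<in> princ_curvs (X (fst z)) (N (fst z)) (\<phi> (snd z))"
  then obtain v where v: "v \<bullet> \<phi> (snd z) = 0" "v \<noteq> 0"
    "frechet_derivative (N (fst z)) (at (\<phi> (snd z))) v = l *\<^sub>R frechet_derivative (X (fst z)) (at (\<phi> (snd z))) v"
    unfolding princ_curvs_def by blast
  obtain \<alpha> \<beta> where ab: "v = \<phi>' (snd z) (snd (comb \<alpha> \<beta> z))" using tangent_eq_comb[OF z v(1)] by blast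
  have "(\<alpha>, \<beta>) \<noteq> (0, 0)"
  proof
    assume "(\<alpha>, \<beta>) = (0, 0)"
    then show False using v(2) linear_0[OF has_derivative_linear[OF \<phi>']] by (simp add: ab comb_def)
  qed
  then show "\<exists>\<alpha> \<beta>. (\<alpha>, \<beta>) \<noteq> (0, 0) \<and> lie (comb \<alpha> \<beta>) M z = l *\<^sub>R lie (comb \<alpha> \<beta>) Y z"
    using v(3) unfolding ab comb_push_forward[OF z] by blast
next
  assume "\<exists>\<alpha> \<beta>. (\<alpha>, \<beta>) \<noteq> (0, 0) \<and> lie (comb \<alpha> \<beta>) M z = l *\<^sub>R lie (comb \<alpha> \<beta>) Y z"
  then obtain \<alpha> \<beta> where ab: "(\<alpha>, \<beta>) \<noteq> (0, 0)" "lie (comb \<alpha> \<beta>) M z = l *\<^sub>R lie (comb \<alpha> \<beta>) Y z" by blast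
  have "\<phi>' (snd z) (snd (comb \<alpha> \<beta> z)) \<noteq> 0" using comb_push_forward_eq_0[OF z] ab(1) by blast
  then show "l \<in> princ_curvs (X (fst z)) (N (fst z)) (\<phi> (snd z))"
    unfolding princ_curvs_def mem_Collect_eq using ab(2) \<phi>'_tangent comb_push_forward[OF z, of \<alpha> \<beta>]
    by (intro exI[of _ "\<phi>' (snd z) (snd (comb \<alpha> \<beta> z))"] conjI) simp_all
qed

lemma princ_curvs_quadratic:
  assumes z: "z \<in> \<Omega>"
  shows "princ_curvs (X (fst z)) (N (fst z)) (\<phi> (snd z))
    = {l. \<rho> z ^ 4 * chart.D z * l\<^sup>2 - \<rho> z * chart.T z * l + 1 = 0}"
proof -
  have "lie (comb \<alpha> \<beta>) M z = l *\<^sub>R lie (comb \<alpha> \<beta>) Y z \<longleftrightarrow>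
    lie (comb \<alpha> \<beta>) M z \<bullet> f1 = l * (lie (comb \<alpha> \<beta>) Y z \<bullet> f1) \<and>
    lie (comb \<alpha> \<beta>) M z \<bullet> f2 = l * (lie (comb \<alpha> \<beta>) Y z \<bullet> f2)" (is "?l \<longleftrightarrow> ?r") for \<alpha> \<beta> l
  proof
    assume r: ?r
    \<comment> \<open>Both derivatives are orthogonal to \<open>M\<close>, so their third components
      depend linearly on the first two in the same way.\<close>
    then have "lie (comb \<alpha> \<beta>) M z \<bullet> N t0 p0 = l * (lie (comb \<alpha> \<beta>) Y z \<bullet> N t0 p0)"
      unfolding lie_M_components(3)[OF z] lie_comb_third[OF z] by (simp add: algebra_simps)
    then show ?l using r
      by (subst orthonormal3_expand[OF frame_f, of "lie (comb \<alpha> \<beta>) M z"],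
          subst orthonormal3_expand[OF frame_f, of "l *\<^sub>R lie (comb \<alpha> \<beta>) Y z"]) simp
  qed simp
  note eq = this
  have z1: "z \<in> \<Omega>1" using z \<Omega>_sub by auto
  show ?thesis
    unfolding set_eq_iff princ_curvs_comb[OF z] eq lie_comb_components[OF z] chart.D_def chart.T_def mem_Collect_eq
    by (intro allI weingarten_characteristic[OF \<rho>_sq(2)[OF z1] \<rho>_sq(1)[OF z1]])
qed

text \<open>A kernel vector of the Hessian would be a nonzero tangent vector annihilated by the
  differential of \<open>X\<close>, against the immersion property.\<close>

lemma D_nonzero:
  assumes z: "z \<in> \<Omega>"
  shows "chart.D z \<noteq> 0"
proof
  assume D: "chart.D z = 0"
  have "\<exists>\<alpha> \<beta>. (\<alpha>, \<beta>) \<noteq> (0, 0) \<and> \<alpha> * chart.hAA z + \<beta> * chart.hAB z = 0 \<and> \<alpha> * chart.hAB z + \<beta> * chart.hBB z = 0"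
  proof (cases "chart.hAA z = 0 \<and> chart.hAB z = 0")
    case True
    then show ?thesis by (intro exI[of _ 1] exI[of _ 0]) simp
  next
    case False
    then show ?thesis using D unfolding chart.D_def
      by (intro exI[of _ "- chart.hAB z"] exI[of _ "chart.hAA z"]) (auto simp: algebra_simps)
  qed
  then obtain \<alpha> \<beta> where ab: "(\<alpha>, \<beta>) \<noteq> (0, 0)"
    "\<alpha> * chart.hAA z + \<beta> * chart.hAB z = 0" "\<alpha> * chart.hAB z + \<beta> * chart.hBB z = 0" by blast
  then have "lie (comb \<alpha> \<beta>) Y z \<bullet> f1 = 0" "lie (comb \<alpha> \<beta>) Y z \<bullet> f2 = 0"
    unfolding lie_comb_components[OF z] by auto
  then have "lie (comb \<alpha> \<beta>) Y z = 0"
    using orthonormal3_expand[OF frame_f, of "lie (comb \<alpha> \<beta>) Y z"] lie_comb_third[OF z, of \<alpha> \<beta>] by simp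
  then have "frechet_derivative (X (fst z)) (at (\<phi> (snd z))) (\<phi>' (snd z) (snd (comb \<alpha> \<beta> z))) = 0"
    unfolding comb_push_forward(1)[OF z] .
  moreover have "fst z \<in> {a<..<b}" using z \<Omega>_sub by (auto simp: \<Omega>0_def)
  ultimately have "\<phi>' (snd z) (snd (comb \<alpha> \<beta> z)) = 0"
    using immersed[THEN bspec, of "fst z", THEN bspec, OF _ \<phi>_sphere] \<phi>'_tangent by blast
  then show False using comb_push_forward_eq_0[OF z] ab(1) by blast
qed

text \<open>Every root of the quadratic is a principal curvature, hence positive by strict
  convexity; this supplies the positivity of \<open>T\<close> and \<open>D\<close> that the flow
  locale and the final sign arguments need.\<close>

lemma princ_curvs_values:
  fixes z
  assumes z: "z \<in> \<Omega>"
  defines "l1 \<equiv> lambda1 (X (fst z)) (N (fst z)) (\<phi> (snd z))" and "l2 \<equiv> lambda2 (X (fst z)) (N (fst z)) (\<phi> (snd z))"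
  shows "chart.T z > 0" "chart.D z > 0"
    "l1 + l2 = chart.T z / (\<rho> z ^ 3 * chart.D z)" "l1 * l2 = 1 / (\<rho> z ^ 4 * chart.D z)"
    "l1 \<in> princ_curvs (X (fst z)) (N (fst z)) (\<phi> (snd z))"
proof -
  let ?c1 = "\<rho> z * chart.T z" and ?c2 = "\<rho> z ^ 4 * chart.D z"
  have \<rho>: "\<rho> z > 0" "\<rho> z * \<rho> z = 1 + A z * A z + B z * B z" using \<rho>_sq[of z] z \<Omega>_sub by blast+
  have c2: "?c2 \<noteq> 0" using D_nonzero[OF z] \<rho> by simp
  have disc: "?c1\<^sup>2 \<ge> 4 * ?c2"
  proof -
    have "4 * (\<rho> z * \<rho> z) * chart.D z \<le> (chart.T z)\<^sup>2"
      using trace_det_ineq unfolding \<rho>(2) chart.D_def chart.T_def .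
    then have "(\<rho> z)\<^sup>2 * (4 * (\<rho> z * \<rho> z) * chart.D z) \<le> (\<rho> z)\<^sup>2 * (chart.T z)\<^sup>2"
      by (intro mult_left_mono) auto
    then show ?thesis by (simp add: power_mult_distrib power4_eq_xxxx power2_eq_square algebra_simps)
  qed
  have roots_pos: "l > 0" if "?c2 * l\<^sup>2 - ?c1 * l + 1 = 0" for l
  proof -
    have "l \<in> princ_curvs (X (fst z)) (N (fst z)) (\<phi> (snd z))"
      using that unfolding princ_curvs_quadratic[OF z] by simp
    moreover have "fst z \<in> {a<..<b}" using z \<Omega>_sub by (auto simp: \<Omega>0_def)
    ultimately show ?thesis using strictly_convex \<phi>_sphere by blast
  qed
  have *: "?c1 > 0" "?c2 > 0" "l1 + l2 = ?c1 / ?c2" "l1 * l2 = 1 / ?c2"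
    "l1 \<in> {l. ?c2 * l\<^sup>2 - ?c1 * l + 1 = 0}"
    unfolding l1_def l2_def lambda1_def lambda2_def princ_curvs_quadratic[OF z]
    by (rule Min_Max_quadratic_roots[OF c2 disc roots_pos]; assumption)+
  show "chart.T z > 0" "chart.D z > 0" using *(1,2) \<rho>(1) by (simp_all add: zero_less_mult_iff)
  show "l1 * l2 = 1 / (\<rho> z ^ 4 * chart.D z)" by (rule *)
  have "?c1 / ?c2 = chart.T z / (\<rho> z ^ 3 * chart.D z)"
    using \<rho>(1) by (simp add: power4_eq_xxxx power3_eq_cube)
  then show "l1 + l2 = chart.T z / (\<rho> z ^ 3 * chart.D z)" using *(3) by simp
  show "l1 \<in> princ_curvs (X (fst z)) (N (fst z)) (\<phi> (snd z))"
    using *(5) unfolding princ_curvs_quadratic[OF z] .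
qed

text \<open>\<open>a0\<close> fixes \<open>A\<close> and \<open>B\<close>, so \<open>h\<close>
  changes by \<rho> times the normal component of the velocity; the tangential corrections in
  \<open>a0\<close> do not contribute to that component, which is \<open>1 / H\<close>.\<close>

lemma lie_a0_h:
  assumes z: "z \<in> \<Omega>"
  shows "lie fields.a0 h z = \<rho> z * chart.F z"
proof -
  let ?H = "mean_curv (X (fst z)) (N (fst z)) (\<phi> (snd z))"
  have H: "1 / ?H = chart.F z"
    unfolding mean_curv_def princ_curvs_values(3)[OF z] chart.F_def by (simp add: power3_eq_cube)
  have z1: "z \<in> \<Omega>1" "z \<in> \<Omega>0" using z \<Omega>_sub by auto
  have "dt Y z = frechet_derivative Y (at z) (1, 0)" by (simp add: lie_def zero_prod_def)
  then have dtY: "dt Y z = chart.F z *\<^sub>R M z" unfolding Y_deriv_time[OF z1(2)] H .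
  have orth: "M z \<bullet> lie fields.a1 Y z = 0" "M z \<bullet> lie fields.a2 Y z = 0"
    using lie_Y_tangent[OF z] fields.horizontal by (simp_all add: M_inner[OF z1(1)])
  have "M z \<bullet> lie fields.a0 Y z = chart.F z"
    by (simp add: fields.lie_a0[OF smooth_PQR(5) z] inner_diff_right orth dtY unit_M[OF z1(2)])
  then have "M3 z * lie fields.a0 h z = chart.F z"
    unfolding M_inner[OF z1(1)] using lie_h[OF z, of fields.a0] fields.dual[OF z] by simp
  then show ?thesis using M3_pos[OF z1(1)] by (simp add: \<rho>_def field_simps)
qed

sublocale chart: gauss_chart_flow \<Omega> fields.a0 fields.a1 fields.a2 A B h \<rho>
  by unfold_locales (auto simp: princ_curvs_values(1) lie_a0_h)

text \<open>Were the Jacobian zero at the base point, some nonzero tangent vector would be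
  annihilated by the differential of \<open>N\<close>, and 0 would be a principal curvature.\<close>

lemma base_point: "(t0, 0, 0) \<in> \<Omega>" "A (t0, 0, 0) = 0" "B (t0, 0, 0) = 0"
proof -
  let ?z = "(t0, 0, 0) :: real \<times> real \<times> real"
  have M: "M ?z = N t0 p0" by (simp add: M_def \<phi>_0)
  have o: "N t0 p0 \<bullet> N t0 p0 = 1" "N t0 p0 \<bullet> f1 = 0" "N t0 p0 \<bullet> f2 = 0"
    using frame_f by (simp_all add: orthonormal3_def inner_commute)
  have M3: "M3 ?z = 1" by (simp add: M3_def M o)
  show AB: "A ?z = 0" "B ?z = 0" by (simp_all add: A_def B_def M o)
  have z0: "?z \<in> \<Omega>0" using t0 by (simp add: \<Omega>0_def)
  then have z1: "?z \<in> \<Omega>1" by (simp add: \<Omega>1_def M3)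
  have "du A ?z * dv B ?z - dv A ?z * du B ?z \<noteq> 0"
  proof
    assume J: "du A ?z * dv B ?z - dv A ?z * du B ?z = 0"
    have "\<exists>x y. (x, y) \<noteq> (0, 0) \<and> x * du A ?z + y * dv A ?z = 0 \<and> x * du B ?z + y * dv B ?z = 0"
    proof (cases "du A ?z = 0 \<and> dv A ?z = 0")
      case True
      show ?thesis
      proof (cases "du B ?z = 0 \<and> dv B ?z = 0")
        case True
        then show ?thesis using \<open>du A ?z = 0 \<and> dv A ?z = 0\<close> by (intro exI[of _ 1] exI[of _ 0]) simp
      next
        case False
        then show ?thesis using True
          by (intro exI[of _ "- dv B ?z"] exI[of _ "du B ?z"]) auto
      qed
    next
      case False
      then show ?thesis using J
        by (intro exI[of _ "- dv A ?z"] exI[of _ "du A ?z"]) (auto simp: algebra_simps)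
    qed
    then obtain x y where xy: "(x, y) \<noteq> (0, 0)" "x * du A ?z + y * dv A ?z = 0" "x * du B ?z + y * dv B ?z = 0"
      by blast
    let ?c = "\<lambda>_ :: real \<times> real \<times> real. (0 :: real, x, y)"
    have exp: "lie ?c f ?z = x * du f ?z + y * dv f ?z" if "smooth_on \<Omega>1 f" for f :: "_ \<Rightarrow> real"
    proof -
      have lin: "linear (frechet_derivative f (at ?z))"
        by (rule has_derivative_linear[OF smooth_on_has_derivative[OF open_\<Omega>1 that z1]])
      have "(0, x, y) = x *\<^sub>R (0, 1, 0) + y *\<^sub>R ((0, 0, 1) :: real \<times> real \<times> real)" by simp
      then show ?thesis unfolding lie_def
        by (simp only: linear_add[OF lin] linear_cmul[OF lin] real_scaleR_def)
    qed
    have cA: "lie ?c A ?z = 0" "lie ?c B ?z = 0" using exp smooth_AB1 xy by auto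
    have sm: "smooth_on \<Omega>1 M" "smooth_on \<Omega>1 M3"
      by (rule smooth_on_subset_open[OF open_\<Omega>0 open_\<Omega>1 \<Omega>1_\<Omega>0], rule smooth_YM smooth_components)+
    have smi: "smooth_on \<Omega>1 (\<lambda>z. M z \<bullet> v)" for v
      by (intro smooth_on_inner smooth_on_const open_\<Omega>1 sm)
    have "lie ?c M ?z \<bullet> f1 = lie ?c (\<lambda>z. A z * M3 z) ?z" "lie ?c M ?z \<bullet> f2 = lie ?c (\<lambda>z. B z * M3 z) ?z"
      unfolding lie_inner_const[OF open_\<Omega>1 sm(1) z1, symmetric]
      by (rule lie_cong[OF open_\<Omega>1]; use M_components smi z1 in auto)+
    then have "lie ?c M ?z \<bullet> f1 = 0" "lie ?c M ?z \<bullet> f2 = 0"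
      by (simp_all add: lie_mult[OF open_\<Omega>1] smooth_AB1 sm z1 AB cA)
    moreover have "lie ?c M ?z \<bullet> N t0 p0 = 0"
      using M_deriv_orthogonal[OF z0] by (simp add: lie_def M inner_commute)
    ultimately have "lie ?c M ?z = 0"
      using orthonormal3_expand[OF frame_f, of "lie ?c M ?z"] by simp
    then have "frechet_derivative (N t0) (at p0) (\<phi>' (0, 0) (x, y)) = 0"
      using pullback_derivative(1)[OF smoothN z0, of "(x, y)"] by (simp add: lie_def M_def[abs_def] \<phi>_0)
    moreover have "\<phi>' (0, 0) (x, y) \<noteq> 0" using \<phi>'_inj[of "(0, 0)" "(x, y)"] xy(1) by (auto simp: zero_prod_def)
    moreover have "\<phi>' (0, 0) (x, y) \<bullet> p0 = 0" using \<phi>'_tangent[of "(0, 0)"] by (simp add: \<phi>_0)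
    ultimately have "0 \<in> princ_curvs (X t0) (N t0) p0" unfolding princ_curvs_def by auto
    then show False using strictly_convex t0 p0 by blast
  qed
  then show "?z \<in> \<Omega>" using z1 by (simp add: \<Omega>_def)
qed

end

section \<open>The pinching quantities on the sphere and their expression in charts\<close>

context imcf
begin

abbreviation "\<kappa>1 t \<equiv> lambda1 (X t) (N t)"
abbreviation "\<kappa>2 t \<equiv> lambda2 (X t) (N t)"

definition "pinch1 t p = (\<kappa>1 t p - \<kappa>2 t p)^2 / (2 * (\<kappa>1 t p + \<kappa>2 t p) * \<kappa>1 t p * \<kappa>2 t p)"
definition "pinch2 t p = ((\<kappa>1 t p)^2 + (\<kappa>2 t p)^2) * (\<kappa>1 t p - \<kappa>2 t p)^2 /
  (8 * (\<kappa>1 t p + \<kappa>2 t p) * (\<kappa>1 t p)^3 * (\<kappa>2 t p)^3)"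

end

context imcf_chart
begin

text \<open>Both quantities are rational in the sum \<open>x\<close> and product \<open>y\<close> of
  the curvatures, which makes them smooth in the chart across umbilic points.\<close>

lemma pinch_chart:
  assumes z: "z \<in> \<Omega>"
  shows "chart.linear_pinching z / 2 = pinch1 (fst z) (\<phi> (snd z))"
    "chart.cubic_pinching z / 8 = pinch2 (fst z) (\<phi> (snd z))"
proof -
  define l m where "l = \<kappa>1 (fst z) (\<phi> (snd z))" and "m = \<kappa>2 (fst z) (\<phi> (snd z))"
  note v = princ_curvs_values[OF z, folded l_def m_def]
  have \<rho>: "\<rho> z > 0" using \<rho>_sq z \<Omega>_sub by blast
  have lm: "l + m > 0" "l * m > 0" unfolding v(3,4) using v(1,2) \<rho> by simp_all
  then have "l \<noteq> 0" "m \<noteq> 0" by auto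
  have F: "chart.F z = 1 / (l + m)" unfolding v(3) chart.F_def by (simp add: power3_eq_cube)
  have \<sigma>: "chart.\<sigma> z = (l + m) / (l * m)"
    unfolding v(3,4) chart.\<sigma>_def using v(2) \<rho> by (simp add: power3_eq_cube power4_eq_xxxx)
  define x y where "x = l + m" and "y = l * m"
  have xy: "x > 0" "y > 0" using lm by (simp_all add: x_def y_def)
  have "(l - m)\<^sup>2 = x\<^sup>2 - 4 * y" "l\<^sup>2 + m\<^sup>2 = x\<^sup>2 - 2 * y"
    by (simp_all add: x_def y_def power2_eq_square algebra_simps)
  moreover have "2 * (l + m) * l * m = 2 * x * y" "8 * (l + m) * l ^ 3 * m ^ 3 = 8 * x * y ^ 3"
    by (simp_all add: x_def y_def power_mult_distrib)
  ultimately have p: "pinch1 (fst z) (\<phi> (snd z)) = (x\<^sup>2 - 4 * y) / (2 * x * y)"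
    "pinch2 (fst z) (\<phi> (snd z)) = (x\<^sup>2 - 2 * y) * (x\<^sup>2 - 4 * y) / (8 * x * y ^ 3)"
    unfolding pinch1_def pinch2_def l_def[symmetric] m_def[symmetric] by simp_all
  have l: "chart.linear_pinching z / 2 = (x\<^sup>2 - 4 * y) / (2 * x * y)"
    unfolding chart.linear_pinching_def F \<sigma> x_def[symmetric] y_def[symmetric]
    using xy by (simp add: field_simps power2_eq_square)
  have c: "chart.cubic_pinching z / 8 = (x\<^sup>2 - 2 * y) * (x\<^sup>2 - 4 * y) / (8 * x * y ^ 3)"
    unfolding chart.cubic_pinching_def F \<sigma> x_def[symmetric] y_def[symmetric]
    using xy by (simp add: field_simps power2_eq_square power3_eq_cube)
  show "chart.linear_pinching z / 2 = pinch1 (fst z) (\<phi> (snd z))"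
    "chart.cubic_pinching z / 8 = pinch2 (fst z) (\<phi> (snd z))" unfolding p l c by (rule refl)+
qed

text \<open>Continuity passes from the chart to the sphere through \<open>\<psi>\<close>, which
  inverts \<open>\<phi>\<close> near \<open>p0\<close>.\<close>

lemma chart_continuous:
  fixes w :: "real \<Rightarrow> real^3 \<Rightarrow> real"
  assumes g: "smooth_on \<Omega> g" and w: "\<And>z. z \<in> \<Omega> \<Longrightarrow> g z = w (fst z) (\<phi> (snd z))"
  shows "continuous (at (t0, p0) within {a<..<b} \<times> sphere 0 1) (\<lambda>x. w (fst x) (snd x))"
proof -
  define \<zeta> where "\<zeta> x = (fst x :: real, \<psi> (snd x))" for x
  have "p0 \<bullet> p0 = 1" using sphere_inner[OF p0] .
  then have d: "1 + p0 \<bullet> p0 > 0" by simp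
  have \<zeta>0: "\<zeta> (t0, p0) = (t0, 0, 0)"
    using frame_e by (simp add: \<zeta>_def \<psi>_def orthonormal3_def inner_commute)
  have \<zeta>: "isCont \<zeta> (t0, p0)"
    unfolding \<zeta>_def[abs_def] \<psi>_def using d by (intro continuous_intros) auto
  moreover have "isCont g (\<zeta> (t0, p0))"
    unfolding \<zeta>0 using smooth_on_continuous[OF open_\<Omega> g] open_\<Omega> base_point(1) continuous_on_eq_continuous_at by blast
  ultimately have "isCont (\<lambda>x. g (\<zeta> x)) (t0, p0)" by (rule isCont_o2)
  then have lim: "((\<lambda>x. g (\<zeta> x)) \<longlongrightarrow> g (\<zeta> (t0, p0))) (at (t0, p0) within {a<..<b} \<times> sphere 0 1)"
    unfolding isCont_def by (rule filterlim_mono) (auto simp: at_le)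
  have "\<forall>\<^sub>F x in at (t0, p0). \<zeta> x \<in> \<Omega>"
    using \<zeta> open_\<Omega> base_point(1) unfolding isCont_def \<zeta>0 by (rule topological_tendstoD)
  then have 1: "\<forall>\<^sub>F x in at (t0, p0) within {a<..<b} \<times> sphere 0 1. \<zeta> x \<in> \<Omega>"
    by (rule filter_leD[OF at_le, rotated]) simp
  have "isCont (\<lambda>x :: real \<times> (real^3). 1 + snd x \<bullet> p0) (t0, p0)" by (intro continuous_intros)
  then have "\<forall>\<^sub>F x :: real \<times> (real^3) in at (t0, p0). 1 + snd x \<bullet> p0 > 0"
    unfolding isCont_def by (rule order_tendstoD) (use d in simp)
  then have 2: "\<forall>\<^sub>F x :: real \<times> (real^3) in at (t0, p0) within {a<..<b} \<times> sphere 0 1. 1 + snd x \<bullet> p0 > 0"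
    by (rule filter_leD[OF at_le, rotated]) simp
  have 3: "\<forall>\<^sub>F x in at (t0, p0) within {a<..<b} \<times> sphere 0 1. x \<in> {a<..<b} \<times> sphere 0 1"
    by (simp add: eventually_at_filter)
  have "\<forall>\<^sub>F x in at (t0, p0) within {a<..<b} \<times> sphere 0 1. g (\<zeta> x) = w (fst x) (snd x)"
    using 1 2 3
  proof eventually_elim
    case (elim x)
    then have "\<phi> (\<psi> (snd x)) = snd x" by (intro \<phi>_\<psi>) auto
    then show ?case using w[OF elim(1)] by (simp add: \<zeta>_def)
  qed
  moreover have "g (\<zeta> (t0, p0)) = w t0 p0" using w[OF base_point(1)] by (simp add: \<zeta>0 \<phi>_0)
  ultimately show ?thesis
    unfolding continuous_within using Lim_transform_eventually[OF lim] by simp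
qed

text \<open>At a spatial maximum \<open>a1\<close> and \<open>a2\<close> annihilate
  \<open>g\<close>, so its derivative at fixed \<open>p0\<close> agrees with the one at fixed
  normal.\<close>

lemma chart_decreasing:
  fixes w :: "real \<Rightarrow> real^3 \<Rightarrow> real"
  assumes g: "smooth_on \<Omega> g" and w: "\<And>z. z \<in> \<Omega> \<Longrightarrow> g z = w (fst z) (\<phi> (snd z))"
    and max: "\<And>q. q \<in> sphere 0 1 \<Longrightarrow> w t0 q \<le> w t0 p0"
    and evolution: "(\<And>y. y \<in> \<Omega> \<Longrightarrow> fst y = t0 \<Longrightarrow> g y \<le> g (t0, 0, 0)) \<Longrightarrow> lie fields.a0 g (t0, 0, 0) \<le> 0"
  shows "\<exists>d\<le>0. ((\<lambda>t. w t p0) has_real_derivative d) (at t0)"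
proof -
  let ?z = "(t0, 0, 0) :: real \<times> real \<times> real"
  note z = base_point(1)
  have gmax: "g y \<le> g ?z" if "y \<in> \<Omega>" "fst y = t0" for y
    using w[OF that(1)] w[OF z] max[OF \<phi>_sphere] that(2) by (simp add: \<phi>_0)
  have "lie fields.a1 g ?z = 0" "lie fields.a2 g ?z = 0"
    by (rule lie_max(1)[OF open_\<Omega> g _ z]; use gmax fields.smooth_a12 fields.horizontal in auto)+
  then have "dt g ?z = lie fields.a0 g ?z" by (simp add: fields.lie_a0[OF g z])
  then have d: "dt g ?z \<le> 0" using evolution[OF gmax] by simp
  have "((\<lambda>s. g (0 + s *\<^sub>R (1, 0, 0))) has_real_derivative dt g ?z) (at t0)"
    unfolding lie_def
    by (rule has_real_derivative_along_line)
      (use smooth_on_has_derivative[OF open_\<Omega> g z] in simp)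
  then have "((\<lambda>s. g (s, 0, 0)) has_real_derivative dt g ?z) (at t0)" by simp
  moreover have "open ((\<lambda>s. (s, 0, 0) :: real \<times> real \<times> real) -` \<Omega>)"
    by (intro open_vimage open_\<Omega> continuous_intros)
  ultimately have "((\<lambda>t. w t p0) has_real_derivative dt g ?z) (at t0)"
    by (rule has_field_derivative_transform_within_open) (use z w \<phi>_0 in auto)
  then show ?thesis using d by blast
qed

text \<open>If \<open>f1\<close> points along the image of a principal direction, the derivatives of
  both \<open>M\<close> and \<open>Y\<close> in that direction are orthogonal to \<open>f2\<close>.
  At the vertex the first forces \<beta> to vanish, and then the second gives
  \<open>hAB = 0\<close>.\<close>

lemma principal_frame:
  assumes v: "v \<bullet> p0 = 0" "v \<noteq> 0"
    "frechet_derivative (N t0) (at p0) v = l *\<^sub>R frechet_derivative (X t0) (at p0) v"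
    and f1: "frechet_derivative (X t0) (at p0) v = c *\<^sub>R f1"
  shows "chart.hAB (t0, 0, 0) = 0"
proof -
  let ?z = "(t0, 0, 0) :: real \<times> real \<times> real"
  note z = base_point(1)
  obtain \<alpha> \<beta> where ab: "v = \<phi>' (0, 0) (snd (comb \<alpha> \<beta> ?z))"
    using tangent_eq_comb[OF z, of v] v(1) unfolding snd_conv \<phi>_0 by blast
  have "f1 \<bullet> f2 = 0" using frame_f by (simp add: orthonormal3_def)
  then have 0: "lie (comb \<alpha> \<beta>) Y ?z \<bullet> f2 = 0" "lie (comb \<alpha> \<beta>) M ?z \<bullet> f2 = 0"
    using comb_push_forward[OF z, of \<alpha> \<beta>] v(3) f1 by (simp_all add: ab \<phi>_0)
  have "\<rho> ?z > 0" using \<rho>_sq(2) z \<Omega>_sub by blast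
  then have \<beta>: "\<beta> = 0" using 0(2) lie_comb_components(2)[OF z] base_point(2,3) by simp
  have "\<alpha> \<noteq> 0"
  proof
    assume "\<alpha> = 0"
    then show False using v(2) \<beta> linear_0[OF has_derivative_linear[OF \<phi>']] by (simp add: ab comb_def)
  qed
  then show ?thesis using 0(1) lie_comb_components(4)[OF z] \<beta> by simp
qed

lemma hess_positive:
  assumes "chart.hAB (t0, 0, 0) = 0"
  shows "chart.hAA (t0, 0, 0) > 0" "chart.hBB (t0, 0, 0) > 0"
  using princ_curvs_values(1,2)[OF base_point(1)] assms base_point
  unfolding chart.T_def chart.D_def by (auto simp: zero_less_mult_iff)

end

context imcf
begin

lemma exists_chart:
  assumes "t0 \<in> {a<..<b}" "p0 \<in> sphere 0 1"
  shows "\<exists>e1 e2 f1 f2. imcf_chart X N a b U t0 p0 e1 e2 f1 f2"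
proof -
  have "N t0 p0 \<bullet> N t0 p0 = 1" using unit_normal assms by (simp add: norm_eq_1)
  then show ?thesis
    using orthonormal3_exists[OF sphere_inner[OF assms(2)]] orthonormal3_exists[of "N t0 p0"] assms
    by (auto simp: imcf_chart_def imcf_chart_axioms_def intro: imcf_axioms)
qed

lemma pinch_continuous:
  "continuous_on ({a<..<b} \<times> sphere 0 1) (\<lambda>x. pinch1 (fst x) (snd x))"
  "continuous_on ({a<..<b} \<times> sphere 0 1) (\<lambda>x. pinch2 (fst x) (snd x))"
proof -
  have "continuous (at (t0, p0) within {a<..<b} \<times> sphere 0 1) (\<lambda>x. pinch1 (fst x) (snd x)) \<and>
      continuous (at (t0, p0) within {a<..<b} \<times> sphere 0 1) (\<lambda>x. pinch2 (fst x) (snd x))"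
    if tp: "t0 \<in> {a<..<b}" "p0 \<in> sphere 0 1" for t0 p0
  proof -
    obtain e1 e2 f1 f2 where "imcf_chart X N a b U t0 p0 e1 e2 f1 f2" using exists_chart[OF tp] by blast
    then interpret imcf_chart X N a b U t0 p0 e1 e2 f1 f2 .
    have "smooth_on \<Omega> (\<lambda>z. chart.linear_pinching z / 2)" "smooth_on \<Omega> (\<lambda>z. chart.cubic_pinching z / 8)"
      by (intro smooth_on_divide smooth_on_const open_\<Omega> chart.smooth_pinching; simp)+
    then show ?thesis using chart_continuous pinch_chart by blast
  qed
  then show "continuous_on ({a<..<b} \<times> sphere 0 1) (\<lambda>x. pinch1 (fst x) (snd x))"
    "continuous_on ({a<..<b} \<times> sphere 0 1) (\<lambda>x. pinch2 (fst x) (snd x))"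
    unfolding continuous_on_eq_continuous_within by auto
qed

text \<open>Done in two stages: a chart with an arbitrary frame shows that a principal direction
  exists, and the frame of the Gauss image is then rotated to the image of that direction.\<close>

lemma exists_principal_chart:
  assumes tp: "t0 \<in> {a<..<b}" "p0 \<in> sphere 0 1"
  obtains e1 e2 f1 f2 v l c where "imcf_chart X N a b U t0 p0 e1 e2 f1 f2"
    "v \<bullet> p0 = 0" "v \<noteq> 0" "frechet_derivative (N t0) (at p0) v = l *\<^sub>R frechet_derivative (X t0) (at p0) v"
    "frechet_derivative (X t0) (at p0) v = c *\<^sub>R f1"
proof -
  obtain e1 e2 f1 f2 where ch: "imcf_chart X N a b U t0 p0 e1 e2 f1 f2" using exists_chart[OF tp] by blast
  then interpret imcf_chart X N a b U t0 p0 e1 e2 f1 f2 .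
  have "\<kappa>1 t0 p0 \<in> princ_curvs (X t0) (N t0) p0"
    using princ_curvs_values(5)[OF base_point(1)] by (simp add: \<phi>_0)
  then obtain v where v: "v \<bullet> p0 = 0" "v \<noteq> 0"
    "frechet_derivative (N t0) (at p0) v = \<kappa>1 t0 p0 *\<^sub>R frechet_derivative (X t0) (at p0) v"
    unfolding princ_curvs_def by blast
  define x where "x = frechet_derivative (X t0) (at p0) v"
  have x: "x \<noteq> 0" using immersed tp v unfolding x_def by blast
  have "x \<bullet> N t0 p0 = 0" using unit_normal tp v unfolding x_def by (auto simp: inner_commute)
  moreover have "(x /\<^sub>R norm x) \<bullet> (x /\<^sub>R norm x) = 1" unfolding norm_eq_1[symmetric] using x by simp
  moreover have "N t0 p0 \<bullet> N t0 p0 = 1" using unit_normal tp by (simp add: norm_eq_1)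
  ultimately obtain g where "orthonormal3 (x /\<^sub>R norm x) g (N t0 p0)"
    using orthonormal3_completion[of "x /\<^sub>R norm x" "N t0 p0"] by auto
  then have "imcf_chart X N a b U t0 p0 e1 e2 (x /\<^sub>R norm x) g"
    using ch by (auto simp: imcf_chart_def imcf_chart_axioms_def)
  moreover have "frechet_derivative (X t0) (at p0) v = norm x *\<^sub>R (x /\<^sub>R norm x)"
    using x by (simp add: x_def)
  ultimately show ?thesis using that v by blast
qed

lemma pinch_decreasing_at_max:
  assumes tp: "t0 \<in> {a<..<b}" "p0 \<in> sphere 0 1"
  shows "(\<And>q. q \<in> sphere 0 1 \<Longrightarrow> pinch1 t0 q \<le> pinch1 t0 p0) \<Longrightarrow>
      \<exists>d\<le>0. ((\<lambda>t. pinch1 t p0) has_real_derivative d) (at t0)"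
    and "(\<And>q. q \<in> sphere 0 1 \<Longrightarrow> pinch2 t0 q \<le> pinch2 t0 p0) \<Longrightarrow>
      \<exists>d\<le>0. ((\<lambda>t. pinch2 t p0) has_real_derivative d) (at t0)"
proof -
  obtain e1 e2 f1 f2 v l c where ch: "imcf_chart X N a b U t0 p0 e1 e2 f1 f2"
    and v: "v \<bullet> p0 = 0" "v \<noteq> 0" "frechet_derivative (N t0) (at p0) v = l *\<^sub>R frechet_derivative (X t0) (at p0) v"
    "frechet_derivative (X t0) (at p0) v = c *\<^sub>R f1"
    by (rule exists_principal_chart[OF tp])
  from ch interpret imcf_chart X N a b U t0 p0 e1 e2 f1 f2 .
  let ?z = "(t0, 0, 0) :: real \<times> real \<times> real"
  note hAB = principal_frame[OF v]
  note vertex = base_point hAB hess_positive[OF hAB]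
  have scale: "lie fields.a0 (\<lambda>z. g z / k) ?z = lie fields.a0 g ?z / k" if "smooth_on \<Omega> g" for g :: "_ \<Rightarrow> real" and k
    using lie_mult[OF open_\<Omega> that smooth_on_const[OF open_\<Omega>] base_point(1), of fields.a0 "1 / k"]
    by (simp add: lie_const[OF open_\<Omega>])
  have sm: "smooth_on \<Omega> (\<lambda>z. chart.linear_pinching z / 2)" "smooth_on \<Omega> (\<lambda>z. chart.cubic_pinching z / 8)"
    by (intro smooth_on_divide smooth_on_const open_\<Omega> chart.smooth_pinching; simp)+
  show "\<exists>d\<le>0. ((\<lambda>t. pinch1 t p0) has_real_derivative d) (at t0)"
    if "\<And>q. q \<in> sphere 0 1 \<Longrightarrow> pinch1 t0 q \<le> pinch1 t0 p0"
    by (rule chart_decreasing[OF sm(1) pinch_chart(1) that])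
      (use chart.linear_pinching_max[OF vertex] scale[OF chart.smooth_pinching(1)] in auto)
  show "\<exists>d\<le>0. ((\<lambda>t. pinch2 t p0) has_real_derivative d) (at t0)"
    if "\<And>q. q \<in> sphere 0 1 \<Longrightarrow> pinch2 t0 q \<le> pinch2 t0 p0"
    by (rule chart_decreasing[OF sm(2) pinch_chart(2) that])
      (use chart.cubic_pinching_max[OF vertex] scale[OF chart.smooth_pinching(2)] in auto)
qed

lemma pinch_nonincreasing:
  assumes "a < s" "s \<le> t" "t < b"
  shows "(SUP p\<in>sphere 0 1. pinch1 t p) \<le> (SUP p\<in>sphere 0 1. pinch1 s p)"
    "(SUP p\<in>sphere 0 1. pinch2 t p) \<le> (SUP p\<in>sphere 0 1. pinch2 s p)"
proof -
  have K: "compact (sphere (0 :: real^3) 1)" "sphere (0 :: real^3) 1 \<noteq> {}" by simp_all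
  show "(SUP p\<in>sphere 0 1. pinch1 t p) \<le> (SUP p\<in>sphere 0 1. pinch1 s p)"
    by (rule SUP_nonincreasing_if_decreasing_at_max[OF K pinch_continuous(1) pinch_decreasing_at_max(1) assms])
  show "(SUP p\<in>sphere 0 1. pinch2 t p) \<le> (SUP p\<in>sphere 0 1. pinch2 s p)"
    by (rule SUP_nonincreasing_if_decreasing_at_max[OF K pinch_continuous(2) pinch_decreasing_at_max(2) assms])
qed

end

theorem theorem10p8:
  fixes X N :: "real \<Rightarrow> real^3 \<Rightarrow> real^3" and a b :: real and U :: "(real^3) set"
  assumes "a < b" and "open U" and "sphere 0 1 \<subseteq> U"
    and smoothX: "smooth_on ({a<..<b} \<times> U) (\<lambda>(t, x). X t x)"
    and smoothN: "smooth_on ({a<..<b} \<times> U) (\<lambda>(t, x). N t x)"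
    and embedded: "\<forall>t\<in>{a<..<b}. inj_on (X t) (sphere 0 1)"
    and immersed: "\<forall>t\<in>{a<..<b}. \<forall>p\<in>sphere 0 1. \<forall>v. v \<bullet> p = 0 \<and>
         frechet_derivative (X t) (at p) v = 0 \<longrightarrow> v = 0"
    and unit_normal: "\<forall>t\<in>{a<..<b}. \<forall>p\<in>sphere 0 1. norm (N t p) = 1 \<and>
         (\<forall>v. v \<bullet> p = 0 \<longrightarrow> N t p \<bullet> frechet_derivative (X t) (at p) v = 0)"
    and outer: "\<forall>t\<in>{a<..<b}. \<forall>p\<in>sphere 0 1. \<forall>q\<in>sphere 0 1.
         (X t q - X t p) \<bullet> N t p \<le> 0"
    and strictly_convex: "\<forall>t\<in>{a<..<b}. \<forall>p\<in>sphere 0 1.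
         \<forall>l\<in>princ_curvs (X t) (N t) p. l > 0"
    and flow: "\<forall>t\<in>{a<..<b}. \<forall>p\<in>sphere 0 1.
         ((\<lambda>s. X s p) has_vector_derivative
            (1 / mean_curv (X t) (N t) p) *\<^sub>R N t p) (at t)"
  shows "\<forall>s t. a < s \<and> s \<le> t \<and> t < b \<longrightarrow>
      (SUP p\<in>sphere 0 1. (lambda1 (X t) (N t) p - lambda2 (X t) (N t) p)^2 /
          (2 * (lambda1 (X t) (N t) p + lambda2 (X t) (N t) p) *
               lambda1 (X t) (N t) p * lambda2 (X t) (N t) p))
      \<le> (SUP p\<in>sphere 0 1. (lambda1 (X s) (N s) p - lambda2 (X s) (N s) p)^2 /
          (2 * (lambda1 (X s) (N s) p + lambda2 (X s) (N s) p) *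
               lambda1 (X s) (N s) p * lambda2 (X s) (N s) p))
    \<and> (SUP p\<in>sphere 0 1. ((lambda1 (X t) (N t) p)^2 + (lambda2 (X t) (N t) p)^2) *
          (lambda1 (X t) (N t) p - lambda2 (X t) (N t) p)^2 /
          (8 * (lambda1 (X t) (N t) p + lambda2 (X t) (N t) p) *
               (lambda1 (X t) (N t) p)^3 * (lambda2 (X t) (N t) p)^3))
      \<le> (SUP p\<in>sphere 0 1. ((lambda1 (X s) (N s) p)^2 + (lambda2 (X s) (N s) p)^2) *
          (lambda1 (X s) (N s) p - lambda2 (X s) (N s) p)^2 /
          (8 * (lambda1 (X s) (N s) p + lambda2 (X s) (N s) p) *
               (lambda1 (X s) (N s) p)^3 * (lambda2 (X s) (N s) p)^3))"
proof -
  interpret imcf X N a b U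
    by standard (fact assms)+
  show ?thesis
    using pinch_nonincreasing unfolding pinch1_def pinch2_def by blast
qed

end
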